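(* Let $q_0>0$, $d_0>0$, $\sigma>0$ and $x<q_0$. For $b\in[0,1]$ let $Q^{(b)}=(Q^{(b)}_t)_{t\geqslant 0}$ be the solution of $$\mathrm{d}Q_t = -\frac{d_0Q_t}{1+bd_0t}\,\mathrm{d}t + \sigma Q_t\,\mathrm{d}B_t,\qquad Q_0=q_0,$$ where $(B_t)$ is a standard Brownian motion, and let $T_{Q,x}(b)=\inf\{t\geqslant 0: Q^{(b)}_t=x\}$. If $0\leqslant b_1\leqslant b_2\leqslant 1$, then $T_{Q,x}(b_1)\preceq_{st}T_{Q,x}(b_2)$.
   Context: For random variables $X,Y$ (possibly taking the value $+\infty$), $X\preceq_{st}Y$ (usual stochastic order) means $\mathbb{P}[X>t]\leqslant\mathbb{P}[Y>t]$ for all $t\in\mathbb{R}$. Convention: $\inf\emptyset=+\infty$. The SDE is in the Itô sense and has a unique strong solution with continuous paths; for $b=0$ its drift is $-d_0Q_t\,\mathrm{d}t$. *)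

theory Defs
  imports "HOL-Probability.Probability"
begin

text \<open>
  Continuous time is \<open>[0, \<infinity>)\<close>; processes and filtrations are indexed by \<^typ>\<open>real\<close> and their
  values at negative times play no role. Filtrations are not assumed complete or right-continuous,
  so a Brownian motion together with its own (raw or augmented) filtration is a special case.
\<close>

locale brownian_motion = prob_space M + filtration "space M" F
  for M :: "'a measure" and F :: "real \<Rightarrow> 'a measure" +
  fixes B :: "real \<Rightarrow> 'a \<Rightarrow> real"
  assumes subalgebra_F: "\<And>t. 0 \<le> t \<Longrightarrow> subalgebra M (F t)"
    and adapted: "\<And>t. 0 \<le> t \<Longrightarrow> B t \<in> borel_measurable (F t)"
    and start: "AE \<omega> in M. B 0 \<omega> = 0"
    and continuous_paths: "AE \<omega> in M. continuous_on {0..} (\<lambda>t. B t \<omega>)"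
    and normal_increments: "\<And>s t. 0 \<le> s \<Longrightarrow> s < t \<Longrightarrow>
      distributed M lborel (\<lambda>\<omega>. B t \<omega> - B s \<omega>) (normal_density 0 (sqrt (t - s)))"
    and indep_increments: "\<And>s t. 0 \<le> s \<Longrightarrow> s < t \<Longrightarrow>
      indep_set (sets (F s)) (sets (vimage_algebra (space M) (\<lambda>\<omega>. B t \<omega> - B s \<omega>) borel))"


subsection \<open>The Ito integral\<close>

text \<open>
  A simple process takes the value \<open>weight S i\<close> on the interval \<open>(grid S i, grid S (Suc i)]\<close> for
  \<open>i < pieces S\<close>, and \<open>0\<close> elsewhere.
\<close>

record 'a simple_process =
  pieces :: nat
  grid :: "nat \<Rightarrow> real"
  weight :: "nat \<Rightarrow> 'a \<Rightarrow> real"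

definition simple_adapted :: "(real \<Rightarrow> 'a measure) \<Rightarrow> 'a simple_process \<Rightarrow> bool" where
  "simple_adapted F S \<longleftrightarrow> 0 \<le> grid S 0 \<and>
     (\<forall>i<pieces S. grid S i < grid S (Suc i) \<and>
        weight S i \<in> borel_measurable (F (grid S i)) \<and>
        (\<exists>C. \<forall>\<omega>\<in>space (F (grid S i)). \<bar>weight S i \<omega>\<bar> \<le> C))"

definition simple_value :: "'a simple_process \<Rightarrow> real \<Rightarrow> 'a \<Rightarrow> real" where
  "simple_value S t \<omega> =
     (\<Sum>i<pieces S. weight S i \<omega> * indicator {grid S i<..grid S (Suc i)} t)"

definition simple_integral ::
    "'a simple_process \<Rightarrow> (real \<Rightarrow> 'a \<Rightarrow> real) \<Rightarrow> real \<Rightarrow> 'a \<Rightarrow> real" where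
  "simple_integral S B t \<omega> =
     (\<Sum>i<pieces S. weight S i \<omega> * (B (min t (grid S (Suc i))) \<omega> - B (min t (grid S i)) \<omega>))"

definition converges_in_prob :: "'a measure \<Rightarrow> (nat \<Rightarrow> 'a \<Rightarrow> real) \<Rightarrow> ('a \<Rightarrow> real) \<Rightarrow> bool" where
  "converges_in_prob M X Y \<longleftrightarrow>
     (\<forall>n. X n \<in> borel_measurable M) \<and> Y \<in> borel_measurable M \<and>
     (\<forall>\<epsilon>>0. (\<lambda>n. measure M {\<omega> \<in> space M. \<epsilon> < \<bar>X n \<omega> - Y \<omega>\<bar>}) \<longlonglongrightarrow> 0)"

definition progressively_measurable ::
    "(real \<Rightarrow> 'a measure) \<Rightarrow> (real \<Rightarrow> 'a \<Rightarrow> real) \<Rightarrow> bool" where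
  "progressively_measurable F H \<longleftrightarrow>
     (\<forall>T\<ge>0. (\<lambda>(t, \<omega>). H t \<omega>) \<in> borel_measurable (restrict_space borel {0..T} \<Otimes>\<^sub>M F T))"

text \<open>
  \<open>ito_integral M F B H I\<close> says that \<open>I\<close> is (a version, with almost surely continuous paths, of)
  the process \<open>t \<mapsto> \<integral>\<^sub>0\<^sup>t H dB\<close>, for a progressively measurable integrand \<open>H\<close> that is almost surely
  locally square integrable. As usual for such integrands, the integral is the limit in probability
  of the elementary integrals of simple processes \<open>S n\<close> with \<open>\<integral>\<^sub>0\<^sup>T (S n - H)\<^sup>2 dt \<rightarrow> 0\<close> in probability
  for all \<open>T\<close>; the limit does not depend on the approximating sequence. Convergence at each fixed
  time and continuity determine \<open>I\<close> up to indistinguishability. Adaptedness of \<open>I\<close> is required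
  only in the form that it holds automatically, i.e. up to null sets, as the filtration need not
  be complete.
\<close>

definition ito_integral ::
    "'a measure \<Rightarrow> (real \<Rightarrow> 'a measure) \<Rightarrow> (real \<Rightarrow> 'a \<Rightarrow> real) \<Rightarrow> (real \<Rightarrow> 'a \<Rightarrow> real)
      \<Rightarrow> (real \<Rightarrow> 'a \<Rightarrow> real) \<Rightarrow> bool" where
  "ito_integral M F B H I \<longleftrightarrow>
     progressively_measurable F H \<and>
     (\<forall>T\<ge>0. AE \<omega> in M. set_integrable lborel {0..T} (\<lambda>t. (H t \<omega>)\<^sup>2)) \<and>
     (AE \<omega> in M. continuous_on {0..} (\<lambda>t. I t \<omega>)) \<and>
     (\<exists>S. (\<forall>n. simple_adapted F (S n)) \<and>
        (\<forall>T\<ge>0. converges_in_prob M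
           (\<lambda>n \<omega>. LINT t:{0..T}|lborel. (simple_value (S n) t \<omega> - H t \<omega>)\<^sup>2) (\<lambda>\<omega>. 0)) \<and>
        (\<forall>t\<ge>0. converges_in_prob M (\<lambda>n. simple_integral (S n) B t) (I t)))"


subsection \<open>Stochastic differential equations\<close>

text \<open>\<open>X\<close> solves \<open>dX\<^sub>t = a(t, X\<^sub>t) dt + c(t, X\<^sub>t) dB\<^sub>t\<close>, \<open>X\<^sub>0 = x0\<close>, on \<open>[0, \<infinity>)\<close> in the Ito sense.\<close>

definition sde_solution ::
    "'a measure \<Rightarrow> (real \<Rightarrow> 'a measure) \<Rightarrow> (real \<Rightarrow> 'a \<Rightarrow> real)
      \<Rightarrow> (real \<Rightarrow> real \<Rightarrow> real) \<Rightarrow> (real \<Rightarrow> real \<Rightarrow> real) \<Rightarrow> real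
      \<Rightarrow> (real \<Rightarrow> 'a \<Rightarrow> real) \<Rightarrow> bool" where
  "sde_solution M F B a c x0 X \<longleftrightarrow>
     (\<forall>t\<ge>0. X t \<in> borel_measurable (F t)) \<and>
     (\<forall>\<omega>\<in>space M. continuous_on {0..} (\<lambda>t. X t \<omega>)) \<and>
     (\<forall>t\<ge>0. AE \<omega> in M. set_integrable lborel {0..t} (\<lambda>s. a s (X s \<omega>))) \<and>
     (\<exists>I. ito_integral M F B (\<lambda>t \<omega>. c t (X t \<omega>)) I \<and>
        (AE \<omega> in M. \<forall>t\<ge>0. X t \<omega> = x0 + (LINT s:{0..t}|lborel. a s (X s \<omega>)) + I t \<omega>))"


subsection \<open>Hitting times and the usual stochastic order\<close>

definition hitting_time :: "(real \<Rightarrow> 'a \<Rightarrow> real) \<Rightarrow> real \<Rightarrow> 'a \<Rightarrow> ereal" where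
  "hitting_time X x \<omega> = Inf (ereal ` {t. 0 \<le> t \<and> X t \<omega> = x})"

text \<open>
  The order relates random variables only; without the measurability conditions \<^const>\<open>measure\<close>
  would silently assign \<open>0\<close> to non-measurable events.
\<close>

definition stochastic_le :: "'a measure \<Rightarrow> ('a \<Rightarrow> ereal) \<Rightarrow> ('a \<Rightarrow> ereal) \<Rightarrow> bool" where
  "stochastic_le M X Y \<longleftrightarrow>
     X \<in> borel_measurable M \<and> Y \<in> borel_measurable M \<and>
     (\<forall>t::real. measure M {\<omega> \<in> space M. ereal t < X \<omega>} \<le> measure M {\<omega> \<in> space M. ereal t < Y \<omega>})"

end

theory Submission
  imports Defs
begin

text \<open>
  All solutions live on the same probability space, so it suffices to compare them pathwise. The Euler
  scheme of the linear equation with drift \<open>- \<gamma> Q\<close> and noise \<open>\<sigma> Q\<close> is a product of factors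
  \<open>1 - \<gamma> h + \<sigma> (B (t + h) - B t)\<close>. By uniform continuity of the Brownian path these
  factors are all positive once the mesh \<open>h\<close> is small, and they increase when \<open>\<gamma>\<close> decreases; hence the
  products are ordered, and so are the solutions, being limits of the Euler schemes. No Ito formula is needed.
  Since both paths start at \<open>q0 > x\<close>, the intermediate value theorem then orders the hitting times.

  The scheme converges in \<open>L\<^sup>2\<close> on the event that \<open>\<bar>Q\<bar> \<le> N\<close> on \<open>[0, T]\<close>, by a discrete Gronwall
  estimate for the recursion of the error. The Ito integral enters only through the elementary
  integrals of simple processes, with weights clipped to \<open>[-\<sigma> N, \<sigma> N]\<close>: clipping gives the
  moments needed for the isometry, and on the event above it does not change the limit.
\<close>

subsection \<open>Transforms of the Brownian motion\<close>

text \<open>No moment of \<open>Q\<close> is known in advance: the integrand is only almost surely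
  locally square integrable, and \<open>I\<close> is only a limit in probability of elementary
  integrals on grids unrelated to the Euler mesh. The second-moment estimate is therefore made for a
  substitute error \<open>e k\<close>, driven by the elementary integral of the clipped
  \<open>S k\<close> and frozen from the first grid point by which \<open>Q\<close> has left
  \<open>[-N, N]\<close>. The freezing factor is known at the start of each step, so the noise stays
  orthogonal to the past.

  The two limits have a fixed order. For a fixed mesh, \<open>k\<close> tends to infinity; this
  removes the error of approximating the integrand, which enters once per step and so carries a
  factor growing with the number of steps. Only afterwards is the mesh refined.

  That clipping is invisible in the limit cannot be seen from second moments: the energy of the part
  clipped off is small in probability only. Its integral is controlled by an inequality in
  probability (\<open>transform_tail\<close>).\<close>

lemma power2_add_le: "(a + b)\<^sup>2 \<le> 2 * a\<^sup>2 + 2 * b\<^sup>2" for a b :: real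
  using zero_le_power2[of "a - b"] by (simp add: power2_eq_square algebra_simps)

lemma integrable_mult_of_squares:
  fixes f g :: "'a \<Rightarrow> real"
  assumes [measurable]: "f \<in> borel_measurable M" "g \<in> borel_measurable M"
    and "integrable M (\<lambda>x. (f x)\<^sup>2)" "integrable M (\<lambda>x. (g x)\<^sup>2)"
  shows "integrable M (\<lambda>x. f x * g x)"
proof (rule Bochner_Integration.integrable_bound)
  show "integrable M (\<lambda>x. (f x)\<^sup>2 + (g x)\<^sup>2)" using assms by simp
  have "\<bar>a * b\<bar> \<le> \<bar>a\<^sup>2 + b\<^sup>2\<bar>" for a b :: real
  proof -
    have "0 \<le> (\<bar>a\<bar> - \<bar>b\<bar>)\<^sup>2" by simp
    then have "2 * \<bar>a * b\<bar> \<le> a\<^sup>2 + b\<^sup>2" by (simp add: power2_diff abs_mult)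
    then show ?thesis by linarith
  qed
  then show "AE x in M. norm (f x * g x) \<le> norm ((f x)\<^sup>2 + (g x)\<^sup>2)" by simp
qed simp

context brownian_motion
begin

section \<open>Square-integrable variables known at a given time\<close>

lemma measurable_F_mono:
  assumes "f \<in> borel_measurable (F s)" "s \<le> t"
  shows "f \<in> borel_measurable (F t)"
  using assms sets_F_mono[of s t] space_F by (auto simp: measurable_def)

lemma measurable_F_M:
  assumes "f \<in> borel_measurable (F t)" "0 \<le> t"
  shows "f \<in> borel_measurable M"
  using assms measurable_from_subalg subalgebra_F by blast

text \<open>The space L^2 of the sigma-algebra \<open>F t\<close>. The condition
  \<open>0 \<le> t\<close> is included because \<open>F t\<close> is a subalgebra of
  \<open>M\<close> for such \<open>t\<close>, so that membership also gives measurability in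
  \<open>M\<close>.\<close>

definition L2_at :: "real \<Rightarrow> ('a \<Rightarrow> real) \<Rightarrow> bool" where
  "L2_at t Z \<longleftrightarrow> 0 \<le> t \<and> Z \<in> borel_measurable (F t) \<and> integrable M (\<lambda>\<omega>. (Z \<omega>)\<^sup>2)"

lemma L2_atD:
  assumes "L2_at t Z"
  shows "0 \<le> t" "Z \<in> borel_measurable (F t)" "Z \<in> borel_measurable M" "integrable M (\<lambda>\<omega>. (Z \<omega>)\<^sup>2)"
  using assms measurable_F_M by (auto simp: L2_at_def)

lemma L2_at_mono: "L2_at s Z \<Longrightarrow> s \<le> t \<Longrightarrow> L2_at t Z"
  using measurable_F_mono by (auto simp: L2_at_def)

lemma L2_at_add:
  assumes "L2_at t Z" "L2_at t W"
  shows "L2_at t (\<lambda>\<omega>. Z \<omega> + W \<omega>)"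
proof -
  note [measurable] = L2_atD(3)[OF assms(1)] L2_atD(3)[OF assms(2)]
  have "integrable M (\<lambda>\<omega>. (Z \<omega>)\<^sup>2 + (W \<omega>)\<^sup>2 + 2 * (Z \<omega> * W \<omega>))"
    using assms by (intro Bochner_Integration.integrable_add integrable_mult_right
        integrable_mult_of_squares) (auto simp: L2_atD)
  then show ?thesis
    using assms by (auto simp: L2_at_def power2_sum mult.assoc)
qed

lemma L2_at_cmult: "L2_at t Z \<Longrightarrow> L2_at t (\<lambda>\<omega>. c * Z \<omega>)"
  by (auto simp: L2_at_def power_mult_distrib)

lemma L2_at_minus: "L2_at t Z \<Longrightarrow> L2_at t (\<lambda>\<omega>. - Z \<omega>)"
  by (auto simp: L2_at_def)

lemma L2_at_diff:
  assumes "L2_at t Z" "L2_at t W"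
  shows "L2_at t (\<lambda>\<omega>. Z \<omega> - W \<omega>)"
  using L2_at_add[OF assms(1) L2_at_minus[OF assms(2)]] by simp

lemma L2_at_bounded:
  assumes "0 \<le> t" "Z \<in> borel_measurable (F t)" "\<And>\<omega>. \<omega> \<in> space M \<Longrightarrow> \<bar>Z \<omega>\<bar> \<le> C"
  shows "L2_at t Z"
  unfolding L2_at_def
proof (intro conjI)
  have [measurable]: "Z \<in> borel_measurable M" using assms measurable_F_M by blast
  have "(Z \<omega>)\<^sup>2 \<le> C\<^sup>2" if "\<omega> \<in> space M" for \<omega>
    using assms(3)[OF that] by (metis abs_ge_zero power2_abs power_mono)
  then show "integrable M (\<lambda>\<omega>. (Z \<omega>)\<^sup>2)"
    by (intro integrable_const_bound[where B="C\<^sup>2"]) (auto intro!: AE_I2)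
qed (use assms in auto)

text \<open>Serves to multiply by 0-1 factors known at time \<open>t\<close>: the switch in
  \<open>transform_tail\<close> and the freezing factor of the Euler error.\<close>

lemma L2_at_mult_bounded:
  assumes "L2_at t Z" "W \<in> borel_measurable (F t)" "\<And>\<omega>. \<omega> \<in> space M \<Longrightarrow> \<bar>W \<omega>\<bar> \<le> C"
  shows "L2_at t (\<lambda>\<omega>. W \<omega> * Z \<omega>)"
  unfolding L2_at_def
proof (intro conjI)
  have [measurable]: "W \<in> borel_measurable M" "Z \<in> borel_measurable M"
    using measurable_F_M[OF assms(2)] L2_atD[OF assms(1)] by auto
  show "integrable M (\<lambda>\<omega>. (W \<omega> * Z \<omega>)\<^sup>2)"
  proof (rule Bochner_Integration.integrable_bound)
    show "integrable M (\<lambda>\<omega>. C\<^sup>2 * (Z \<omega>)\<^sup>2)" using L2_atD[OF assms(1)] by simp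
    show "AE \<omega> in M. norm ((W \<omega> * Z \<omega>)\<^sup>2) \<le> norm (C\<^sup>2 * (Z \<omega>)\<^sup>2)"
    proof (rule AE_I2)
      fix \<omega> assume "\<omega> \<in> space M"
      then have "(W \<omega>)\<^sup>2 \<le> C\<^sup>2" using assms(3) by (metis abs_ge_zero power2_abs power_mono)
      then show "norm ((W \<omega> * Z \<omega>)\<^sup>2) \<le> norm (C\<^sup>2 * (Z \<omega>)\<^sup>2)"
        by (simp add: power_mult_distrib mult_right_mono)
    qed
  qed simp
  show "(\<lambda>\<omega>. W \<omega> * Z \<omega>) \<in> borel_measurable (F t)"
    using assms(2) L2_atD(2)[OF assms(1)] by simp
qed (use assms L2_atD in auto)

section \<open>Moments and independence of Brownian increments\<close>

lemma increment_measurable: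
  assumes "0 \<le> s" "s \<le> t"
  shows "(\<lambda>\<omega>. B t \<omega> - B s \<omega>) \<in> borel_measurable (F t)"
proof -
  have "B t \<in> borel_measurable (F t)" using adapted assms by auto
  moreover have "B s \<in> borel_measurable (F t)" using adapted[of s] measurable_F_mono assms by auto
  ultimately show ?thesis by simp
qed

lemma increment_moments:
  assumes "0 \<le> s" "s < t"
  shows "integrable M (\<lambda>\<omega>. B t \<omega> - B s \<omega>)" "expectation (\<lambda>\<omega>. B t \<omega> - B s \<omega>) = 0"
    "integrable M (\<lambda>\<omega>. (B t \<omega> - B s \<omega>)\<^sup>2)" "expectation (\<lambda>\<omega>. (B t \<omega> - B s \<omega>)\<^sup>2) = t - s"
proof -
  let ?X = "\<lambda>\<omega>. B t \<omega> - B s \<omega>" and ?r = "sqrt (t - s)"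
  have r: "0 < ?r" using assms by simp
  note D = normal_increments[OF assms]
  have i1: "has_bochner_integral lborel (\<lambda>x. normal_density 0 ?r x * x) 0"
    using normal_moment_odd[OF r, of 0 0] by simp
  have i2: "has_bochner_integral lborel (\<lambda>x. normal_density 0 ?r x * x\<^sup>2) (t - s)"
    using normal_moment_even[OF r, of 0 1] assms
    by (simp add: power2_eq_square fact_2 diff_divide_distrib)
  show "integrable M ?X"
    using distributed_integrable[OF D, of "\<lambda>x. x"] i1
    by (auto simp: has_bochner_integral_iff normal_density_nonneg)
  show "expectation ?X = 0"
    using distributed_integral[OF D, of "\<lambda>x. x"] i1
    by (auto simp: has_bochner_integral_iff normal_density_nonneg)
  show "integrable M (\<lambda>\<omega>. (?X \<omega>)\<^sup>2)"
    using distributed_integrable[OF D, of "\<lambda>x. x\<^sup>2"] i2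
    by (auto simp: has_bochner_integral_iff normal_density_nonneg)
  show "expectation (\<lambda>\<omega>. (?X \<omega>)\<^sup>2) = t - s"
    using distributed_integral[OF D, of "\<lambda>x. x\<^sup>2"] i2
    by (auto simp: has_bochner_integral_iff normal_density_nonneg)
qed

text \<open>Independence of the increment is postulated for the whole sigma-algebra
  \<open>F s\<close>. The sigma-algebra generated by \<open>Z\<close> is contained in it, and
  independence passes to smaller families.\<close>

lemma indep_past_increment:
  assumes "0 \<le> s" "s < t" "Z \<in> borel_measurable (F s)"
  shows "indep_var borel Z borel (\<lambda>\<omega>. B t \<omega> - B s \<omega>)"
proof -
  let ?X = "\<lambda>\<omega>. B t \<omega> - B s \<omega>"
  have Z: "Z \<in> borel_measurable M" using assms measurable_F_M by blast
  have X: "?X \<in> borel_measurable M"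
    using increment_measurable[of s t] assms measurable_F_M[of _ t] by auto
  have sp: "space (F s) = space M" by (rule space_F)
  have 1: "sigma_sets (space M) {Z -` A \<inter> space M |A. A \<in> sets borel} \<subseteq> sets (F s)"
    using assms(3) sp by (intro sets.sigma_sets_subset[of _ "F s", unfolded sp]) (auto simp: measurable_def)
  have 2: "sigma_sets (space M) {?X -` A \<inter> space M |A. A \<in> sets borel}
      = sets (vimage_algebra (space M) ?X borel)"
    by (simp add: sets_vimage_algebra)
  from indep_increments[OF assms(1,2)] have "indep_set
      (sigma_sets (space M) {Z -` A \<inter> space M |A. A \<in> sets borel})
      (sigma_sets (space M) {?X -` A \<inter> space M |A. A \<in> sets borel})"
    unfolding 2 indep_sets2_eq using 1 by blast
  then show ?thesis using X Z by (simp add: indep_var_eq)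
qed

text \<open>A product of two square-integrable variables is in general only integrable. Here the two
  squares are independent, so their product is integrable and its expectation factorizes. The case
  \<open>s = t\<close> is included because refined grids may repeat points, while normality is
  postulated for \<open>s < t\<close>.\<close>

lemma L2_at_mult_increment:
  assumes "L2_at s Z" "s \<le> t"
  shows "L2_at t (\<lambda>\<omega>. Z \<omega> * (B t \<omega> - B s \<omega>))"
    and "expectation (\<lambda>\<omega>. (Z \<omega> * (B t \<omega> - B s \<omega>))\<^sup>2) = expectation (\<lambda>\<omega>. (Z \<omega>)\<^sup>2) * (t - s)"
proof -
  note Z = L2_atD[OF assms(1)]
  have ms: "(\<lambda>\<omega>. Z \<omega> * (B t \<omega> - B s \<omega>)) \<in> borel_measurable (F t)"
    using increment_measurable[OF Z(1) assms(2)] measurable_F_mono[OF Z(2) assms(2)] by simp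
  have "L2_at t (\<lambda>\<omega>. Z \<omega> * (B t \<omega> - B s \<omega>)) \<and>
    expectation (\<lambda>\<omega>. (Z \<omega> * (B t \<omega> - B s \<omega>))\<^sup>2) = expectation (\<lambda>\<omega>. (Z \<omega>)\<^sup>2) * (t - s)"
  proof (cases "s = t")
    case True
    then show ?thesis using Z ms by (auto simp: L2_at_def)
  next
    case False
    then have st: "s < t" using assms by simp
    have "indep_var borel (\<lambda>\<omega>. (Z \<omega>)\<^sup>2) borel (\<lambda>\<omega>. (B t \<omega> - B s \<omega>)\<^sup>2)"
      using indep_var_compose[OF indep_past_increment[OF Z(1) st Z(2)],
          of "\<lambda>x. x\<^sup>2" borel "\<lambda>x. x\<^sup>2" borel] by (simp add: comp_def)
    from indep_var_lebesgue_integral[OF this Z(4) increment_moments(3)[OF Z(1) st]]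
      indep_var_integrable[OF this Z(4) increment_moments(3)[OF Z(1) st]]
      increment_moments(4)[OF Z(1) st]
    show ?thesis using ms Z st by (auto simp: L2_at_def power_mult_distrib)
  qed
  then show "L2_at t (\<lambda>\<omega>. Z \<omega> * (B t \<omega> - B s \<omega>))"
    and "expectation (\<lambda>\<omega>. (Z \<omega> * (B t \<omega> - B s \<omega>))\<^sup>2) = expectation (\<lambda>\<omega>. (Z \<omega>)\<^sup>2) * (t - s)"
    by auto
qed

text \<open>The centered increment is independent of \<open>Z * W\<close>. In the uses
  \<open>Z\<close> is what has accumulated so far and \<open>W\<close> the next weight; their
  product is merely integrable, so it could not be passed as one \<open>L2_at\<close>
  variable.\<close>

lemma expectation_mult_increment:
  assumes "L2_at s Z" "L2_at s W" "s \<le> t"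
  shows "expectation (\<lambda>\<omega>. Z \<omega> * (W \<omega> * (B t \<omega> - B s \<omega>))) = 0"
proof (cases "s = t")
  case False
  then have st: "s < t" using assms by simp
  note Z = L2_atD[OF assms(1)] and W = L2_atD[OF assms(2)]
  have I: "integrable M (\<lambda>\<omega>. Z \<omega> * W \<omega>)" by (intro integrable_mult_of_squares Z W)
  have "indep_var borel (\<lambda>\<omega>. Z \<omega> * W \<omega>) borel (\<lambda>\<omega>. B t \<omega> - B s \<omega>)"
    using Z(2) W(2) by (intro indep_past_increment Z(1) st) simp
  from indep_var_lebesgue_integral[OF this I increment_moments(1)[OF Z(1) st]]
  show ?thesis by (simp add: increment_moments(2)[OF Z(1) st] mult.assoc)
qed simp

text \<open>The martingale transform of \<open>B\<close> sampled at the times \<open>s\<close>: a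
  discrete stochastic integral in which \<open>W j\<close> is meant to be known at
  \<open>s j\<close>.\<close>

definition transform :: "(nat \<Rightarrow> real) \<Rightarrow> (nat \<Rightarrow> 'a \<Rightarrow> real) \<Rightarrow> nat \<Rightarrow> 'a \<Rightarrow> real" where
  "transform s W k \<omega> = (\<Sum>j<k. W j \<omega> * (B (s (Suc j)) \<omega> - B (s j) \<omega>))"

text \<open>Ito isometry by induction on the number of steps: the new summand is orthogonal to the
  accumulated transform, so the squares add up. The energy is kept under the expectation, ready to
  be rewritten as a pathwise time integral. The third claim later removes the cross term between the
  Euler error and the noise of the next step.\<close>

lemma transform_isometry:
  assumes "\<And>j. j < k \<Longrightarrow> s j \<le> s (Suc j)" "\<And>j. j < k \<Longrightarrow> L2_at (s j) (W j)" "0 \<le> s 0"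
  shows "L2_at (s k) (transform s W k)"
    and "expectation (\<lambda>\<omega>. (transform s W k \<omega>)\<^sup>2)
      = expectation (\<lambda>\<omega>. \<Sum>j<k. (W j \<omega>)\<^sup>2 * (s (Suc j) - s j))"
    and "L2_at (s 0) Z \<Longrightarrow> expectation (\<lambda>\<omega>. Z \<omega> * transform s W k \<omega>) = 0"
proof -
  have "L2_at (s k) (transform s W k) \<and> s 0 \<le> s k \<and>
    expectation (\<lambda>\<omega>. (transform s W k \<omega>)\<^sup>2)
      = expectation (\<lambda>\<omega>. \<Sum>j<k. (W j \<omega>)\<^sup>2 * (s (Suc j) - s j)) \<and>
    (L2_at (s 0) Z \<longrightarrow> expectation (\<lambda>\<omega>. Z \<omega> * transform s W k \<omega>) = 0)"
    using assms(1,2)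
  proof (induction k)
    case 0
    show ?case using assms(3) by (auto simp: transform_def[abs_def] L2_at_def)
  next
    case (Suc k)
    let ?T = "transform s W k" and ?D = "\<lambda>\<omega>. W k \<omega> * (B (s (Suc k)) \<omega> - B (s k) \<omega>)"
    from Suc have IH: "L2_at (s k) ?T" "s 0 \<le> s k"
      "expectation (\<lambda>\<omega>. (?T \<omega>)\<^sup>2) = expectation (\<lambda>\<omega>. \<Sum>j<k. (W j \<omega>)\<^sup>2 * (s (Suc j) - s j))"
      "L2_at (s 0) Z \<Longrightarrow> expectation (\<lambda>\<omega>. Z \<omega> * ?T \<omega>) = 0" by auto
    have le: "s k \<le> s (Suc k)" and W: "L2_at (s k) (W k)" using Suc by auto
    note D = L2_at_mult_increment[OF W le]
    note T' = L2_at_mono[OF IH(1) le]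
    have eq: "transform s W (Suc k) = (\<lambda>\<omega>. ?T \<omega> + ?D \<omega>)"
      by (simp add: transform_def fun_eq_iff)
    have TD: "integrable M (\<lambda>\<omega>. ?T \<omega> * ?D \<omega>)"
      by (intro integrable_mult_of_squares L2_atD[OF T'] L2_atD[OF D(1)])
    have "expectation (\<lambda>\<omega>. (?T \<omega> + ?D \<omega>)\<^sup>2)
      = expectation (\<lambda>\<omega>. (?T \<omega>)\<^sup>2 + (?D \<omega>)\<^sup>2 + 2 * (?T \<omega> * ?D \<omega>))"
      by (simp only: power2_sum mult.assoc)
    also have "\<dots> = expectation (\<lambda>\<omega>. (?T \<omega>)\<^sup>2) + expectation (\<lambda>\<omega>. (?D \<omega>)\<^sup>2)"
      using TD L2_atD[OF T'] L2_atD[OF D(1)] expectation_mult_increment[OF IH(1) W le] by simp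
    also have "\<dots> = expectation (\<lambda>\<omega>. \<Sum>j<Suc k. (W j \<omega>)\<^sup>2 * (s (Suc j) - s j))"
    proof -
      have "integrable M (\<lambda>\<omega>. \<Sum>j<k. (W j \<omega>)\<^sup>2 * (s (Suc j) - s j))"
        using Suc.prems(2) by (intro Bochner_Integration.integrable_sum integrable_mult_left)
          (simp add: L2_atD(4)[OF Suc.prems(2)])
      then show ?thesis using L2_atD[OF W] by (simp add: IH D)
    qed
    finally have 1: "expectation (\<lambda>\<omega>. (?T \<omega> + ?D \<omega>)\<^sup>2) = \<dots>" .
    have 2: "expectation (\<lambda>\<omega>. Z \<omega> * (?T \<omega> + ?D \<omega>)) = 0" if Z: "L2_at (s 0) Z"
    proof -
      have Zk: "L2_at (s k) Z" using L2_at_mono[OF Z IH(2)] .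
      have "integrable M (\<lambda>\<omega>. Z \<omega> * ?T \<omega>)" "integrable M (\<lambda>\<omega>. Z \<omega> * ?D \<omega>)"
        by (intro integrable_mult_of_squares L2_atD[OF Zk] L2_atD[OF IH(1)] L2_atD[OF D(1)])+
      then show ?thesis
        using IH(4)[OF Z] expectation_mult_increment[OF Zk W le] by (simp add: distrib_left)
    qed
    show ?case unfolding eq using L2_at_add[OF T' D(1)] 1 2 IH(2) le by auto
  qed
  then show "L2_at (s k) (transform s W k)"
    and "expectation (\<lambda>\<omega>. (transform s W k \<omega>)\<^sup>2)
      = expectation (\<lambda>\<omega>. \<Sum>j<k. (W j \<omega>)\<^sup>2 * (s (Suc j) - s j))"
    and "L2_at (s 0) Z \<Longrightarrow> expectation (\<lambda>\<omega>. Z \<omega> * transform s W k \<omega>) = 0"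
    by auto
qed

end

subsection \<open>Simple processes\<close>

text \<open>Since \<open>f\<close> is prescribed on half-open pieces, its value at
  \<open>s 0\<close> is arbitrary. This is a single null point for the integral; for measurability
  it is split off as a separate summand.\<close>

lemma step_function_integral:
  fixes s c :: "nat \<Rightarrow> real" and f :: "real \<Rightarrow> real"
  assumes "\<And>j. j < k \<Longrightarrow> s j \<le> s (Suc j)"
    and "\<And>j t. j < k \<Longrightarrow> s j < t \<Longrightarrow> t \<le> s (Suc j) \<Longrightarrow> f t = c j"
  shows "set_integrable lborel {s 0..s k} f"
    and "(LINT t:{s 0..s k}|lborel. f t) = (\<Sum>j<k. c j * (s (Suc j) - s j))"
proof -
  let ?g = "\<lambda>t. \<Sum>j<k. c j * indicator {s j<..s (Suc j)} t"
  have eq: "s 0 \<le> s k \<and> (\<forall>t. indicator {s 0<..s k} t * f t = ?g t)"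
    using assms
  proof (induction k)
    case (Suc k)
    then have IH: "s 0 \<le> s k" and
      "\<And>t. indicator {s 0<..s k} t * f t = (\<Sum>j<k. c j * indicator {s j<..s (Suc j)} t)" by auto
    from this(2)[symmetric] show ?case
      using IH Suc.prems(1)[of k] Suc.prems(2)[of k] by (auto simp: indicator_def)
  qed simp
  have AE_eq: "AE t in lborel. indicator {s 0..s k} t *\<^sub>R f t = ?g t"
    using AE_lborel_singleton[of "s 0"]
  proof eventually_elim
    case (elim t)
    then show ?case using eq[THEN conjunct2, rule_format, of t, symmetric]
      by (auto simp: indicator_def)
  qed
  have H: "has_bochner_integral lborel ?g (\<Sum>j<k. c j * (s (Suc j) - s j))"
    using assms(1)
    by (intro has_bochner_integral_sum has_bochner_integral_mult_right)
       (auto simp: has_bochner_integral_iff)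
  have meas: "(\<lambda>t. indicator {s 0..s k} t *\<^sub>R f t) \<in> borel_measurable lborel"
  proof -
    have "indicator {s 0..s k} t *\<^sub>R f t = ?g t + indicator {s 0} t * f (s 0)" for t
      using eq[THEN conjunct1] eq[THEN conjunct2, rule_format, of t, symmetric]
      by (auto simp: indicator_def)
    moreover have "(\<lambda>t. ?g t + indicator {s 0} t * f (s 0)) \<in> borel_measurable lborel"
      by (intro borel_measurable_add borel_measurable_sum) auto
    ultimately show ?thesis by presburger
  qed
  have "has_bochner_integral lborel (\<lambda>t. indicator {s 0..s k} t *\<^sub>R f t)
      (\<Sum>j<k. c j * (s (Suc j) - s j))"
    using H has_bochner_integral_cong_AE[OF meas _ AE_eq] by auto
  then show "set_integrable lborel {s 0..s k} f"
    and "(LINT t:{s 0..s k}|lborel. f t) = (\<Sum>j<k. c j * (s (Suc j) - s j))"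
    by (auto simp: has_bochner_integral_iff set_integrable_def set_lebesgue_integral_def)
qed

text \<open>Partial sums increase, so the terms that are counted form an initial segment with total
  at most \<open>\<delta>\<close>. The test includes the current term, which rules out an
  overshoot.\<close>

lemma sum_stopped_le:
  fixes a :: "nat \<Rightarrow> real"
  assumes "\<And>j. 0 \<le> a j" "0 \<le> \<delta>"
  shows "(\<Sum>j<k. if (\<Sum>i\<le>j. a i) \<le> \<delta> then a j else 0) \<le> \<delta>"
proof (induction k)
  case (Suc k)
  show ?case
  proof (cases "(\<Sum>i\<le>k. a i) \<le> \<delta>")
    case True
    have "(\<Sum>j<Suc k. if (\<Sum>i\<le>j. a i) \<le> \<delta> then a j else 0) \<le> (\<Sum>j<Suc k. a j)"
      using assms(1) by (intro sum_mono) auto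
    then show ?thesis using True by (simp only: lessThan_Suc_atMost)
  next
    case False
    then show ?thesis using Suc by simp
  qed
qed (use assms in simp)

lemma simple_adapted_grid:
  assumes "simple_adapted F S"
  shows "i \<le> j \<Longrightarrow> j \<le> pieces S \<Longrightarrow> grid S i \<le> grid S j"
    and "j \<le> pieces S \<Longrightarrow> 0 \<le> grid S j"
proof -
  have "i \<le> j \<Longrightarrow> j \<le> pieces S \<Longrightarrow> grid S i \<le> grid S j" for i j
  proof (induction j rule: nat_induct)
    case (Suc j)
    then have "j < pieces S" by simp
    then have "grid S j < grid S (Suc j)" using assms by (auto simp: simple_adapted_def)
    then show ?case using Suc by (cases "i = Suc j") auto
  qed simp
  from this[of i j] this[of 0 j] assms
  show "i \<le> j \<Longrightarrow> j \<le> pieces S \<Longrightarrow> grid S i \<le> grid S j"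
    and "j \<le> pieces S \<Longrightarrow> 0 \<le> grid S j"
    by (auto simp: simple_adapted_def)
qed

lemma simple_value_piece:
  assumes "simple_adapted F S" "i < pieces S" "grid S i < t" "t \<le> grid S (Suc i)"
  shows "simple_value S t \<omega> = weight S i \<omega>"
proof -
  have "t \<notin> {grid S j<..grid S (Suc j)}" if "j < pieces S" "j \<noteq> i" for j
  proof (cases "j < i")
    case True
    then have "grid S (Suc j) \<le> grid S i" using simple_adapted_grid(1)[OF assms(1)] assms(2) by simp
    then show ?thesis using assms by auto
  next
    case False
    then have "grid S (Suc i) \<le> grid S j" using simple_adapted_grid(1)[OF assms(1)] that by simp
    then show ?thesis using assms by auto
  qed
  then have "simple_value S t \<omega> = (\<Sum>j<pieces S. if j = i then weight S i \<omega> else 0)"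
    unfolding simple_value_def using assms by (intro sum.cong) (auto simp: indicator_def)
  then show ?thesis using assms by simp
qed

lemma simple_value_outside:
  assumes "simple_adapted F S" "t \<le> grid S 0 \<or> grid S (pieces S) < t"
  shows "simple_value S t \<omega> = 0"
  unfolding simple_value_def
proof (intro sum.neutral ballI)
  fix j assume "j \<in> {..<pieces S}"
  then have "grid S 0 \<le> grid S j" "grid S (Suc j) \<le> grid S (pieces S)"
    using simple_adapted_grid(1)[OF assms(1)] by auto
  then show "weight S j \<omega> * indicator {grid S j<..grid S (Suc j)} t = 0"
    using assms(2) by (auto simp: indicator_def)
qed

lemma simple_value_cases:
  assumes "simple_adapted F S"
  obtains "\<And>\<omega>. simple_value S t \<omega> = 0" "\<And>i. i < pieces S \<Longrightarrow> t \<notin> {grid S i<..grid S (Suc i)}"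
  | i where "i < pieces S" "grid S i < t" "t \<le> grid S (Suc i)"
  by (cases "\<exists>i<pieces S. grid S i < t \<and> t \<le> grid S (Suc i)")
     (auto simp: simple_value_def intro!: sum.neutral)

text \<open>Applied to \<open>clip c\<close> and to the remainder
  \<open>\<lambda>x. x - clip c x\<close>, it splits an elementary integral into a part with
  uniformly bounded weights and a part of small energy.\<close>

definition map_weight :: "(real \<Rightarrow> real) \<Rightarrow> 'a simple_process \<Rightarrow> 'a simple_process" where
  "map_weight f S = S\<lparr>weight := \<lambda>i \<omega>. f (weight S i \<omega>)\<rparr>"

lemma map_weight_simps [simp]:
  "pieces (map_weight f S) = pieces S"
  "grid (map_weight f S) = grid S"
  "weight (map_weight f S) i \<omega> = f (weight S i \<omega>)"
  by (simp_all add: map_weight_def)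

lemma simple_adapted_map_weight:
  assumes "simple_adapted F S" "f \<in> borel_measurable borel" "\<And>x. \<bar>f x\<bar> \<le> \<bar>x\<bar>"
  shows "simple_adapted F (map_weight f S)"
proof -
  have "(\<lambda>\<omega>. f (weight S i \<omega>)) \<in> borel_measurable (F (grid S i)) \<and>
      (\<exists>C. \<forall>\<omega>\<in>space (F (grid S i)). \<bar>f (weight S i \<omega>)\<bar> \<le> C)" if "i < pieces S" for i
  proof
    show "(\<lambda>\<omega>. f (weight S i \<omega>)) \<in> borel_measurable (F (grid S i))"
      using assms(1,2) that by (auto simp: simple_adapted_def)
    obtain C where "\<forall>\<omega>\<in>space (F (grid S i)). \<bar>weight S i \<omega>\<bar> \<le> C"
      using assms(1) \<open>i < pieces S\<close> by (auto simp: simple_adapted_def)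
    then show "\<exists>C. \<forall>\<omega>\<in>space (F (grid S i)). \<bar>f (weight S i \<omega>)\<bar> \<le> C"
      using assms(3) order_trans by blast
  qed
  then show ?thesis using assms(1) by (auto simp: simple_adapted_def map_weight_def)
qed

text \<open>The pieces are disjoint, so at most one summand is present and \<open>f\<close> acts on
  it alone; \<open>f 0 = 0\<close> settles the times outside all pieces.\<close>

lemma simple_value_map_weight:
  assumes "simple_adapted F S" "f 0 = 0"
  shows "simple_value (map_weight f S) t \<omega> = f (simple_value S t \<omega>)"
proof (cases rule: simple_value_cases[OF assms(1), of t])
  case 1
  have "simple_value (map_weight f S) t \<omega> = 0"
    unfolding simple_value_def map_weight_def using 1(2) by (auto intro!: sum.neutral)
  then show ?thesis using 1(1) assms(2) by simp
next
  case (2 i)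
  have "simple_value (map_weight f S) t \<omega>
    = (\<Sum>j<pieces S. if j = i then f (weight S i \<omega>) else 0)"
    unfolding simple_value_def map_weight_simps
  proof (intro sum.cong refl)
    fix j assume "j \<in> {..<pieces S}"
    then have "t \<in> {grid S j<..grid S (Suc j)} \<longleftrightarrow> j = i"
      using 2 simple_adapted_grid(1)[OF assms(1), of "Suc i" j]
        simple_adapted_grid(1)[OF assms(1), of "Suc j" i]
      by (cases i j rule: linorder_cases) auto
    then show "f (weight S j \<omega>) * indicator {grid S j<..grid S (Suc j)} t
      = (if j = i then f (weight S i \<omega>) else 0)" by (auto simp: indicator_def)
  qed
  then show ?thesis using simple_value_piece[OF assms(1) 2] 2(1) by simp
qed

text \<open>
  The grid of \<open>S\<close> restricted to \<open>[u, v]\<close>, with \<open>u\<close> and \<open>v\<close> added as end points, so that the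
  integral of \<open>S - \<kappa>\<close> over \<open>[u, v]\<close> becomes a transform.
\<close>

definition refined_grid :: "'a simple_process \<Rightarrow> real \<Rightarrow> real \<Rightarrow> nat \<Rightarrow> real" where
  "refined_grid S u v j =
     (if j = 0 then u else if j \<le> Suc (pieces S) then max u (min v (grid S (j - 1))) else v)"

text \<open>Index \<open>j\<close> belongs to piece \<open>j - 1\<close> of \<open>S\<close>; the
  indices \<open>0\<close> and \<open>Suc (pieces S)\<close> are the stretches before and after the
  grid of \<open>S\<close>, where the simple process vanishes. The test against \<open>v\<close>
  discards pieces that start at \<open>v\<close> or later: they are degenerate in the refined grid,
  but their weights need not be known at time \<open>v\<close>.\<close>

definition refined_weight :: "'a simple_process \<Rightarrow> real \<Rightarrow> ('a \<Rightarrow> real) \<Rightarrow> nat \<Rightarrow> 'a \<Rightarrow> real" where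
  "refined_weight S v \<kappa> j \<omega> =
     (if 0 < j \<and> j \<le> pieces S \<and> grid S (j - 1) < v then weight S (j - 1) \<omega> else 0) - \<kappa> \<omega>"

lemma refined_grid_mono:
  assumes "simple_adapted F S" "u \<le> v"
  shows "refined_grid S u v j \<le> refined_grid S u v (Suc j)"
proof (cases j)
  case (Suc i)
  then show ?thesis
    using assms simple_adapted_grid(1)[OF assms(1), of i j]
    by (auto simp: refined_grid_def min_def max_def)
qed (use assms in \<open>auto simp: refined_grid_def\<close>)

lemma refined_grid_ends:
  assumes "u \<le> v"
  shows "refined_grid S u v 0 = u" "refined_grid S u v (Suc (Suc (pieces S))) = v"
  by (auto simp: refined_grid_def)

lemma refined_weight_value:
  assumes "simple_adapted F S" "u \<le> v" "j < Suc (Suc (pieces S))"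
    "refined_grid S u v j < t" "t \<le> refined_grid S u v (Suc j)"
  shows "simple_value S t \<omega> - \<kappa> \<omega> = refined_weight S v \<kappa> j \<omega>"
proof (cases j)
  case 0
  then have "t \<le> grid S 0" using assms by (auto simp: refined_grid_def min_def max_def split: if_splits)
  then show ?thesis using simple_value_outside[OF assms(1)] 0 by (simp add: refined_weight_def)
next
  case (Suc i)
  show ?thesis
  proof (cases "i = pieces S")
    case True
    then have "grid S (pieces S) < t"
      using assms(4,5) Suc by (auto simp: refined_grid_def min_def max_def split: if_splits)
    then show ?thesis using simple_value_outside[OF assms(1)] True Suc by (simp add: refined_weight_def)
  next
    case False
    then have i: "i < pieces S" using assms(3) Suc by simp
    then have "grid S i < t" "t \<le> grid S (Suc i)" "grid S i < v"
      using assms(4,5) Suc by (auto simp: refined_grid_def min_def max_def split: if_splits)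
    then show ?thesis using simple_value_piece[OF assms(1) i] Suc i by (simp add: refined_weight_def)
  qed
qed

lemma refined_energy:
  assumes "simple_adapted F S" "u \<le> v"
  shows "set_integrable lborel {u..v} (\<lambda>t. (simple_value S t \<omega> - \<kappa> \<omega>)\<^sup>2)"
    and "(\<Sum>j<Suc (Suc (pieces S)). (refined_weight S v \<kappa> j \<omega>)\<^sup>2
        * (refined_grid S u v (Suc j) - refined_grid S u v j))
      = (LINT t:{u..v}|lborel. (simple_value S t \<omega> - \<kappa> \<omega>)\<^sup>2)"
  using step_function_integral[of "Suc (Suc (pieces S))" "refined_grid S u v"
      "\<lambda>t. (simple_value S t \<omega> - \<kappa> \<omega>)\<^sup>2" "\<lambda>j. (refined_weight S v \<kappa> j \<omega>)\<^sup>2"]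
    refined_grid_mono[OF assms] refined_weight_value[OF assms] refined_grid_ends[OF assms(2), of S]
  by (auto simp del: sum.lessThan_Suc)

context brownian_motion
begin

lemma refined_weight_L2:
  assumes "simple_adapted F S" "0 \<le> u" "u \<le> v" "L2_at u \<kappa>" "j < Suc (Suc (pieces S))"
  shows "L2_at (refined_grid S u v j) (refined_weight S v \<kappa> j)"
proof -
  let ?s = "refined_grid S u v j"
  have u: "u \<le> ?s"
    using assms by (auto simp: refined_grid_def)
  have "L2_at ?s (\<lambda>\<omega>. if 0 < j \<and> j \<le> pieces S \<and> grid S (j - 1) < v then weight S (j - 1) \<omega> else 0)"
  proof (cases "0 < j \<and> j \<le> pieces S \<and> grid S (j - 1) < v")
    case True
    then obtain i where i: "j = Suc i" "i < pieces S" "grid S i < v" by (cases j) auto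
    then have w: "weight S i \<in> borel_measurable (F (grid S i))"
      "\<exists>C. \<forall>\<omega>\<in>space M. \<bar>weight S i \<omega>\<bar> \<le> C"
      using assms(1) space_F by (auto simp: simple_adapted_def)
    \<comment> \<open>Because \<open>grid S i < v\<close>, cutting at \<open>v\<close> does not move
      this grid point back, so its weight is known at the refined time.\<close>
    have "grid S i \<le> ?s" using i by (auto simp: refined_grid_def)
    then have "weight S i \<in> borel_measurable (F ?s)" using w measurable_F_mono by blast
    then show ?thesis using w(2) u assms True i by (auto intro!: L2_at_bounded)
  next
    case False
    then show ?thesis using u assms by (auto intro!: L2_at_bounded[where C=0] simp: if_not_P)
  qed
  from L2_at_diff[OF this L2_at_mono[OF assms(4) u]] show ?thesis
    by (simp add: refined_weight_def[abs_def])
qed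

text \<open>The shifts by \<open>\<kappa>\<close> telescope to
  \<open>\<kappa> * (B v - B u)\<close>. Each piece of \<open>S\<close> contributes its portion
  inside \<open>[u, v]\<close>, which is the difference of its contributions up to \<open>v\<close>
  and up to \<open>u\<close>.\<close>

lemma refined_transform:
  assumes "simple_adapted F S" "0 \<le> u" "u \<le> v"
  shows "transform (refined_grid S u v) (refined_weight S v \<kappa>) (Suc (Suc (pieces S))) \<omega>
    = simple_integral S B v \<omega> - simple_integral S B u \<omega> - \<kappa> \<omega> * (B v \<omega> - B u \<omega>)"
proof -
  let ?s = "refined_grid S u v" and ?n = "Suc (Suc (pieces S))"
  let ?w = "\<lambda>j. if 0 < j \<and> j \<le> pieces S \<and> grid S (j - 1) < v then weight S (j - 1) \<omega> else 0"
  have "(\<Sum>j<?n. ?w j * (B (?s (Suc j)) \<omega> - B (?s j) \<omega>))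
    = (\<Sum>i<pieces S. ?w (Suc i) * (B (?s (Suc (Suc i))) \<omega> - B (?s (Suc i)) \<omega>))"
    by (subst sum.lessThan_Suc_shift) simp
  also have "\<dots> = (\<Sum>i<pieces S. weight S i \<omega> * (B (min v (grid S (Suc i))) \<omega> - B (min v (grid S i)) \<omega>)
    - weight S i \<omega> * (B (min u (grid S (Suc i))) \<omega> - B (min u (grid S i)) \<omega>))"
  proof (intro sum.cong refl)
    fix i assume "i \<in> {..<pieces S}"
    then have i: "i < pieces S" "grid S i \<le> grid S (Suc i)"
      using simple_adapted_grid(1)[OF assms(1), of i "Suc i"] by auto
    show "?w (Suc i) * (B (?s (Suc (Suc i))) \<omega> - B (?s (Suc i)) \<omega>)
      = weight S i \<omega> * (B (min v (grid S (Suc i))) \<omega> - B (min v (grid S i)) \<omega>)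
        - weight S i \<omega> * (B (min u (grid S (Suc i))) \<omega> - B (min u (grid S i)) \<omega>)"
      using i assms by (auto simp: refined_grid_def min_def max_def algebra_simps)
  qed
  also have "\<dots> = simple_integral S B v \<omega> - simple_integral S B u \<omega>"
    by (simp add: simple_integral_def sum_subtractf)
  finally have 1: "(\<Sum>j<?n. ?w j * (B (?s (Suc j)) \<omega> - B (?s j) \<omega>)) = \<dots>" .
  have 2: "(\<Sum>j<?n. B (?s (Suc j)) \<omega> - B (?s j) \<omega>) = B v \<omega> - B u \<omega>"
    using sum_lessThan_telescope[of "\<lambda>j. B (?s j) \<omega>" ?n] refined_grid_ends[OF assms(3)] by metis
  have "transform ?s (refined_weight S v \<kappa>) ?n \<omega>
    = (\<Sum>j<?n. ?w j * (B (?s (Suc j)) \<omega> - B (?s j) \<omega>)) - \<kappa> \<omega> * (\<Sum>j<?n. B (?s (Suc j)) \<omega> - B (?s j) \<omega>)"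
    unfolding transform_def refined_weight_def
    by (subst sum_distrib_left, subst sum_subtractf[symmetric]) (simp only: left_diff_distrib)
  then show ?thesis unfolding 1 2 .
qed

text \<open>\<open>\<xi>\<close> is the noise defect of one Euler step from \<open>u\<close> to
  \<open>v\<close>: the elementary integral uses the weights of \<open>S\<close>, the scheme a value
  \<open>\<kappa>\<close> fixed at time \<open>u\<close>. As a transform along the refined grid it
  inherits isometry and orthogonality to the past.\<close>

lemma simple_increment:
  fixes \<kappa>
  assumes "simple_adapted F S" "0 \<le> u" "u \<le> v" "L2_at u \<kappa>"
  defines "\<xi> \<equiv> \<lambda>\<omega>. simple_integral S B v \<omega> - simple_integral S B u \<omega> - \<kappa> \<omega> * (B v \<omega> - B u \<omega>)"
  shows "L2_at v \<xi>"
    and "expectation (\<lambda>\<omega>. (\<xi> \<omega>)\<^sup>2)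
      = expectation (\<lambda>\<omega>. LINT t:{u..v}|lborel. (simple_value S t \<omega> - \<kappa> \<omega>)\<^sup>2)"
    and "L2_at u Z \<Longrightarrow> expectation (\<lambda>\<omega>. Z \<omega> * \<xi> \<omega>) = 0"
proof -
  have \<xi>: "\<xi> = transform (refined_grid S u v) (refined_weight S v \<kappa>) (Suc (Suc (pieces S)))"
    using refined_transform[OF assms(1-3), of \<kappa>] by (auto simp: \<xi>_def fun_eq_iff)
  note * = transform_isometry[where s="refined_grid S u v" and k="Suc (Suc (pieces S))"
      and W="refined_weight S v \<kappa>",
      OF refined_grid_mono[OF assms(1,3)] refined_weight_L2[OF assms(1-4)],
      unfolded refined_energy(2)[OF assms(1,3)] refined_grid_ends[OF assms(3), of S],
      folded \<xi>, OF _ assms(2)]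
  show "L2_at v \<xi>"
    and "expectation (\<lambda>\<omega>. (\<xi> \<omega>)\<^sup>2)
      = expectation (\<lambda>\<omega>. LINT t:{u..v}|lborel. (simple_value S t \<omega> - \<kappa> \<omega>)\<^sup>2)"
    and "L2_at u Z \<Longrightarrow> expectation (\<lambda>\<omega>. Z \<omega> * \<xi> \<omega>) = 0"
    using * by simp_all
qed

text \<open>An inequality of Lenglart type: the transform is small in probability once its energy
  is. \<open>A\<close> may be any event, unrelated to the filtration, since Markov's inequality is
  applied on the whole space and \<open>A\<close> only restricts the exceptional sets.\<close>

lemma transform_tail:
  fixes s W k
  assumes "\<And>j. j < k \<Longrightarrow> s j \<le> s (Suc j)" "\<And>j. j < k \<Longrightarrow> L2_at (s j) (W j)" "0 \<le> s 0"
    and "A \<in> events" "0 < \<epsilon>" "0 < \<delta>"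
  shows "prob (A \<inter> {\<omega> \<in> space M. \<epsilon> < \<bar>transform s W k \<omega>\<bar>})
    \<le> prob (A \<inter> {\<omega> \<in> space M. \<delta> < (\<Sum>j<k. (W j \<omega>)\<^sup>2 * (s (Suc j) - s j))}) + \<delta> / \<epsilon>\<^sup>2"
proof -
  let ?a = "\<lambda>j \<omega>. if j < k then (W j \<omega>)\<^sup>2 * (s (Suc j) - s j) else 0"
  \<comment> \<open>Switching the weights off once the energy exceeds \<open>\<delta>\<close> leaves the transform unchanged where the
    total energy is at most \<open>\<delta>\<close>, and bounds its second moment by \<open>\<delta>\<close>.\<close>
  define V where "V j \<omega> = (if (\<Sum>i\<le>j. ?a i \<omega>) \<le> \<delta> then 1 else 0 :: real) * W j \<omega>" for j \<omega>
  have mono: "s i \<le> s j" if "i \<le> j" "j \<le> k" for i j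
    using that by (induction j rule: nat_induct) (use assms(1) in \<open>auto simp: le_Suc_eq intro: order_trans\<close>)
  have V: "L2_at (s j) (V j)" if "j < k" for j
    unfolding V_def
  proof (rule L2_at_mult_bounded[OF assms(2)[OF that], where C=1])
    have "W i \<in> borel_measurable (F (s j))" if "i \<le> j" for i
      using measurable_F_mono[OF L2_atD(2)[OF assms(2)] mono, of i j] that \<open>j < k\<close> by auto
    then have [measurable]: "(\<lambda>\<omega>. \<Sum>i\<le>j. ?a i \<omega>) \<in> borel_measurable (F (s j))"
      by (intro borel_measurable_sum) auto
    show "(\<lambda>\<omega>. if (\<Sum>i\<le>j. ?a i \<omega>) \<le> \<delta> then 1 else 0 :: real) \<in> borel_measurable (F (s j))"
      by measurable
  qed auto
  note T = transform_isometry[OF assms(1) V assms(3)]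
  have [measurable]: "transform s V k \<in> borel_measurable M" "transform s W k \<in> borel_measurable M"
    using L2_atD(3)[OF T(1)] L2_atD(3)[OF transform_isometry(1)[OF assms(1-3)]] by auto
  have Wm: "(\<lambda>\<omega>. \<Sum>j<k. (W j \<omega>)\<^sup>2 * (s (Suc j) - s j)) \<in> borel_measurable M"
    using L2_atD(3)[OF assms(2)] by (intro borel_measurable_sum) auto
  have energy: "(\<Sum>j<k. (V j \<omega>)\<^sup>2 * (s (Suc j) - s j)) \<le> \<delta>" for \<omega>
  proof -
    have "(\<Sum>j<k. (V j \<omega>)\<^sup>2 * (s (Suc j) - s j))
      = (\<Sum>j<k. if (\<Sum>i\<le>j. ?a i \<omega>) \<le> \<delta> then ?a j \<omega> else 0)"
      by (intro sum.cong) (auto simp: V_def)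
    also have "\<dots> \<le> \<delta>"
      using assms(1,6) by (intro sum_stopped_le) auto
    finally show ?thesis .
  qed
  have same: "transform s V k \<omega> = transform s W k \<omega>"
    if small: "(\<Sum>j<k. (W j \<omega>)\<^sup>2 * (s (Suc j) - s j)) \<le> \<delta>" for \<omega>
  proof -
    have "V j \<omega> = W j \<omega>" if j: "j < k" for j
    proof -
      have "(\<Sum>i\<le>j. ?a i \<omega>) \<le> (\<Sum>i<k. ?a i \<omega>)"
        using assms(1) j by (intro sum_mono2) auto
      also have "\<dots> \<le> \<delta>" using small by simp
      finally show ?thesis by (simp add: V_def)
    qed
    then show ?thesis by (simp add: transform_def)
  qed
  have "expectation (\<lambda>\<omega>. \<Sum>j<k. (V j \<omega>)\<^sup>2 * (s (Suc j) - s j)) \<le> expectation (\<lambda>\<omega>. \<delta>)"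
  proof (rule integral_mono)
    show "integrable M (\<lambda>\<omega>. \<Sum>j<k. (V j \<omega>)\<^sup>2 * (s (Suc j) - s j))"
      using L2_atD(4)[OF V] by (intro Bochner_Integration.integrable_sum integrable_mult_left) auto
  qed (use energy in auto)
  then have e: "expectation (\<lambda>\<omega>. (transform s V k \<omega>)\<^sup>2) \<le> \<delta>"
    using T(2) by (simp add: prob_space)
  have "prob {\<omega> \<in> space M. \<epsilon>\<^sup>2 \<le> (transform s V k \<omega>)\<^sup>2}
      \<le> expectation (\<lambda>\<omega>. (transform s V k \<omega>)\<^sup>2) / \<epsilon>\<^sup>2"
    using L2_atD(4)[OF T(1)] assms(5)
    by (intro integral_Markov_inequality_measure[where A="space M"]) auto
  also have "\<dots> \<le> \<delta> / \<epsilon>\<^sup>2" using e by (simp add: divide_right_mono)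
  finally have markov: "prob {\<omega> \<in> space M. \<epsilon>\<^sup>2 \<le> (transform s V k \<omega>)\<^sup>2} \<le> \<delta> / \<epsilon>\<^sup>2" .
  let ?E = "A \<inter> {\<omega> \<in> space M. \<delta> < (\<Sum>j<k. (W j \<omega>)\<^sup>2 * (s (Suc j) - s j))}"
  let ?M = "{\<omega> \<in> space M. \<epsilon>\<^sup>2 \<le> (transform s V k \<omega>)\<^sup>2}"
  have E: "?E \<in> events" using assms(4) Wm by measurable
  have "A \<inter> {\<omega> \<in> space M. \<epsilon> < \<bar>transform s W k \<omega>\<bar>} \<subseteq> ?E \<union> ?M"
  proof
    fix \<omega> assume \<omega>: "\<omega> \<in> A \<inter> {\<omega> \<in> space M. \<epsilon> < \<bar>transform s W k \<omega>\<bar>}"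
    show "\<omega> \<in> ?E \<union> ?M"
    proof (cases "\<omega> \<in> ?E")
      case False
      then have "(\<Sum>j<k. (W j \<omega>)\<^sup>2 * (s (Suc j) - s j)) \<le> \<delta>" using \<omega> by auto
      with same[of \<omega>] \<omega> assms(5) have "\<epsilon>\<^sup>2 \<le> (transform s V k \<omega>)\<^sup>2"
        by (intro abs_le_square_iff[THEN iffD1]) auto
      then show ?thesis using \<omega> by auto
    qed auto
  qed
  then have "prob (A \<inter> {\<omega> \<in> space M. \<epsilon> < \<bar>transform s W k \<omega>\<bar>}) \<le> prob (?E \<union> ?M)"
    using E by (intro finite_measure_mono) auto
  also have "\<dots> \<le> prob ?E + prob ?M" using E by (intro measure_Un_le) auto
  finally show ?thesis using markov by simp
qed

lemma simple_integral_tail: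
  assumes "simple_adapted F S" "0 \<le> t" "A \<in> events" "0 < \<epsilon>" "0 < \<delta>"
  shows "prob (A \<inter> {\<omega> \<in> space M. \<epsilon> < \<bar>simple_integral S B t \<omega> - simple_integral S B 0 \<omega>\<bar>})
    \<le> prob (A \<inter> {\<omega> \<in> space M. \<delta> < (LINT r:{0..t}|lborel. (simple_value S r \<omega>)\<^sup>2)}) + \<delta> / \<epsilon>\<^sup>2"
proof -
  have L: "L2_at 0 (\<lambda>\<omega>. 0)" by (auto simp: L2_at_def)
  show ?thesis
    using transform_tail[where s="refined_grid S 0 t" and k="Suc (Suc (pieces S))"
        and W="refined_weight S t (\<lambda>\<omega>. 0)",
        OF refined_grid_mono[OF assms(1,2)] refined_weight_L2[OF assms(1) _ assms(2) L] _ assms(3-5)]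
      refined_transform[OF assms(1) _ assms(2), of "\<lambda>\<omega>. 0"] refined_energy[OF assms(1,2), where \<kappa>="\<lambda>\<omega>. 0"]
      refined_grid_ends[OF assms(2), of S]
    by simp
qed

end

subsection \<open>Clipped integrands\<close>

definition clip :: "real \<Rightarrow> real \<Rightarrow> real" where
  "clip c x = max (- c) (min c x)"

lemma clip_measurable [measurable]: "clip c \<in> borel_measurable borel"
  by (simp add: clip_def[abs_def])

lemma clip_0 [simp]: "0 \<le> c \<Longrightarrow> clip c 0 = 0"
  by (simp add: clip_def)

lemma clip_id: "\<bar>x\<bar> \<le> c \<Longrightarrow> clip c x = x"
  by (auto simp: clip_def min_def max_def)

lemma abs_clip_le: "0 \<le> c \<Longrightarrow> \<bar>clip c x\<bar> \<le> c" "0 \<le> c \<Longrightarrow> \<bar>clip c x\<bar> \<le> \<bar>x\<bar>"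
  by (auto simp: clip_def min_def max_def)

lemma clip_lipschitz: "\<bar>clip c x - clip c y\<bar> \<le> \<bar>x - y\<bar>"
  by (auto simp: clip_def min_def max_def)

text \<open>Clipping is the projection onto \<open>[-c, c]\<close>. Hence, where the integrand is
  bounded by \<open>c\<close>, the part of a simple process that is clipped off is at most its
  distance to the integrand.\<close>

lemma clip_nearest: "\<bar>y\<bar> \<le> c \<Longrightarrow> \<bar>x - clip c x\<bar> \<le> \<bar>x - y\<bar>"
  by (auto simp: clip_def min_def max_def)

text \<open>Turns the clipped integrand \<open>clip (\<sigma> * N) (\<sigma> * Q)\<close> into
  \<open>\<sigma>\<close> times the clipped solution.\<close>

lemma clip_mult: "0 < k \<Longrightarrow> clip (k * c) (k * x) = k * clip c x"
  by (simp add: clip_def max_mult_distrib_left min_mult_distrib_left)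

text \<open>Split at \<open>r / 3\<close>: small values contribute at most \<open>r / 3\<close>, the
  exceptional event at most \<open>C\<close> times its probability, which is eventually below
  \<open>r / (3 * C)\<close>.\<close>

lemma (in prob_space) tendsto_expectation_truncated:
  fixes Y :: "nat \<Rightarrow> 'a \<Rightarrow> real"
  assumes "\<And>n. Y n \<in> borel_measurable M" "A \<in> events" "0 < C"
    and "\<And>\<epsilon>. 0 < \<epsilon> \<Longrightarrow> (\<lambda>n. prob (A \<inter> {\<omega> \<in> space M. \<epsilon> < \<bar>Y n \<omega>\<bar>})) \<longlonglongrightarrow> 0"
  shows "(\<lambda>n. expectation (\<lambda>\<omega>. indicator A \<omega> * min C \<bar>Y n \<omega>\<bar>)) \<longlonglongrightarrow> 0"
proof (rule LIMSEQ_I)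
  fix r :: real assume r: "0 < r"
  note [measurable] = assms(1,2)
  have "\<forall>\<^sub>F n in sequentially. prob (A \<inter> {\<omega> \<in> space M. r / 3 < \<bar>Y n \<omega>\<bar>}) < r / (3 * C)"
    using assms(4)[of "r / 3"] r assms(3) by (intro order_tendstoD) auto
  then obtain N where N: "\<And>n. n \<ge> N \<Longrightarrow> prob (A \<inter> {\<omega> \<in> space M. r / 3 < \<bar>Y n \<omega>\<bar>}) < r / (3 * C)"
    by (auto simp: eventually_sequentially)
  show "\<exists>N. \<forall>n\<ge>N. norm (expectation (\<lambda>\<omega>. indicator A \<omega> * min C \<bar>Y n \<omega>\<bar>) - 0) < r"
  proof (intro exI allI impI)
    fix n assume n: "n \<ge> N"
    define E where "E = A \<inter> {\<omega> \<in> space M. r / 3 < \<bar>Y n \<omega>\<bar>}"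
    have E: "E \<in> events" unfolding E_def by measurable
    have "expectation (\<lambda>\<omega>. indicator A \<omega> * min C \<bar>Y n \<omega>\<bar>)
      \<le> expectation (\<lambda>\<omega>. r / 3 + C * indicator E \<omega>)"
    proof (rule integral_mono_AE')
      show "integrable M (\<lambda>\<omega>. r / 3 + C * indicator E \<omega>)" using E
        by (intro Bochner_Integration.integrable_add integrable_mult_right integrable_real_indicator)
          (auto simp: less_top[symmetric])
      show "AE \<omega> in M. indicator A \<omega> * min C \<bar>Y n \<omega>\<bar> \<le> r / 3 + C * indicator E \<omega>"
        using r assms(3) by (intro AE_I2) (auto simp: indicator_def E_def)
      show "AE \<omega> in M. 0 \<le> r / 3 + C * indicator E \<omega>"
        using r assms(3) by (intro AE_I2) (auto simp: indicator_def)
    qed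
    also have "\<dots> = r / 3 + C * prob E"
    proof -
      have "integrable M (indicator E :: 'a \<Rightarrow> real)"
        using E by (intro integrable_real_indicator) (auto simp: less_top[symmetric])
      then show ?thesis
        using E sets.sets_into_space[OF E] by (simp add: prob_space Int_absorb2)
    qed
    also have "\<dots> < r / 3 + C * (r / (3 * C))"
      using N[OF n, folded E_def] assms(3) by (intro add_strict_left_mono mult_strict_left_mono) auto
    also have "\<dots> < r" using r assms(3) by simp
    finally show "norm (expectation (\<lambda>\<omega>. indicator A \<omega> * min C \<bar>Y n \<omega>\<bar>) - 0) < r"
      using assms(3) by (simp add: integral_nonneg_AE indicator_def)
  qed
qed

text \<open>Progressive measurability speaks about times in \<open>[0, T]\<close>. Clamping the time
  to this interval produces a jointly measurable function on the whole line, to which measurability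
  of parameter integrals applies.\<close>

lemma progressive_clamped_measurable:
  assumes "progressively_measurable F H" "0 \<le> T"
  shows "(\<lambda>(t, \<omega>). H (max 0 (min T t)) \<omega>) \<in> borel_measurable (lborel \<Otimes>\<^sub>M F T)"
proof -
  have H: "(\<lambda>(t, \<omega>). H t \<omega>) \<in> borel_measurable (restrict_space borel {0..T} \<Otimes>\<^sub>M F T)"
    using assms by (auto simp: progressively_measurable_def)
  have "(\<lambda>p. (max 0 (min T (fst p)), snd p))
      \<in> lborel \<Otimes>\<^sub>M F T \<rightarrow>\<^sub>M restrict_space borel {0..T} \<Otimes>\<^sub>M F T"
  proof (rule measurable_Pair)
    show "(\<lambda>p. max 0 (min T (fst p))) \<in> lborel \<Otimes>\<^sub>M F T \<rightarrow>\<^sub>M restrict_space borel {0..T}"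
      using assms(2) by (intro measurable_restrict_space2) auto
  qed simp
  from measurable_compose[OF this H] show ?thesis
    by (simp add: case_prod_beta)
qed

lemma progressive_path_measurable:
  assumes "progressively_measurable F H" "0 \<le> T" "\<omega> \<in> space (F T)"
  shows "(\<lambda>t. H (max 0 (min T t)) \<omega>) \<in> borel_measurable borel"
  using measurable_compose[OF measurable_Pair2' progressive_clamped_measurable[OF assms(1,2)], OF assms(3)]
  by simp

lemma set_integrable_bounded_interval:
  fixes f g :: "real \<Rightarrow> real"
  assumes "g \<in> borel_measurable borel" "\<And>t. t \<in> {u..v} \<Longrightarrow> f t = g t"
    and "\<And>t. t \<in> {u..v} \<Longrightarrow> \<bar>f t\<bar> \<le> C"
  shows "set_integrable lborel {u..v} f"
  unfolding set_integrable_def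
proof (rule Bochner_Integration.integrable_bound)
  show "integrable lborel (\<lambda>t. C * indicator {u..v} t :: real)"
    by (cases "u \<le> v") (auto simp: integrable_indicator_iff emeasure_lborel_Icc_eq)
  have "(\<lambda>t. indicator {u..v} t *\<^sub>R f t) = (\<lambda>t. indicator {u..v} t *\<^sub>R g t)"
    using assms(2) by (auto simp: indicator_def)
  then show "(\<lambda>t. indicator {u..v} t *\<^sub>R f t) \<in> borel_measurable lborel"
    using assms(1) by simp
  show "AE t in lborel. norm (indicator {u..v} t *\<^sub>R f t) \<le> norm (C * indicator {u..v} t)"
    using assms(3) by (intro AE_I2) (force simp: indicator_def)
qed

lemma simple_value_measurable [measurable]:
  "(\<lambda>t. simple_value S t \<omega>) \<in> borel_measurable borel"
  unfolding simple_value_def by measurable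

lemma simple_integral_0:
  assumes "simple_adapted F S"
  shows "simple_integral S B 0 \<omega> = 0"
proof -
  have "0 \<le> grid S i" "0 \<le> grid S (Suc i)" if "i < pieces S" for i
    using simple_adapted_grid(2)[OF assms, of i] simple_adapted_grid(2)[OF assms, of "Suc i"] that by auto
  then show ?thesis by (auto simp: simple_integral_def min_def intro!: sum.neutral)
qed

lemma simple_integral_map_weight_diff:
  "simple_integral (map_weight (\<lambda>x. x - f x) S) B t \<omega>
    = simple_integral S B t \<omega> - simple_integral (map_weight f S) B t \<omega>"
  by (simp add: simple_integral_def sum_subtractf left_diff_distrib)

lemma square_diff_integrable:
  assumes "simple_adapted F S" "progressively_measurable F H" "0 \<le> T" "\<omega> \<in> space (F T)"
    and "set_integrable lborel {0..T} (\<lambda>t. (H t \<omega>)\<^sup>2)"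
  shows "set_integrable lborel {0..T} (\<lambda>t. (simple_value S t \<omega> - H t \<omega>)\<^sup>2)"
  unfolding set_integrable_def
proof (rule Bochner_Integration.integrable_bound)
  have "set_integrable lborel {0..T} (\<lambda>t. (simple_value S t \<omega>)\<^sup>2)"
    using refined_energy(1)[OF assms(1,3), where \<kappa>="\<lambda>_. 0"] by simp
  then have "set_integrable lborel {0..T} (\<lambda>t. 2 * (simple_value S t \<omega>)\<^sup>2 + 2 * (H t \<omega>)\<^sup>2)"
    using assms(5) by simp
  then show "integrable lborel (\<lambda>t. indicator {0..T} t *\<^sub>R (2 * (simple_value S t \<omega>)\<^sup>2 + 2 * (H t \<omega>)\<^sup>2))"
    by (simp add: set_integrable_def)
  have [measurable]: "(\<lambda>t. H (max 0 (min T t)) \<omega>) \<in> borel_measurable borel"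
    by (rule progressive_path_measurable[OF assms(2-4)])
  have "(\<lambda>t. indicator {0..T} t *\<^sub>R (simple_value S t \<omega> - H t \<omega>)\<^sup>2)
      = (\<lambda>t. indicator {0..T} t *\<^sub>R (simple_value S t \<omega> - H (max 0 (min T t)) \<omega>)\<^sup>2)"
    by (auto simp: indicator_def fun_eq_iff)
  then show "(\<lambda>t. indicator {0..T} t *\<^sub>R (simple_value S t \<omega> - H t \<omega>)\<^sup>2) \<in> borel_measurable lborel"
    by simp
  show "AE t in lborel. norm (indicator {0..T} t *\<^sub>R (simple_value S t \<omega> - H t \<omega>)\<^sup>2)
      \<le> norm (indicator {0..T} t *\<^sub>R (2 * (simple_value S t \<omega>)\<^sup>2 + 2 * (H t \<omega>)\<^sup>2))"
    using power2_add_le[of "simple_value S _ \<omega>" "- H _ \<omega>"]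
    by (intro AE_I2) (auto simp: indicator_def)
qed

context brownian_motion
begin

section \<open>Clipping does not change the limit on the good event\<close>

lemma simple_integral_measurable:
  assumes "simple_adapted F S" "0 \<le> t"
  shows "simple_integral S B t \<in> borel_measurable M"
proof -
  have "L2_at 0 (\<lambda>\<omega>. 0)" by (auto simp: L2_at_def)
  from L2_atD(3)[OF simple_increment(1)[OF assms(1) order_refl assms(2) this]]
  show ?thesis using simple_integral_0[OF assms(1)] by simp
qed

text \<open>On \<open>A\<close> the energy of the part clipped off is at most the approximation
  error, by \<open>clip_nearest\<close>; so its integral tends to 0 in probability on
  \<open>A\<close>, and the clipped integrals have the same limit there as the original ones.
  Truncation at 1 turns this into convergence of expectations.\<close>

lemma clipped_integral_limit:
  fixes S :: "nat \<Rightarrow> 'a simple_process"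
  assumes "progressively_measurable F H" "AE \<omega> in M. set_integrable lborel {0..T} (\<lambda>t. (H t \<omega>)\<^sup>2)"
    and S: "\<And>n. simple_adapted F (S n)"
    and "converges_in_prob M
           (\<lambda>n \<omega>. LINT t:{0..T}|lborel. (simple_value (S n) t \<omega> - H t \<omega>)\<^sup>2) (\<lambda>\<omega>. 0)"
    and "converges_in_prob M (\<lambda>n. simple_integral (S n) B t) (I t)"
    and "0 \<le> t" "t \<le> T" "0 < c" "A \<in> events"
    and "\<And>\<omega> r. \<omega> \<in> A \<Longrightarrow> 0 \<le> r \<Longrightarrow> r \<le> T \<Longrightarrow> \<bar>H r \<omega>\<bar> \<le> c"
  shows "(\<lambda>n. expectation (\<lambda>\<omega>. indicator A \<omega> *
    min 1 \<bar>simple_integral (map_weight (clip c) (S n)) B t \<omega> - I t \<omega>\<bar>)) \<longlonglongrightarrow> 0"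
proof -
  let ?C = "\<lambda>n. map_weight (clip c) (S n)" and ?D = "\<lambda>n. map_weight (\<lambda>x. x - clip c x) (S n)"
  let ?U = "\<lambda>n \<omega>. LINT t:{0..T}|lborel. (simple_value (S n) t \<omega> - H t \<omega>)\<^sup>2"
  have C: "simple_adapted F (?C n)" for n
    using S assms(8) by (intro simple_adapted_map_weight) (auto simp: abs_clip_le)
  have D: "simple_adapted F (?D n)" for n
    using S assms(8) by (intro simple_adapted_map_weight) (auto simp: clip_def min_def max_def)
  note [measurable] = simple_integral_measurable[OF C assms(6)] simple_integral_measurable[OF S assms(6)]
    simple_integral_measurable[OF D assms(6)] assms(9)
  have [measurable]: "I t \<in> borel_measurable M" "?U n \<in> borel_measurable M" for n
    using assms(4,5) by (auto simp: converges_in_prob_def)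
  have energy: "AE \<omega> in M. \<omega> \<in> A \<longrightarrow> (LINT r:{0..t}|lborel. (simple_value (?D n) r \<omega>)\<^sup>2) \<le> ?U n \<omega>" for n
    using assms(2) AE_space
  proof eventually_elim
    case (elim \<omega>)
    then have \<omega>: "\<omega> \<in> space (F T)" using space_F by auto
    show ?case
    proof
      assume A: "\<omega> \<in> A"
      have "set_integrable lborel {0..T} (\<lambda>t. (simple_value (S n) t \<omega> - H t \<omega>)\<^sup>2)"
        using square_diff_integrable[OF S assms(1) _ \<omega> elim(1)] assms by auto
      then show "(LINT r:{0..t}|lborel. (simple_value (?D n) r \<omega>)\<^sup>2) \<le> ?U n \<omega>"
        unfolding set_lebesgue_integral_def
      proof (intro integral_mono)
        show "integrable lborel (\<lambda>r. indicator {0..t} r *\<^sub>R (simple_value (?D n) r \<omega>)\<^sup>2)"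
          using refined_energy(1)[OF D assms(6), where \<kappa>="\<lambda>_. 0"] by (simp add: set_integrable_def)
        fix r
        have "\<bar>simple_value (S n) r \<omega> - clip c (simple_value (S n) r \<omega>)\<bar> \<le> \<bar>simple_value (S n) r \<omega> - H r \<omega>\<bar>"
          if "0 \<le> r" "r \<le> t" using assms(10)[OF A, of r] assms(7) that by (intro clip_nearest) auto
        then show "indicator {0..t} r *\<^sub>R (simple_value (?D n) r \<omega>)\<^sup>2
          \<le> indicator {0..T} r *\<^sub>R (simple_value (S n) r \<omega> - H r \<omega>)\<^sup>2"
          using assms(7,8) simple_value_map_weight[OF S, of "\<lambda>x. x - clip c x" n r \<omega>]
          by (auto simp: indicator_def abs_le_square_iff)
      qed (simp add: set_integrable_def)
    qed
  qed
  show ?thesis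
  proof (rule tendsto_expectation_truncated)
    fix \<epsilon> :: real assume \<epsilon>: "0 < \<epsilon>"
    show "(\<lambda>n. prob (A \<inter> {\<omega> \<in> space M. \<epsilon> < \<bar>simple_integral (?C n) B t \<omega> - I t \<omega>\<bar>})) \<longlonglongrightarrow> 0"
    proof (rule LIMSEQ_I)
      fix r :: real assume r: "0 < r"
      \<comment> \<open>Makes the Markov term of the tail bound at level
        \<open>\<epsilon> / 2\<close> equal to \<open>r / 4\<close>. With \<open>r / 4\<close> for
        the energy and \<open>r / 4\<close> for the original integral, the total stays below
        \<open>r\<close>.\<close>
      define \<delta> where "\<delta> = r / 4 * (\<epsilon> / 2)\<^sup>2"
      have \<delta>: "0 < \<delta>" "\<delta> / (\<epsilon> / 2)\<^sup>2 = r / 4" using r \<epsilon> by (auto simp: \<delta>_def)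
      let ?PU = "\<lambda>n. {\<omega> \<in> space M. \<delta> < \<bar>?U n \<omega>\<bar>}"
      let ?PI = "\<lambda>n. {\<omega> \<in> space M. \<epsilon> / 2 < \<bar>simple_integral (S n) B t \<omega> - I t \<omega>\<bar>}"
      let ?PD = "\<lambda>n. A \<inter> {\<omega> \<in> space M. \<epsilon> / 2 < \<bar>simple_integral (?D n) B t \<omega>\<bar>}"
      have "(\<lambda>n. prob (?PU n)) \<longlonglongrightarrow> 0"
        using assms(4) \<delta>(1) by (simp add: converges_in_prob_def)
      then have "\<forall>\<^sub>F n in sequentially. prob (?PU n) < r / 4"
        using r by (intro order_tendstoD) auto
      moreover have "(\<lambda>n. prob (?PI n)) \<longlonglongrightarrow> 0"
        using assms(5) half_gt_zero[OF \<epsilon>] unfolding converges_in_prob_def by blast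
      then have "\<forall>\<^sub>F n in sequentially. prob (?PI n) < r / 4"
        using r by (intro order_tendstoD) auto
      ultimately have "\<forall>\<^sub>F n in sequentially.
        norm (prob (A \<inter> {\<omega> \<in> space M. \<epsilon> < \<bar>simple_integral (?C n) B t \<omega> - I t \<omega>\<bar>}) - 0) < r"
      proof eventually_elim
        case (elim n)
        have "prob (?PD n) \<le> prob (A \<inter> {\<omega> \<in> space M. \<delta> < (LINT r:{0..t}|lborel. (simple_value (?D n) r \<omega>)\<^sup>2)}) + r / 4"
          using simple_integral_tail[OF D assms(6,9), of "\<epsilon> / 2" \<delta> n] simple_integral_0[OF D] \<epsilon> \<delta> by simp
        also have "prob (A \<inter> {\<omega> \<in> space M. \<delta> < (LINT r:{0..t}|lborel. (simple_value (?D n) r \<omega>)\<^sup>2)}) \<le> prob (?PU n)"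
          using energy[of n] by (intro finite_measure_mono_AE) auto
        finally have pd: "prob (?PD n) < r / 2" using elim by simp
        have "A \<inter> {\<omega> \<in> space M. \<epsilon> < \<bar>simple_integral (?C n) B t \<omega> - I t \<omega>\<bar>} \<subseteq> ?PD n \<union> ?PI n"
        proof
          fix \<omega> assume \<omega>: "\<omega> \<in> A \<inter> {\<omega> \<in> space M. \<epsilon> < \<bar>simple_integral (?C n) B t \<omega> - I t \<omega>\<bar>}"
          then have "\<epsilon> / 2 < \<bar>simple_integral (S n) B t \<omega> - simple_integral (?C n) B t \<omega>\<bar>
              \<or> \<epsilon> / 2 < \<bar>simple_integral (S n) B t \<omega> - I t \<omega>\<bar>" 
            by (auto simp: abs_if split: if_splits)
          then show "\<omega> \<in> ?PD n \<union> ?PI n"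
            using \<omega> simple_integral_map_weight_diff[of "clip c" "S n" B t \<omega>] by auto
        qed
        then have "prob (A \<inter> {\<omega> \<in> space M. \<epsilon> < \<bar>simple_integral (?C n) B t \<omega> - I t \<omega>\<bar>})
            \<le> prob (?PD n \<union> ?PI n)"
          by (intro finite_measure_mono) auto
        also have "\<dots> \<le> prob (?PD n) + prob (?PI n)" by (intro measure_Un_le) auto
        finally show ?case using elim pd r by simp
      qed
      then show "\<exists>N. \<forall>n\<ge>N. norm (prob (A \<inter> {\<omega> \<in> space M. \<epsilon> < \<bar>simple_integral (?C n) B t \<omega> - I t \<omega>\<bar>}) - 0) < r"
        by (simp add: eventually_sequentially)
    qed
  qed auto
qed

text \<open>Insert the clipped integrand between the clipped simple process and the constant
  \<open>k\<close>. The first difference is bounded by the approximation error, as clipping is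
  1-Lipschitz, and also by \<open>2 * c\<close>; this gives the truncated error, whose expectation
  tends to 0. It is integrated over all of \<open>[0, T]\<close>, a loss that is harmless as long as
  the number of steps is fixed. \<open>T + 1\<close> keeps the truncation level positive also at
  \<open>T = 0\<close>.\<close>

lemma clipped_energy_le:
  assumes "progressively_measurable F H" "set_integrable lborel {0..T} (\<lambda>t. (H t \<omega>)\<^sup>2)"
    and S: "simple_adapted F S" and "\<omega> \<in> space M" "0 < c"
    and "0 \<le> u" "u \<le> v" "v \<le> T"
    and w: "\<And>t. u \<le> t \<Longrightarrow> t \<le> v \<Longrightarrow> \<bar>clip c (H t \<omega>) - k\<bar> \<le> w"
  shows "(LINT t:{u..v}|lborel. (simple_value (map_weight (clip c) S) t \<omega> - k)\<^sup>2)
    \<le> 2 * min (4 * c\<^sup>2 * (T + 1)) \<bar>LINT t:{0..T}|lborel. (simple_value S t \<omega> - H t \<omega>)\<^sup>2\<bar> + 2 * (v - u) * w\<^sup>2"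
proof -
  have T: "0 \<le> T" using assms by simp
  have \<omega>: "\<omega> \<in> space (F T)" using assms(4) space_F by auto
  let ?f = "\<lambda>t. clip c (simple_value S t \<omega>) - clip c (H t \<omega>)"
  have c: "0 \<le> c" using assms by simp
  have f4: "(?f t)\<^sup>2 \<le> 4 * c\<^sup>2" for t
  proof -
    have "\<bar>?f t\<bar> \<le> \<bar>2 * c\<bar>"
      using abs_clip_le(1)[OF c, of "simple_value S t \<omega>"] abs_clip_le(1)[OF c, of "H t \<omega>"] c by linarith
    then have "(?f t)\<^sup>2 \<le> (2 * c)\<^sup>2" by (simp only: abs_le_square_iff)
    then show ?thesis by (simp add: power_mult_distrib)
  qed
  have [measurable]: "(\<lambda>t. H (max 0 (min T t)) \<omega>) \<in> borel_measurable borel"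
    using progressive_path_measurable[OF assms(1) T \<omega>] .
  have f_int: "set_integrable lborel {a..b} (\<lambda>t. (?f t)\<^sup>2)" if "0 \<le> a" "b \<le> T" for a b
  proof (rule set_integrable_bounded_interval)
    show "(\<lambda>t. (clip c (simple_value S t \<omega>) - clip c (H (max 0 (min T t)) \<omega>))\<^sup>2) \<in> borel_measurable borel"
      by measurable
  qed (use f4 that in auto)
  have "(LINT t:{0..T}|lborel. (?f t)\<^sup>2) \<le> (LINT t:{0..T}|lborel. 4 * c\<^sup>2)"
    using f_int[of 0 T] f4
    by (intro set_integral_mono) (auto simp: set_integrable_def integrable_indicator_iff emeasure_lborel_Icc_eq)
  also have "\<dots> \<le> 4 * c\<^sup>2 * (T + 1)" using T by (simp add: set_lebesgue_integral_def algebra_simps)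
  finally have 1: "(LINT t:{0..T}|lborel. (?f t)\<^sup>2) \<le> 4 * c\<^sup>2 * (T + 1)" .
  have "(LINT t:{0..T}|lborel. (?f t)\<^sup>2) \<le> (LINT t:{0..T}|lborel. (simple_value S t \<omega> - H t \<omega>)\<^sup>2)"
    using f_int[of 0 T] square_diff_integrable[OF S assms(1) T \<omega> assms(2)] clip_lipschitz
    by (intro set_integral_mono) (auto simp: abs_le_square_iff[symmetric])
  then have 2: "(LINT t:{0..T}|lborel. (?f t)\<^sup>2)
      \<le> min (4 * c\<^sup>2 * (T + 1)) \<bar>LINT t:{0..T}|lborel. (simple_value S t \<omega> - H t \<omega>)\<^sup>2\<bar>"
    using 1 by auto
  have 3: "(LINT t:{u..v}|lborel. (?f t)\<^sup>2) \<le> (LINT t:{0..T}|lborel. (?f t)\<^sup>2)"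
    unfolding set_lebesgue_integral_def
    using f_int[of u v] f_int[of 0 T] assms(6-8)
    by (intro integral_mono) (auto simp: set_integrable_def indicator_def)
  have C: "simple_adapted F (map_weight (clip c) S)"
    using S c by (intro simple_adapted_map_weight) (auto simp: abs_clip_le)
  have "(LINT t:{u..v}|lborel. (simple_value (map_weight (clip c) S) t \<omega> - k)\<^sup>2)
    \<le> (LINT t:{u..v}|lborel. 2 * (?f t)\<^sup>2 + 2 * w\<^sup>2)"
  proof (rule set_integral_mono)
    show "set_integrable lborel {u..v} (\<lambda>t. (simple_value (map_weight (clip c) S) t \<omega> - k)\<^sup>2)"
      using refined_energy(1)[OF C assms(7), where \<kappa>="\<lambda>_. k"] by simp
    show "set_integrable lborel {u..v} (\<lambda>t. 2 * (?f t)\<^sup>2 + 2 * w\<^sup>2)"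
      using set_integral_add(1)[OF set_integrable_mult_right[OF f_int[OF assms(6,8)], of 2], of "\<lambda>t. 2 * w\<^sup>2"]
      by (auto simp: set_integrable_def integrable_indicator_iff emeasure_lborel_Icc_eq)
    fix t assume t: "t \<in> {u..v}"
    have "(simple_value (map_weight (clip c) S) t \<omega> - k)\<^sup>2 = (?f t + (clip c (H t \<omega>) - k))\<^sup>2"
      using simple_value_map_weight[OF S, of "clip c"] c by simp
    also have "\<dots> \<le> 2 * (?f t)\<^sup>2 + 2 * (clip c (H t \<omega>) - k)\<^sup>2" by (rule power2_add_le)
    also have "(clip c (H t \<omega>) - k)\<^sup>2 \<le> w\<^sup>2"
      using w[of t] t by (intro abs_le_square_iff[THEN iffD1]) force
    finally show "(simple_value (map_weight (clip c) S) t \<omega> - k)\<^sup>2 \<le> 2 * (?f t)\<^sup>2 + 2 * w\<^sup>2" by simp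
  qed
  also have "\<dots> = 2 * (LINT t:{u..v}|lborel. (?f t)\<^sup>2) + 2 * (v - u) * w\<^sup>2"
  proof -
    have "(LINT t:{u..v}|lborel. 2 * w\<^sup>2) = 2 * (v - u) * w\<^sup>2"
      using assms(7) by (simp add: set_lebesgue_integral_def)
    then show ?thesis
      using set_integrable_mult_right[OF f_int[OF assms(6,8)], of 2]
      by (subst set_integral_add(2))
        (auto simp: set_integrable_def integrable_indicator_iff emeasure_lborel_Icc_eq)
  qed
  finally show ?thesis using 2 3 by linarith
qed

end

subsection \<open>Modulus of continuity and error recursion\<close>

text \<open>The rationals of the open interval are dense in \<open>{a..b}\<close> as soon as
  \<open>a < b\<close>. This reduces suprema, events and almost sure statements over all times to
  countably many times; degenerate intervals are treated apart.\<close>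

lemma continuous_le_on_rationals:
  fixes f :: "real \<Rightarrow> real"
  assumes "continuous_on {a..b} f" "a < b" "\<And>r. r \<in> \<rat> \<Longrightarrow> a \<le> r \<Longrightarrow> r \<le> b \<Longrightarrow> f r \<le> z"
    and "x \<in> {a..b}"
  shows "f x \<le> z"
proof -
  have cl: "closure ({a<..<b} \<inter> \<rat>) = {a..b}"
    using closure_open_Int_superset[of "{a<..<b}" "\<rat>"] assms(2) by (simp add: Rats_closure_real)
  show ?thesis
    by (rule continuous_le_on_closure[of "{a<..<b} \<inter> \<rat>"]) (use assms cl in auto)
qed

text \<open>The largest deviation of the path from its value at the left end of the current step,
  over the \<open>Suc n\<close> steps of \<open>[0, T]\<close>. In \<open>p\<close>, the first
  component numbers the step and the second is the relative position in it, restricted to rationals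
  so that the supremum is measurable.\<close>

definition grid_modulus :: "(real \<Rightarrow> 'a \<Rightarrow> real) \<Rightarrow> real \<Rightarrow> nat \<Rightarrow> 'a \<Rightarrow> real" where
  "grid_modulus K T n \<omega> = (SUP p\<in>{..n} \<times> (\<rat> \<inter> {0..1}).
     \<bar>K ((real (fst p) + snd p) * (T / Suc n)) \<omega> - K (real (fst p) * (T / Suc n)) \<omega>\<bar>)"

lemma grid_modulus_bounds:
  assumes "\<And>t. 0 \<le> t \<Longrightarrow> \<bar>K t \<omega>\<bar> \<le> C" "0 < T"
  shows "bdd_above ((\<lambda>p. \<bar>K ((real (fst p) + snd p) * (T / Suc n)) \<omega> - K (real (fst p) * (T / Suc n)) \<omega>\<bar>)
      ` ({..n} \<times> (\<rat> \<inter> {0..1})))"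
    and "0 \<le> grid_modulus K T n \<omega>" "grid_modulus K T n \<omega> \<le> 2 * C"
proof -
  let ?f = "\<lambda>p. \<bar>K ((real (fst p) + snd p) * (T / Suc n)) \<omega> - K (real (fst p) * (T / Suc n)) \<omega>\<bar>"
  let ?J = "{..n} \<times> (\<rat> \<inter> {0..1::real})"
  have *: "?f p \<le> 2 * C" if "p \<in> ?J" for p
  proof -
    have "0 \<le> (real (fst p) + snd p) * (T / Suc n)" "0 \<le> real (fst p) * (T / Suc n)"
      using that assms(2) by auto
    from assms(1)[OF this(1)] assms(1)[OF this(2)] show ?thesis by linarith
  qed
  show bdd: "bdd_above (?f ` ?J)" using * by (intro bdd_aboveI[where M="2 * C"]) blast
  have ne: "(0, 0) \<in> ?J" by auto
  have "?f (0, 0) \<le> grid_modulus K T n \<omega>"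
    unfolding grid_modulus_def using bdd ne by (intro cSUP_upper)
  then show "0 \<le> grid_modulus K T n \<omega>" by simp
  show "grid_modulus K T n \<omega> \<le> 2 * C"
    unfolding grid_modulus_def using * ne by (intro cSUP_least) auto
qed

lemma grid_modulus_upper:
  assumes "\<And>t. 0 \<le> t \<Longrightarrow> \<bar>K t \<omega>\<bar> \<le> C" "0 < T" "continuous_on {0..} (\<lambda>t. K t \<omega>)"
    and "i \<le> n" "real i * (T / Suc n) \<le> t" "t \<le> real (Suc i) * (T / Suc n)"
  shows "\<bar>K t \<omega> - K (real i * (T / Suc n)) \<omega>\<bar> \<le> grid_modulus K T n \<omega>"
proof -
  let ?h = "T / Suc n"
  have h: "0 < ?h" using assms(2) by simp
  define r where "r = t / ?h - real i"
  have r: "r \<in> {0..1}" using assms(5,6) h by (auto simp: r_def field_simps)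
  have t: "t = (real i + r) * ?h" using h assms(2) by (simp add: r_def)
  have "\<bar>K ((real i + r) * ?h) \<omega> - K (real i * ?h) \<omega>\<bar> \<le> grid_modulus K T n \<omega>"
  proof (rule continuous_le_on_rationals[OF _ zero_less_one _ r])
    have "continuous_on {0..1} (\<lambda>r. K ((real i + r) * ?h) \<omega>)"
      by (rule continuous_on_compose2[OF assms(3)]) (use assms(2) in \<open>auto intro!: continuous_intros\<close>)
    then show "continuous_on {0..1} (\<lambda>r. \<bar>K ((real i + r) * ?h) \<omega> - K (real i * ?h) \<omega>\<bar>)"
      by (intro continuous_intros)
    fix q :: real assume "q \<in> \<rat>" "0 \<le> q" "q \<le> 1"
    then show "\<bar>K ((real i + q) * ?h) \<omega> - K (real i * ?h) \<omega>\<bar> \<le> grid_modulus K T n \<omega>"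
      using cSUP_upper[OF _ grid_modulus_bounds(1)[where K=K and \<omega>=\<omega> and C=C, OF assms(1,2)], of "(i, q)" n]
        assms(4)
      by (simp add: grid_modulus_def)
  qed
  then show ?thesis unfolding t .
qed

lemma grid_modulus_tendsto_0:
  assumes "\<And>t. 0 \<le> t \<Longrightarrow> \<bar>K t \<omega>\<bar> \<le> C" "0 < T" "continuous_on {0..} (\<lambda>t. K t \<omega>)"
  shows "(\<lambda>n. grid_modulus K T n \<omega>) \<longlonglongrightarrow> 0"
proof (rule LIMSEQ_I)
  fix \<epsilon> :: real assume \<epsilon>: "0 < \<epsilon>"
  have "uniformly_continuous_on {0..T} (\<lambda>t. K t \<omega>)"
    by (intro compact_uniformly_continuous continuous_on_subset[OF assms(3)]) auto
  then obtain d where d: "0 < d"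
    "\<And>s t. s \<in> {0..T} \<Longrightarrow> t \<in> {0..T} \<Longrightarrow> dist t s < d \<Longrightarrow> dist (K t \<omega>) (K s \<omega>) < \<epsilon> / 2"
    unfolding uniformly_continuous_on_def using \<epsilon> by (meson half_gt_zero)
  obtain N :: nat where N: "T / d < real N" using reals_Archimedean2 by blast
  show "\<exists>N. \<forall>n\<ge>N. norm (grid_modulus K T n \<omega> - 0) < \<epsilon>"
  proof (intro exI allI impI)
    fix n assume n: "n \<ge> N"
    let ?h = "T / Suc n"
    have "T / d < real (Suc n)" using N n by simp
    then have hd: "?h < d" using d(1) by (simp add: field_simps)
    have "grid_modulus K T n \<omega> \<le> \<epsilon> / 2"
      unfolding grid_modulus_def
    proof (rule cSUP_least)
      fix p assume "p \<in> {..n} \<times> (\<rat> \<inter> {0..1::real})"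
      then obtain i q where p: "p = (i, q)" "i \<le> n" "0 \<le> q" "q \<le> 1" by auto
      have le: "(real i + q) * ?h \<le> T" "real i * ?h \<le> T"
      proof -
        have "(real i + q) * ?h \<le> real (Suc n) * ?h" "real i * ?h \<le> real (Suc n) * ?h"
          using p assms(2) by (intro mult_right_mono; simp)+
        then show "(real i + q) * ?h \<le> T" "real i * ?h \<le> T" by simp_all
      qed
      have "q * ?h \<le> 1 * ?h" using p assms(2) by (intro mult_right_mono) auto
      moreover have "0 \<le> q * ?h" using p assms(2) by simp
      moreover have "(real i + q) * ?h - real i * ?h = q * ?h" by (simp only: distrib_right)
      ultimately have "dist ((real i + q) * ?h) (real i * ?h) < d"
        using hd unfolding dist_real_def by linarith
      with d(2)[of "real i * ?h" "(real i + q) * ?h"] le p assms(2)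
      show "\<bar>K ((real (fst p) + snd p) * ?h) \<omega> - K (real (fst p) * ?h) \<omega>\<bar> \<le> \<epsilon> / 2"
        by (simp add: dist_real_def)
    qed (auto intro!: exI[of _ "(0,0)"])
    then show "norm (grid_modulus K T n \<omega> - 0) < \<epsilon>"
      using grid_modulus_bounds(2)[where K=K and \<omega>=\<omega> and C=C, OF assms(1,2), of n] \<epsilon> by simp
  qed
qed

lemma grid_modulus_measurable:
  assumes "\<And>t. 0 \<le> t \<Longrightarrow> K t \<in> borel_measurable M" "0 < T"
    and "\<And>t \<omega>. 0 \<le> t \<Longrightarrow> \<omega> \<in> space M \<Longrightarrow> \<bar>K t \<omega>\<bar> \<le> C"
  shows "grid_modulus K T n \<in> borel_measurable M"
  unfolding grid_modulus_def[abs_def]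
proof (rule borel_measurable_cSUP)
  show "countable ({..n} \<times> (\<rat> \<inter> {0..1::real}))"
    by (intro countable_SIGMA countable_Int1 countable_rat) auto
  fix p assume p: "p \<in> {..n} \<times> (\<rat> \<inter> {0..1::real})"
  have "K ((real (fst p) + snd p) * (T / Suc n)) \<in> borel_measurable M"
    "K (real (fst p) * (T / Suc n)) \<in> borel_measurable M"
    using p assms(2) by (auto intro!: assms(1))
  then show "(\<lambda>\<omega>. \<bar>K ((real (fst p) + snd p) * (T / Suc n)) \<omega> - K (real (fst p) * (T / Suc n)) \<omega>\<bar>) \<in> borel_measurable M"
    by simp
next
  fix \<omega> assume "\<omega> \<in> space M"
  with assms(2,3) show "bdd_above ((\<lambda>p. \<bar>K ((real (fst p) + snd p) * (T / Suc n)) \<omega>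
      - K (real (fst p) * (T / Suc n)) \<omega>\<bar>) ` ({..n} \<times> (\<rat> \<inter> {0..1})))"
    by (intro grid_modulus_bounds(1)) auto
qed

text \<open>Pathwise the modulus tends to 0 by uniform continuity, and it is dominated by the
  constant \<open>2 * C\<close>. This domination is what the clipped solution offers and
  \<open>Q\<close> itself does not.\<close>

lemma (in prob_space) grid_modulus_second_moment:
  assumes "\<And>t. 0 \<le> t \<Longrightarrow> K t \<in> borel_measurable M" "0 < T"
    and "\<And>t \<omega>. 0 \<le> t \<Longrightarrow> \<omega> \<in> space M \<Longrightarrow> \<bar>K t \<omega>\<bar> \<le> C"
    and "\<And>\<omega>. \<omega> \<in> space M \<Longrightarrow> continuous_on {0..} (\<lambda>t. K t \<omega>)"
  shows "integrable M (\<lambda>\<omega>. (grid_modulus K T n \<omega>)\<^sup>2)"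
    and "(\<lambda>n. expectation (\<lambda>\<omega>. (grid_modulus K T n \<omega>)\<^sup>2)) \<longlonglongrightarrow> 0"
proof -
  note [measurable] = grid_modulus_measurable[OF assms(1-3)]
  have b: "AE \<omega> in M. norm ((grid_modulus K T n \<omega>)\<^sup>2) \<le> (2 * C)\<^sup>2" for n
  proof (rule AE_I2)
    fix \<omega> assume "\<omega> \<in> space M"
    then have "0 \<le> grid_modulus K T n \<omega>" "grid_modulus K T n \<omega> \<le> 2 * C"
      using assms(2,3) by (auto intro!: grid_modulus_bounds)
    then have "(grid_modulus K T n \<omega>)\<^sup>2 \<le> (2 * C)\<^sup>2" by (intro power_mono)
    then show "norm ((grid_modulus K T n \<omega>)\<^sup>2) \<le> (2 * C)\<^sup>2" by simp
  qed
  show "integrable M (\<lambda>\<omega>. (grid_modulus K T n \<omega>)\<^sup>2)"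
    by (rule integrable_const_bound[OF b]) simp
  have "(\<lambda>n. expectation (\<lambda>\<omega>. (grid_modulus K T n \<omega>)\<^sup>2)) \<longlonglongrightarrow> expectation (\<lambda>\<omega>. 0)"
  proof (rule integral_dominated_convergence[where w="\<lambda>_. (2 * C)\<^sup>2"])
    show "AE \<omega> in M. (\<lambda>n. (grid_modulus K T n \<omega>)\<^sup>2) \<longlonglongrightarrow> 0"
    proof (rule AE_I2)
      fix \<omega> assume "\<omega> \<in> space M"
      then have "(\<lambda>n. grid_modulus K T n \<omega>) \<longlonglongrightarrow> 0"
        using assms by (intro grid_modulus_tendsto_0) auto
      from tendsto_power[OF this, of 2] show "(\<lambda>n. (grid_modulus K T n \<omega>)\<^sup>2) \<longlonglongrightarrow> 0" by simp
    qed
  qed (use b in auto)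
  then show "(\<lambda>n. expectation (\<lambda>\<omega>. (grid_modulus K T n \<omega>)\<^sup>2)) \<longlonglongrightarrow> 0" by simp
qed

text \<open>The increment of the error is a drift part \<open>?u\<close> plus a noise part
  \<open>?m\<close>. Young's inequality is applied to \<open>2 * e * ?u\<close> only, with weight
  \<open>h\<close>: the drift defect \<open>p\<close> is of order \<open>h\<close> times a modulus,
  so \<open>p^2 / h\<close> can be summed over about \<open>1 / h\<close> steps. The product
  \<open>2 * e * ?m\<close> is kept exactly, as the last bracket, because its expectation will
  vanish.\<close>

lemma error_step_le:
  fixes e p q r g c d h \<sigma> D :: real
  assumes h: "0 < h" and "0 \<le> c" "c \<le> d" "g = 0 \<or> g = 1"
  shows "(e + g * (- (c * h) * e - p + \<sigma> * e * D + q))\<^sup>2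
    \<le> (1 + h + 2 * d\<^sup>2 * h + 4 * d\<^sup>2 * h\<^sup>2) * e\<^sup>2 + (2 / h + 4) * p\<^sup>2
      + 4 * \<sigma>\<^sup>2 * (e * D)\<^sup>2 + 4 * q\<^sup>2 + (2 * \<sigma> * (e * (g * e * D)) + 2 * (g * e * q))"
proof -
  let ?u = "g * (- (c * h) * e - p)" and ?m = "g * (\<sigma> * e * D + q)"
  have g2: "g\<^sup>2 \<le> 1" using assms(4) by auto
  have "(- (c * h) * e - p)\<^sup>2 \<le> 2 * (- (c * h) * e)\<^sup>2 + 2 * (- p)\<^sup>2"
    using power2_add_le[of "- (c * h) * e" "- p"] by simp
  also have "\<dots> = 2 * (c\<^sup>2 * (h\<^sup>2 * e\<^sup>2)) + 2 * p\<^sup>2" by (simp add: power_mult_distrib)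
  also have "\<dots> \<le> 2 * (d\<^sup>2 * (h\<^sup>2 * e\<^sup>2)) + 2 * p\<^sup>2"
    using assms(2,3) by (intro add_mono mult_left_mono mult_right_mono power_mono) auto
  finally have u0: "(- (c * h) * e - p)\<^sup>2 \<le> 2 * (d\<^sup>2 * (h\<^sup>2 * e\<^sup>2)) + 2 * p\<^sup>2" .
  have u: "?u\<^sup>2 \<le> 2 * (d\<^sup>2 * (h\<^sup>2 * e\<^sup>2)) + 2 * p\<^sup>2"
    using assms(4) u0 by (auto intro: order_trans[OF zero_le_power2 u0])
  have m0: "(\<sigma> * e * D + q)\<^sup>2 \<le> 2 * (\<sigma>\<^sup>2 * (e * D)\<^sup>2) + 2 * q\<^sup>2"
    using power2_add_le[of "\<sigma> * e * D" q] by (simp add: power_mult_distrib mult.assoc)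
  have m: "?m\<^sup>2 \<le> 2 * (\<sigma>\<^sup>2 * (e * D)\<^sup>2) + 2 * q\<^sup>2"
    using assms(4) m0 by auto
  have "0 \<le> (h * e - ?u)\<^sup>2 / h" using h by simp
  then have eu: "2 * e * ?u \<le> h * e\<^sup>2 + ?u\<^sup>2 / h"
    using h by (simp add: power2_diff field_simps power2_eq_square)
  have "?u\<^sup>2 / h \<le> (2 * (d\<^sup>2 * (h\<^sup>2 * e\<^sup>2)) + 2 * p\<^sup>2) / h"
    using u h by (simp add: divide_right_mono)
  also have "\<dots> = 2 * d\<^sup>2 * h * e\<^sup>2 + 2 / h * p\<^sup>2"
    using h by (simp add: field_simps power2_eq_square)
  finally have uh: "?u\<^sup>2 / h \<le> 2 * d\<^sup>2 * h * e\<^sup>2 + 2 / h * p\<^sup>2" .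
  have "(e + g * (- (c * h) * e - p + \<sigma> * e * D + q))\<^sup>2 = (e + (?u + ?m))\<^sup>2"
    by (simp add: algebra_simps)
  also have "\<dots> = e\<^sup>2 + 2 * e * ?u + 2 * e * ?m + (?u + ?m)\<^sup>2"
    by (simp add: power2_eq_square algebra_simps)
  also have "\<dots> \<le> e\<^sup>2 + 2 * e * ?u + 2 * e * ?m + (2 * ?u\<^sup>2 + 2 * ?m\<^sup>2)"
    using power2_add_le by simp
  also have "2 * e * ?m = 2 * \<sigma> * (e * (g * e * D)) + 2 * (g * e * q)" by (simp add: algebra_simps)
  finally show ?thesis using u m eu uh by (simp add: algebra_simps)
qed

context brownian_motion
begin

text \<open>Discrete Gronwall. \<open>\<alpha>\<close> and \<open>\<beta>\<close> are the drift and
  noise defects of a step and \<open>G\<close> is the freezing factor. In the expectation of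
  \<open>error_step_le\<close> the last bracket vanishes by orthogonality, which leaves
  \<open>x' \<le> (1 + C * h) * x + K\<close>; iteration gives the bound
  \<open>i * K * (1 + C * h) ^ i\<close>.\<close>

lemma euler_error_bound:
  fixes e \<alpha> \<beta> G :: "nat \<Rightarrow> 'a \<Rightarrow> real" and c :: "nat \<Rightarrow> real"
  assumes h: "0 < h" "h \<le> T" and c: "\<And>i. 0 \<le> c i" "\<And>i. c i \<le> d"
    and e0: "\<And>\<omega>. e 0 \<omega> = 0"
    and eS: "\<And>i \<omega>. i < m \<Longrightarrow> e (Suc i) \<omega> = e i \<omega> + G i \<omega> * (- (c i * h) * e i \<omega> - \<alpha> i \<omega>
      + \<sigma> * e i \<omega> * (B (real (Suc i) * h) \<omega> - B (real i * h) \<omega>) + \<beta> i \<omega>)"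
    and G: "\<And>i. i < m \<Longrightarrow> G i \<in> borel_measurable (F (real i * h))" "\<And>i \<omega>. G i \<omega> = 0 \<or> G i \<omega> = 1"
    and \<alpha>: "\<And>i. i < m \<Longrightarrow> L2_at (real (Suc i) * h) (\<alpha> i)" "\<And>i. i < m \<Longrightarrow> expectation (\<lambda>\<omega>. (\<alpha> i \<omega>)\<^sup>2) \<le> h\<^sup>2 * a"
    and \<beta>: "\<And>i. i < m \<Longrightarrow> L2_at (real (Suc i) * h) (\<beta> i)" "\<And>i. i < m \<Longrightarrow> expectation (\<lambda>\<omega>. (\<beta> i \<omega>)\<^sup>2) \<le> b"
      "\<And>i Z. i < m \<Longrightarrow> L2_at (real i * h) Z \<Longrightarrow> expectation (\<lambda>\<omega>. Z \<omega> * \<beta> i \<omega>) = 0"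
    and ab: "0 \<le> a" "0 \<le> b"
  defines "C \<equiv> 1 + 2 * d\<^sup>2 + 4 * d\<^sup>2 * T + 4 * \<sigma>\<^sup>2"
  shows "i \<le> m \<Longrightarrow> L2_at (real i * h) (e i) \<and>
    expectation (\<lambda>\<omega>. (e i \<omega>)\<^sup>2) \<le> real i * (2 * h * a + 4 * h * T * a + 4 * b) * (1 + C * h) ^ i"
proof (induction i)
  case 0
  have "e 0 = (\<lambda>_. 0)" using e0 by auto
  then show ?case by (auto simp: L2_at_def)
next
  case (Suc i)
  then have i: "i < m" and IH: "L2_at (real i * h) (e i)"
    "expectation (\<lambda>\<omega>. (e i \<omega>)\<^sup>2) \<le> real i * (2 * h * a + 4 * h * T * a + 4 * b) * (1 + C * h) ^ i" by auto
  let ?s = "real i * h" and ?t = "real (Suc i) * h"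
  let ?D = "\<lambda>\<omega>. B ?t \<omega> - B ?s \<omega>"
  have st: "?s \<le> ?t" "?t - ?s = h" using h by (auto simp: algebra_simps)
  have Gb: "\<bar>G i \<omega>\<bar> \<le> 1" for \<omega> using G(2)[of i \<omega>] by auto
  have Ge: "L2_at ?s (\<lambda>\<omega>. G i \<omega> * e i \<omega>)" by (rule L2_at_mult_bounded[OF IH(1) G(1)[OF i] Gb])
  have eD: "L2_at ?t (\<lambda>\<omega>. e i \<omega> * ?D \<omega>)"
    "expectation (\<lambda>\<omega>. (e i \<omega> * ?D \<omega>)\<^sup>2) = expectation (\<lambda>\<omega>. (e i \<omega>)\<^sup>2) * h"
    using L2_at_mult_increment[OF IH(1) st(1)] st(2) by auto
  have GeD: "L2_at ?t (\<lambda>\<omega>. G i \<omega> * e i \<omega> * ?D \<omega>)"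
    using L2_at_mult_increment[OF Ge st(1)] by auto
  note et = L2_at_mono[OF IH(1) st(1)] and Get = L2_at_mono[OF Ge st(1)]
  have "L2_at ?t (\<lambda>\<omega>. - (c i * h) * e i \<omega> - \<alpha> i \<omega> + \<sigma> * (e i \<omega> * ?D \<omega>) + \<beta> i \<omega>)"
    by (intro L2_at_add L2_at_diff L2_at_cmult et \<alpha>(1)[OF i] \<beta>(1)[OF i] eD)
  from L2_at_add[OF et L2_at_mult_bounded[OF this measurable_F_mono[OF G(1)[OF i] st(1)] Gb]]
  moreover have "e (Suc i) = (\<lambda>\<omega>. e i \<omega> + G i \<omega> * (- (c i * h) * e i \<omega> - \<alpha> i \<omega>
      + \<sigma> * (e i \<omega> * ?D \<omega>) + \<beta> i \<omega>))"
    using eS[OF i] by (simp add: fun_eq_iff mult.assoc)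
  ultimately have L2: "L2_at ?t (e (Suc i))" by simp
  let ?x = "expectation (\<lambda>\<omega>. (e i \<omega>)\<^sup>2)"
  let ?A = "1 + h + 2 * d\<^sup>2 * h + 4 * d\<^sup>2 * h\<^sup>2"
  let ?R = "\<lambda>\<omega>. ?A * (e i \<omega>)\<^sup>2 + (2 / h + 4) * (\<alpha> i \<omega>)\<^sup>2 + 4 * \<sigma>\<^sup>2 * (e i \<omega> * ?D \<omega>)\<^sup>2 + 4 * (\<beta> i \<omega>)\<^sup>2
      + (2 * \<sigma> * (e i \<omega> * (G i \<omega> * e i \<omega> * ?D \<omega>)) + 2 * (G i \<omega> * e i \<omega> * \<beta> i \<omega>))"
  have int: "integrable M (\<lambda>\<omega>. e i \<omega> * (G i \<omega> * e i \<omega> * ?D \<omega>))"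
    "integrable M (\<lambda>\<omega>. G i \<omega> * e i \<omega> * \<beta> i \<omega>)"
    by (intro integrable_mult_of_squares L2_atD[OF et] L2_atD[OF GeD] L2_atD[OF Get] L2_atD[OF \<beta>(1)[OF i]])+
  note ints = int L2_atD(4)[OF et] L2_atD(4)[OF \<alpha>(1)[OF i]] L2_atD(4)[OF \<beta>(1)[OF i]] L2_atD(4)[OF eD(1)]
  have zero: "expectation (\<lambda>\<omega>. e i \<omega> * (G i \<omega> * e i \<omega> * ?D \<omega>)) = 0"
    "expectation (\<lambda>\<omega>. G i \<omega> * e i \<omega> * \<beta> i \<omega>) = 0"
    using expectation_mult_increment[OF IH(1) Ge st(1)] \<beta>(3)[OF i Ge] by auto
  have "expectation (\<lambda>\<omega>. (e (Suc i) \<omega>)\<^sup>2) \<le> expectation ?R"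
  proof (rule integral_mono)
    show "integrable M (\<lambda>\<omega>. (e (Suc i) \<omega>)\<^sup>2)" by (rule L2_atD(4)[OF L2])
    show "integrable M ?R"
      by (intro Bochner_Integration.integrable_add integrable_mult_right ints)
    show "(e (Suc i) \<omega>)\<^sup>2 \<le> ?R \<omega>" for \<omega>
      unfolding eS[OF i] by (rule error_step_le[OF h(1) c G(2)])
  qed
  also have "expectation ?R = ?A * ?x + (2 / h + 4) * expectation (\<lambda>\<omega>. (\<alpha> i \<omega>)\<^sup>2)
      + 4 * \<sigma>\<^sup>2 * (?x * h) + 4 * expectation (\<lambda>\<omega>. (\<beta> i \<omega>)\<^sup>2)"
    using ints zero eD(2) by (simp add: Bochner_Integration.integral_add)
  also have "\<dots> \<le> (?A + 4 * \<sigma>\<^sup>2 * h) * ?x + (2 / h + 4) * (h\<^sup>2 * a) + 4 * b"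
  proof -
    have "(2 / h + 4) * expectation (\<lambda>\<omega>. (\<alpha> i \<omega>)\<^sup>2) \<le> (2 / h + 4) * (h\<^sup>2 * a)"
      using \<alpha>(2)[OF i] h by (intro mult_left_mono) auto
    then show ?thesis using \<beta>(2)[OF i] by (simp add: algebra_simps)
  qed
  also have "\<dots> \<le> (1 + C * h) * ?x + (2 * h * a + 4 * h * T * a + 4 * b)"
  proof -
    \<comment> \<open>Second-order terms are absorbed into first-order ones, so that a single
      constant \<open>C\<close>, independent of the mesh, serves all steps.\<close>
    have "h\<^sup>2 \<le> h * T" using h by (simp add: power2_eq_square)
    then have "4 * d\<^sup>2 * h\<^sup>2 \<le> 4 * d\<^sup>2 * (h * T)" by (intro mult_left_mono) auto
    then have 1: "?A + 4 * \<sigma>\<^sup>2 * h \<le> 1 + C * h" by (simp add: C_def algebra_simps)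
    have "(2 / h + 4) * (h\<^sup>2 * a) = 2 * h * a + 4 * (h\<^sup>2 * a)"
      using h by (simp add: field_simps power2_eq_square)
    also have "h\<^sup>2 * a \<le> h * T * a" using \<open>h\<^sup>2 \<le> h * T\<close> ab by (intro mult_right_mono) auto
    finally have 2: "(2 / h + 4) * (h\<^sup>2 * a) \<le> 2 * h * a + 4 * h * T * a" by simp
    have "(?A + 4 * \<sigma>\<^sup>2 * h) * ?x \<le> (1 + C * h) * ?x"
      using 1 by (intro mult_right_mono) auto
    then show ?thesis using 2 by linarith
  qed
  also have "\<dots> \<le> real (Suc i) * (2 * h * a + 4 * h * T * a + 4 * b) * (1 + C * h) ^ Suc i"
  proof -
    let ?K = "2 * h * a + 4 * h * T * a + 4 * b"
    have K: "0 \<le> ?K" using h ab by auto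
    have C: "0 \<le> C * h" using h by (auto simp: C_def)
    have "(1 + C * h) * ?x \<le> (1 + C * h) * (real i * ?K * (1 + C * h) ^ i)"
      using IH(2) C by (intro mult_left_mono) auto
    moreover have "?K * 1 \<le> ?K * (1 + C * h) ^ Suc i"
      using K C by (intro mult_left_mono one_le_power) auto
    ultimately show ?thesis by (simp add: algebra_simps)
  qed
  finally show ?case using L2 by simp
qed

end

subsection \<open>Linear equations and their Euler scheme\<close>

lemma set_integral_split_continuous:
  fixes f :: "real \<Rightarrow> real"
  assumes "continuous_on {0..} f" "0 \<le> u" "u \<le> v"
  shows "(LINT s:{0..v}|lborel. f s) = (LINT s:{0..u}|lborel. f s) + (LINT s:{u..v}|lborel. f s)"
proof -
  have i: "set_integrable lborel {a..b} f" if "0 \<le> a" for a b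
    using that by (intro borel_integrable_atLeastAtMost' continuous_on_subset[OF assms(1)]) auto
  show ?thesis
    using Henstock_Kurzweil_Integration.integral_combine[OF assms(2,3) set_borel_integral_eq_integral(1)[OF i[OF order_refl]]]
      set_borel_integral_eq_integral(2)[OF i] assms(2) by simp
qed

lemma set_integral_deviation_le:
  fixes f :: "real \<Rightarrow> real"
  assumes "continuous_on {u..v} f" "u \<le> v" "\<And>s. u \<le> s \<Longrightarrow> s \<le> v \<Longrightarrow> \<bar>f s - k\<bar> \<le> w"
  shows "\<bar>(LINT s:{u..v}|lborel. f s) - (v - u) * k\<bar> \<le> (v - u) * w"
proof -
  have i: "set_integrable lborel {u..v} f" by (intro borel_integrable_atLeastAtMost' assms)
  have c: "set_integrable lborel {u..v} (\<lambda>_. z)" "(LINT s:{u..v}|lborel. z) = (v - u) * z" for z :: real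
    using assms(2) by (auto simp: set_lebesgue_integral_def intro!: borel_integrable_atLeastAtMost' continuous_intros)
  have "f s \<le> k + w \<and> k - w \<le> f s" if "s \<in> {u..v}" for s
    using assms(3)[of s] that by (auto simp: abs_le_iff)
  then have "(LINT s:{u..v}|lborel. f s) \<le> (LINT s:{u..v}|lborel. k + w)"
    "(LINT s:{u..v}|lborel. k - w) \<le> (LINT s:{u..v}|lborel. f s)"
    by (intro set_integral_mono i c; blast)+
  then show ?thesis unfolding c(2) by (simp add: abs_le_iff algebra_simps)
qed

text \<open>The parameter \<open>b\<close> enters the equation only through the rate
  \<open>\<gamma> t = d0 / (1 + b * d0 * t)\<close>. The estimates rely on its continuity and on the
  bounds 0 and \<open>d\<close>, here \<open>d = d0\<close>; the comparison needs two rates that are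
  ordered pointwise.\<close>

locale linear_sde = brownian_motion M F B
  for M :: "'a measure" and F and B +
  fixes \<gamma> :: "real \<Rightarrow> real" and d \<sigma> q0 :: real and Q :: "real \<Rightarrow> 'a \<Rightarrow> real"
  assumes \<gamma>_cont: "continuous_on {0..} \<gamma>"
    and \<gamma>_bounds: "\<And>t. 0 \<le> t \<Longrightarrow> 0 \<le> \<gamma> t" "\<And>t. 0 \<le> t \<Longrightarrow> \<gamma> t \<le> d"
    and \<sigma>_pos: "0 < \<sigma>"
    and sol: "sde_solution M F B (\<lambda>t q. - (\<gamma> t * q)) (\<lambda>t q. \<sigma> * q) q0 Q"
begin

lemma Q_adapted: "0 \<le> t \<Longrightarrow> Q t \<in> borel_measurable (F t)"
  and Q_continuous: "\<omega> \<in> space M \<Longrightarrow> continuous_on {0..} (\<lambda>t. Q t \<omega>)"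
  using sol by (auto simp: sde_solution_def)

lemma Q_measurable: "0 \<le> t \<Longrightarrow> Q t \<in> borel_measurable M"
  using measurable_F_M Q_adapted by blast

text \<open>The event that the running maximum of the absolute value of \<open>Q\<close> up to
  \<open>t\<close> is at most \<open>N\<close>. It decreases in \<open>t\<close> and is known at
  time \<open>t\<close>, so its indicator can freeze the recursion.\<close>

definition good :: "real \<Rightarrow> real \<Rightarrow> 'a set" where
  "good N t = {\<omega> \<in> space M. \<forall>s\<in>{0..t}. \<bar>Q s \<omega>\<bar> \<le> N}"

lemma good_sets:
  assumes "0 \<le> t"
  shows "good N t \<in> sets (F t)"
proof -
  have *: "{\<omega> \<in> space (F t). \<bar>Q s \<omega>\<bar> \<le> N} \<in> sets (F t)" if "0 \<le> s" "s \<le> t" for s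
  proof -
    have [measurable]: "Q s \<in> borel_measurable (F t)"
      using measurable_F_mono[OF Q_adapted] that by blast
    show ?thesis by measurable
  qed
  show ?thesis
  \<comment> \<open>The reduction to rational times requires a nondegenerate interval.\<close>
  proof (cases "t = 0")
    case True
    then have "good N t = {\<omega> \<in> space (F t). \<bar>Q 0 \<omega>\<bar> \<le> N}" using space_F by (auto simp: good_def)
    then show ?thesis using * assms by auto
  next
    case False
    have "good N t = {\<omega> \<in> space (F t). \<forall>s\<in>\<rat> \<inter> {0..t}. \<bar>Q s \<omega>\<bar> \<le> N}"
    proof -
      have "\<bar>Q s \<omega>\<bar> \<le> N" if "\<omega> \<in> space M" "\<forall>s\<in>\<rat> \<inter> {0..t}. \<bar>Q s \<omega>\<bar> \<le> N" "s \<in> {0..t}" for s \<omega>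
      proof (rule continuous_le_on_rationals[OF _ _ _ that(3)])
        show "continuous_on {0..t} (\<lambda>s. \<bar>Q s \<omega>\<bar>)"
          by (intro continuous_intros continuous_on_subset[OF Q_continuous[OF that(1)]]) auto
      qed (use that False assms in auto)
      then show ?thesis using space_F by (auto simp: good_def)
    qed
    then show ?thesis
      using * by (auto intro!: sets.sets_Collect_countable_All' countable_Int1 countable_rat)
  qed
qed

lemma good_events: "0 \<le> t \<Longrightarrow> good N t \<in> events"
  using good_sets[of t N] subalgebra_F[of t] by (auto simp: subalgebra_def)

text \<open>A bounded substitute for \<open>Q\<close>, with which it agrees on
  \<open>good N T\<close> up to time \<open>T\<close>. All moments in the error estimate are taken
  of \<open>K\<close> or of its modulus.\<close>

definition K :: "real \<Rightarrow> real \<Rightarrow> 'a \<Rightarrow> real" where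
  "K N t \<omega> = clip N (Q t \<omega>)"

lemma K_adapted: "0 \<le> t \<Longrightarrow> K N t \<in> borel_measurable (F t)"
  using measurable_compose[OF Q_adapted clip_measurable] by (simp add: K_def[abs_def])

lemma K_measurable: "0 \<le> t \<Longrightarrow> K N t \<in> borel_measurable M"
  using measurable_F_M K_adapted by blast

lemma K_bound: "0 \<le> N \<Longrightarrow> \<bar>K N t \<omega>\<bar> \<le> N"
  by (simp add: K_def abs_clip_le)

lemma K_continuous: "\<omega> \<in> space M \<Longrightarrow> continuous_on {0..} (\<lambda>t. K N t \<omega>)"
  unfolding K_def clip_def by (intro continuous_intros Q_continuous)

lemma K_good: "\<omega> \<in> good N T \<Longrightarrow> 0 \<le> t \<Longrightarrow> t \<le> T \<Longrightarrow> K N t \<omega> = Q t \<omega>"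
  by (auto simp: K_def good_def intro!: clip_id)

abbreviation "\<gamma>K \<equiv> \<lambda>N t \<omega>. \<gamma> t * K N t \<omega>"

lemma \<gamma>K_measurable: "0 \<le> t \<Longrightarrow> \<gamma>K N t \<in> borel_measurable M"
  using K_measurable by simp

lemma \<gamma>K_bound: "0 \<le> N \<Longrightarrow> 0 \<le> t \<Longrightarrow> \<bar>\<gamma>K N t \<omega>\<bar> \<le> d * N"
  using \<gamma>_bounds[of t] K_bound[of N t \<omega>] by (auto simp: abs_mult intro!: mult_mono)

lemma \<gamma>K_continuous: "\<omega> \<in> space M \<Longrightarrow> continuous_on {0..} (\<lambda>t. \<gamma>K N t \<omega>)"
  by (intro continuous_intros \<gamma>_cont K_continuous)

text \<open>The drift defect of an Euler step from \<open>u\<close> to \<open>v\<close>: the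
  integrated drift minus its value frozen at the left end, both for the clipped solution.\<close>

definition \<alpha> :: "real \<Rightarrow> real \<Rightarrow> real \<Rightarrow> 'a \<Rightarrow> real" where
  "\<alpha> N u v \<omega> = (LINT s:{u..v}|lborel. \<gamma>K N s \<omega>) - (v - u) * \<gamma>K N u \<omega>"

lemma progressive: "progressively_measurable F (\<lambda>t \<omega>. \<sigma> * Q t \<omega>)"
  using sol by (auto simp: sde_solution_def ito_integral_def)

lemma \<alpha>_adapted:
  assumes "0 \<le> u" "u \<le> v"
  shows "\<alpha> N u v \<in> borel_measurable (F v)"
proof -
  have v: "0 \<le> v" using assms by simp
  let ?c = "\<lambda>s. max 0 (min v s)"
  have [measurable]: "(\<lambda>(s, \<omega>). \<sigma> * Q (?c s) \<omega>) \<in> borel_measurable (lborel \<Otimes>\<^sub>M F v)"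
    using progressive_clamped_measurable[OF progressive v] .
  have "continuous_on UNIV (\<lambda>s. \<gamma> (?c s))"
    by (rule continuous_on_compose2[OF \<gamma>_cont]) (auto intro!: continuous_intros)
  then have [measurable]: "(\<lambda>s. \<gamma> (?c s)) \<in> borel_measurable borel"
    by (rule borel_measurable_continuous_onI)
  \<comment> \<open>Joint measurability is given for the integrand \<open>\<sigma> * Q\<close>, so
    \<open>Q\<close> is recovered from it by dividing by \<open>\<sigma>\<close>.\<close>
  have "(\<lambda>(s, \<omega>). indicator {u..v} s * (\<gamma> (?c s) * clip N (\<sigma> * Q (?c s) \<omega> / \<sigma>)))
      \<in> borel_measurable (lborel \<Otimes>\<^sub>M F v)"
    by measurable
  from measurable_compose[OF measurable_pair_swap' this]
  have "(\<lambda>(\<omega>, s). indicator {u..v} s * (\<gamma> (?c s) * clip N (\<sigma> * Q (?c s) \<omega> / \<sigma>)))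
      \<in> borel_measurable (F v \<Otimes>\<^sub>M lborel)"
    by (simp only: case_prod_beta' fst_conv snd_conv)
  then have "(\<lambda>\<omega>. \<integral>s. indicator {u..v} s * (\<gamma> (?c s) * clip N (\<sigma> * Q (?c s) \<omega> / \<sigma>)) \<partial>lborel)
      \<in> borel_measurable (F v)"
    by (rule lborel.borel_measurable_lebesgue_integral)
  moreover have "(\<integral>s. indicator {u..v} s * (\<gamma> (?c s) * clip N (\<sigma> * Q (?c s) \<omega> / \<sigma>)) \<partial>lborel)
      = (LINT s:{u..v}|lborel. \<gamma>K N s \<omega>)" for \<omega>
    unfolding set_lebesgue_integral_def
    using \<sigma>_pos assms by (intro Bochner_Integration.integral_cong) (auto simp: indicator_def K_def)
  moreover have "K N u \<in> borel_measurable (F v)"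
    using measurable_F_mono[OF K_adapted] assms by blast
  ultimately show ?thesis by (simp add: \<alpha>_def[abs_def])
qed

definition euler :: "real \<Rightarrow> nat \<Rightarrow> nat \<Rightarrow> 'a \<Rightarrow> real" where
  "euler T n k \<omega> = q0 * (\<Prod>i<k. 1 - \<gamma> (real i * (T / Suc n)) * (T / Suc n)
     + \<sigma> * (B (real (Suc i) * (T / Suc n)) \<omega> - B (real i * (T / Suc n)) \<omega>))"

lemma euler_measurable:
  assumes "0 \<le> T"
  shows "euler T n k \<in> borel_measurable M"
proof -
  have [measurable]: "B (real i * (T / Suc n)) \<in> borel_measurable M" for i
  proof -
    have "0 \<le> real i * (T / Suc n)" using assms by simp
    then show ?thesis using adapted measurable_F_M by blast
  qed
  show ?thesis unfolding euler_def[abs_def] by measurable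
qed

text \<open>The Gronwall bound after \<open>Suc n\<close> steps of length
  \<open>h = T / Suc n\<close>, with noise bound
  \<open>b = 2 * \<rho> + 2 * h * \<sigma>^2 * w\<close>, where \<open>w\<close> is the second
  moment of the modulus of \<open>K N\<close>. In all other terms the number of steps cancels
  against \<open>h\<close>; only \<open>\<rho>\<close> keeps it as a factor, and
  \<open>\<rho>\<close> is sent to 0 at fixed \<open>n\<close>.\<close>

definition error_bound :: "real \<Rightarrow> real \<Rightarrow> nat \<Rightarrow> real \<Rightarrow> real" where
  "error_bound N T n \<rho> = exp ((1 + 2 * d\<^sup>2 + 4 * d\<^sup>2 * T + 4 * \<sigma>\<^sup>2) * T) *
    (T * (2 + 4 * T) * expectation (\<lambda>\<omega>. (grid_modulus (\<gamma>K N) T n \<omega>)\<^sup>2) + 8 * real (Suc n) * \<rho>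
      + 8 * T * \<sigma>\<^sup>2 * expectation (\<lambda>\<omega>. (grid_modulus (K N) T n \<omega>)\<^sup>2))"

text \<open>An instance of \<open>euler_error_bound\<close>. The drift defect is at most
  \<open>h\<close> times the modulus of the clipped drift; the second moment of the noise defect
  follows from the isometry in \<open>simple_increment\<close> together with
  \<open>clipped_energy_le\<close>. Nothing here refers to the Ito integral.\<close>

lemma clipped_error_bound:
  fixes S :: "'a simple_process" and n
  assumes "0 < T" "0 < N" and S: "simple_adapted F S"
    and sq: "AE \<omega> in M. set_integrable lborel {0..T} (\<lambda>t. (\<sigma> * Q t \<omega>)\<^sup>2)"
    and U: "(\<lambda>\<omega>. LINT t:{0..T}|lborel. (simple_value S t \<omega> - \<sigma> * Q t \<omega>)\<^sup>2) \<in> borel_measurable M"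
    and e0: "\<And>\<omega>. e 0 \<omega> = 0"
  defines "h \<equiv> T / Suc n" and "C \<equiv> map_weight (clip (\<sigma> * N)) S"
  assumes eS: "\<And>i \<omega>. e (Suc i) \<omega> = e i \<omega> + indicator (good N (real i * h)) \<omega> *
      (- (\<gamma> (real i * h) * h) * e i \<omega> - \<alpha> N (real i * h) (real (Suc i) * h) \<omega>
      + \<sigma> * e i \<omega> * (B (real (Suc i) * h) \<omega> - B (real i * h) \<omega>)
      + (simple_integral C B (real (Suc i) * h) \<omega> - simple_integral C B (real i * h) \<omega>
        - \<sigma> * K N (real i * h) \<omega> * (B (real (Suc i) * h) \<omega> - B (real i * h) \<omega>)))"
  defines "\<rho> \<equiv> expectation (\<lambda>\<omega>. min (4 * (\<sigma> * N)\<^sup>2 * (T + 1))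
      \<bar>LINT t:{0..T}|lborel. (simple_value S t \<omega> - \<sigma> * Q t \<omega>)\<^sup>2\<bar>)"
  shows "L2_at T (e (Suc n))"
    and "expectation (\<lambda>\<omega>. (e (Suc n) \<omega>)\<^sup>2) \<le> error_bound N T n \<rho>"
proof -
  have h: "0 < h" "h \<le> T" "real (Suc n) * h = T"
    using assms(1) by (auto simp: h_def field_simps)
  have tle: "real (Suc i) * h \<le> T" if "i < Suc n" for i
    using mult_right_mono[of "real (Suc i)" "real (Suc n)" h] that h by auto
  let ?g = "grid_modulus (\<gamma>K N) T n" and ?w = "grid_modulus (K N) T n"
  let ?a = "expectation (\<lambda>\<omega>. (?g \<omega>)\<^sup>2)" and ?b = "expectation (\<lambda>\<omega>. (?w \<omega>)\<^sup>2)"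
  have N: "0 \<le> N" using assms by simp
  have gi: "integrable M (\<lambda>\<omega>. (?g \<omega>)\<^sup>2)" "integrable M (\<lambda>\<omega>. (?w \<omega>)\<^sup>2)"
    by (intro grid_modulus_second_moment(1)[where C="d * N"] grid_modulus_second_moment(1)[where C=N]
        \<gamma>K_measurable \<gamma>K_bound \<gamma>K_continuous K_measurable K_bound K_continuous assms N; assumption)+
  have gm: "\<bar>\<gamma>K N t \<omega> - \<gamma>K N (real i * h) \<omega>\<bar> \<le> ?g \<omega>" "\<bar>K N t \<omega> - K N (real i * h) \<omega>\<bar> \<le> ?w \<omega>"
    if "\<omega> \<in> space M" "i < Suc n" "real i * h \<le> t" "t \<le> real (Suc i) * h" for \<omega> i t
    using that unfolding h_def
    by (intro grid_modulus_upper[where K="\<gamma>K N" and C="d * N"] grid_modulus_upper[where K="K N" and C=N]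
        \<gamma>K_bound \<gamma>K_continuous K_bound K_continuous assms N; simp)+
  have w0: "0 \<le> ?w \<omega>" "0 \<le> ?g \<omega>" for \<omega>
    by (intro grid_modulus_bounds(2)[where K="\<gamma>K N" and C="d * N"] grid_modulus_bounds(2)[where K="K N" and C=N]
        \<gamma>K_bound K_bound assms N; assumption)+
  let ?R = "\<lambda>\<omega>. min (4 * (\<sigma> * N)\<^sup>2 * (T + 1)) \<bar>LINT t:{0..T}|lborel. (simple_value S t \<omega> - \<sigma> * Q t \<omega>)\<^sup>2\<bar>"
  have R_int: "integrable M ?R"
    using U assms(1) by (intro integrable_const_bound[where B="4 * (\<sigma> * N)\<^sup>2 * (T + 1)"]) auto
  have \<rho>: "0 \<le> \<rho>" unfolding \<rho>_def using assms(1) by (intro integral_nonneg_AE AE_I2) auto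
  have cN: "0 < \<sigma> * N" using assms \<sigma>_pos by simp
  have C: "simple_adapted F C"
    unfolding C_def using S cN by (intro simple_adapted_map_weight) (auto simp: abs_clip_le)
  let ?\<alpha> = "\<lambda>i. \<alpha> N (real i * h) (real (Suc i) * h)"
  let ?\<kappa> = "\<lambda>i \<omega>. \<sigma> * K N (real i * h) \<omega>"
  let ?\<beta> = "\<lambda>i \<omega>. simple_integral C B (real (Suc i) * h) \<omega> - simple_integral C B (real i * h) \<omega>
        - ?\<kappa> i \<omega> * (B (real (Suc i) * h) \<omega> - B (real i * h) \<omega>)"
  have \<kappa>: "L2_at (real i * h) (?\<kappa> i)" for i
    using h K_bound[OF N] by (intro L2_at_cmult L2_at_bounded[where C=N] K_adapted) auto
  have st: "0 \<le> real i * h" "real i * h \<le> real (Suc i) * h" "real (Suc i) * h - real i * h = h" for i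
    using h by (auto simp: algebra_simps)
  note \<beta> = simple_increment[OF C st(1,2) \<kappa>]
  have \<alpha>_le: "\<bar>?\<alpha> i \<omega>\<bar> \<le> h * ?g \<omega>" if "\<omega> \<in> space M" "i < Suc n" for i \<omega>
    unfolding \<alpha>_def
    using set_integral_deviation_le[OF continuous_on_subset[OF \<gamma>K_continuous[OF that(1)]] st(2)[of i] gm(1)[OF that]]
      st[of i] by auto
  have \<alpha>_L2: "L2_at (real (Suc i) * h) (?\<alpha> i)" if "i < Suc n" for i
  proof (rule L2_at_bounded[where C="h * (2 * (d * N))"])
    fix \<omega> assume "\<omega> \<in> space M"
    note \<alpha>_le[OF this that]
    also have "h * ?g \<omega> \<le> h * (2 * (d * N))"
      using h by (intro mult_left_mono grid_modulus_bounds(3)[where K="\<gamma>K N"] \<gamma>K_bound N assms) auto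
    finally show "\<bar>?\<alpha> i \<omega>\<bar> \<le> h * (2 * (d * N))" .
  qed (use \<alpha>_adapted[OF st(1,2)] h in auto)
  have "i \<le> Suc n \<Longrightarrow> L2_at (real i * h) (e i) \<and>
    expectation (\<lambda>\<omega>. (e i \<omega>)\<^sup>2) \<le> real i * (2 * h * ?a + 4 * h * T * ?a + 4 * (2 * \<rho> + 2 * h * \<sigma>\<^sup>2 * ?b))
      * (1 + (1 + 2 * d\<^sup>2 + 4 * d\<^sup>2 * T + 4 * \<sigma>\<^sup>2) * h) ^ i" for i
  proof (rule euler_error_bound[where \<alpha>="?\<alpha>" and \<beta>="?\<beta>" and G="\<lambda>i. indicator (good N (real i * h))"
        and c="\<lambda>i. \<gamma> (real i * h)"])
    show "(\<lambda>\<omega>. indicator (good N (real i * h)) \<omega> :: real) \<in> borel_measurable (F (real i * h))" for i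
      using good_sets[OF st(1)] by simp
    show "expectation (\<lambda>\<omega>. (?\<alpha> i \<omega>)\<^sup>2) \<le> h\<^sup>2 * ?a" if "i < Suc n" for i
    proof -
      have "expectation (\<lambda>\<omega>. (?\<alpha> i \<omega>)\<^sup>2) \<le> expectation (\<lambda>\<omega>. h\<^sup>2 * (?g \<omega>)\<^sup>2)"
      proof (rule integral_mono)
        fix \<omega> assume "\<omega> \<in> space M"
        from \<alpha>_le[OF this that] have "\<bar>?\<alpha> i \<omega>\<bar> \<le> \<bar>h * ?g \<omega>\<bar>" by linarith
        then show "(?\<alpha> i \<omega>)\<^sup>2 \<le> h\<^sup>2 * (?g \<omega>)\<^sup>2"
          by (simp add: abs_le_square_iff power_mult_distrib)
      qed (use gi L2_atD(4)[OF \<alpha>_L2[OF that]] in auto)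
      then show ?thesis using gi by simp
    qed
    show "expectation (\<lambda>\<omega>. (?\<beta> i \<omega>)\<^sup>2) \<le> 2 * \<rho> + 2 * h * \<sigma>\<^sup>2 * ?b" if i: "i < Suc n" for i
    proof -
      have "expectation (\<lambda>\<omega>. LINT t:{real i * h..real (Suc i) * h}|lborel. (simple_value C t \<omega> - ?\<kappa> i \<omega>)\<^sup>2)
        \<le> expectation (\<lambda>\<omega>. 2 * ?R \<omega> + 2 * h * \<sigma>\<^sup>2 * (?w \<omega>)\<^sup>2)"
      proof (rule integral_mono_AE')
        show "integrable M (\<lambda>\<omega>. 2 * ?R \<omega> + 2 * h * \<sigma>\<^sup>2 * (?w \<omega>)\<^sup>2)"
          using R_int gi by (intro Bochner_Integration.integrable_add integrable_mult_right) auto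
        show "AE \<omega> in M. (LINT t:{real i * h..real (Suc i) * h}|lborel. (simple_value C t \<omega> - ?\<kappa> i \<omega>)\<^sup>2)
          \<le> 2 * ?R \<omega> + 2 * h * \<sigma>\<^sup>2 * (?w \<omega>)\<^sup>2"
          using sq AE_space
        proof eventually_elim
          case (elim \<omega>)
          have "(LINT t:{real i * h..real (Suc i) * h}|lborel. (simple_value C t \<omega> - ?\<kappa> i \<omega>)\<^sup>2)
            \<le> 2 * ?R \<omega> + 2 * (real (Suc i) * h - real i * h) * (\<sigma> * ?w \<omega>)\<^sup>2"
            unfolding C_def
          proof (rule clipped_energy_le[OF progressive elim(1) S elim(2) cN st(1,2) tle[OF i]])
            fix t assume t: "real i * h \<le> t" "t \<le> real (Suc i) * h"
            have "clip (\<sigma> * N) (\<sigma> * Q t \<omega>) - ?\<kappa> i \<omega> = \<sigma> * (K N t \<omega> - K N (real i * h) \<omega>)"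
              using clip_mult[OF \<sigma>_pos, of N "Q t \<omega>"] by (simp add: K_def right_diff_distrib)
            then show "\<bar>clip (\<sigma> * N) (\<sigma> * Q t \<omega>) - ?\<kappa> i \<omega>\<bar> \<le> \<sigma> * ?w \<omega>"
              using gm(2)[OF elim(2) i t] \<sigma>_pos by (simp add: abs_mult)
          qed
          then show ?case unfolding st(3) by (simp add: power_mult_distrib mult.assoc)
        qed
        show "AE \<omega> in M. 0 \<le> 2 * ?R \<omega> + 2 * h * \<sigma>\<^sup>2 * (?w \<omega>)\<^sup>2"
          using h assms(1) by (intro AE_I2) auto
      qed
      also have "\<dots> = 2 * \<rho> + 2 * h * \<sigma>\<^sup>2 * ?b"
        using R_int gi by (simp add: \<rho>_def)
      finally show ?thesis unfolding \<beta>(2) .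
    qed
    show "0 \<le> 2 * \<rho> + 2 * h * \<sigma>\<^sup>2 * ?b" using \<rho> h by simp
  qed (use h e0 eS \<gamma>_bounds st \<beta> \<alpha>_L2 in \<open>auto simp: indicator_def\<close>)
  from this[of "Suc n"] have L: "L2_at T (e (Suc n))" and
    E: "expectation (\<lambda>\<omega>. (e (Suc n) \<omega>)\<^sup>2) \<le> real (Suc n) * (2 * h * ?a + 4 * h * T * ?a + 4 * (2 * \<rho> + 2 * h * \<sigma>\<^sup>2 * ?b))
      * (1 + (1 + 2 * d\<^sup>2 + 4 * d\<^sup>2 * T + 4 * \<sigma>\<^sup>2) * h) ^ Suc n"
    unfolding h(3) by auto
  show "L2_at T (e (Suc n))" by (rule L)
  let ?C = "1 + 2 * d\<^sup>2 + 4 * d\<^sup>2 * T + 4 * \<sigma>\<^sup>2"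
  let ?X = "T * (2 + 4 * T) * ?a + 8 * real (Suc n) * \<rho> + 8 * T * \<sigma>\<^sup>2 * ?b"
  have "0 \<le> ?C * h" using h by auto
  then have "(1 + ?C * h) ^ Suc n \<le> exp (?C * h) ^ Suc n"
    by (intro power_mono exp_ge_add_one_self) auto
  also have "\<dots> = exp (?C * T)"
    using h(3) by (simp only: exp_of_nat_mult[symmetric] mult.left_commute[of "real (Suc n)"])
  finally have pw: "(1 + ?C * h) ^ Suc n \<le> exp (?C * T)" .
  have "real (Suc n) * (2 * h * ?a + 4 * h * T * ?a + 4 * (2 * \<rho> + 2 * h * \<sigma>\<^sup>2 * ?b))
    = (real (Suc n) * h) * (2 * ?a + 4 * T * ?a + 8 * \<sigma>\<^sup>2 * ?b) + 8 * real (Suc n) * \<rho>"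
    by (simp add: algebra_simps)
  also have "\<dots> = ?X" unfolding h(3) by (simp add: algebra_simps)
  finally have X: "real (Suc n) * (2 * h * ?a + 4 * h * T * ?a + 4 * (2 * \<rho> + 2 * h * \<sigma>\<^sup>2 * ?b)) = ?X" .
  have "0 \<le> ?X" using assms(1) \<rho> by simp
  from mult_left_mono[OF pw this] E show "expectation (\<lambda>\<omega>. (e (Suc n) \<omega>)\<^sup>2) \<le> error_bound N T n \<rho>"
    unfolding X error_bound_def by (simp add: mult.commute)
qed

end

text \<open>A finite number of steps depends continuously on the driving values \<open>w k\<close>,
  so their convergence at the grid points is inherited by the errors.\<close>

lemma error_recursion_limit:
  fixes x g p D z y :: "nat \<Rightarrow> real" and e w :: "nat \<Rightarrow> nat \<Rightarrow> real"
  assumes "\<And>k. e k 0 = 0" "x 0 = 0"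
    and "\<And>k i. i < m \<Longrightarrow> e k (Suc i) = e k i + (- g i * e k i - p i + \<sigma> * e k i * D i
      + (w k (Suc i) - w k i - y i))"
    and "\<And>i. i < m \<Longrightarrow> x (Suc i) = x i + (- g i * x i - p i + \<sigma> * x i * D i + (z (Suc i) - z i - y i))"
    and "\<And>i. i \<le> m \<Longrightarrow> (\<lambda>k. w k i) \<longlonglongrightarrow> z i"
  shows "i \<le> m \<Longrightarrow> (\<lambda>k. e k i) \<longlonglongrightarrow> x i"
proof (induction i)
  case (Suc i)
  then show ?case
    using assms(3,4)[of i] assms(5)[of i] assms(5)[of "Suc i"] by (auto intro!: tendsto_intros)
qed (use assms in simp)

context linear_sde
begin

text \<open>Stated as a nonnegative integral because it comes out of Fatou's lemma; integrability is
  read off from its finiteness in \<open>squared_error_L1\<close>.\<close>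

lemma euler_error:
  assumes "0 < T" "0 < N"
  shows "(\<integral>\<^sup>+\<omega>. indicator (good N T) \<omega> * ennreal ((Q T \<omega> - euler T n (Suc n) \<omega>)\<^sup>2) \<partial>M)
    \<le> ennreal (error_bound N T n 0)"
proof -
  obtain I where ito: "ito_integral M F B (\<lambda>t \<omega>. \<sigma> * Q t \<omega>) I"
    and sde: "AE \<omega> in M. \<forall>t\<ge>0. Q t \<omega> = q0 + (LINT s:{0..t}|lborel. - (\<gamma> s * Q s \<omega>)) + I t \<omega>"
    using sol by (auto simp: sde_solution_def)
  have sq: "AE \<omega> in M. set_integrable lborel {0..T} (\<lambda>t. (\<sigma> * Q t \<omega>)\<^sup>2)"
    using ito assms(1) by (auto simp: ito_integral_def)
  obtain S where S: "\<And>k. simple_adapted F (S k)"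
    and U: "converges_in_prob M
           (\<lambda>k \<omega>. LINT t:{0..T}|lborel. (simple_value (S k) t \<omega> - \<sigma> * Q t \<omega>)\<^sup>2) (\<lambda>\<omega>. 0)"
    and SI: "\<And>t. 0 \<le> t \<Longrightarrow> converges_in_prob M (\<lambda>k. simple_integral (S k) B t) (I t)"
  proof -
    obtain S where "\<forall>k. simple_adapted F (S k)"
      "\<forall>T\<ge>0. converges_in_prob M
           (\<lambda>k \<omega>. LINT t:{0..T}|lborel. (simple_value (S k) t \<omega> - \<sigma> * Q t \<omega>)\<^sup>2) (\<lambda>\<omega>. 0)"
      "\<forall>t\<ge>0. converges_in_prob M (\<lambda>k. simple_integral (S k) B t) (I t)"
      using ito unfolding ito_integral_def by blast
    with assms(1) that show thesis by (meson less_imp_le)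
  qed
  define h where "h = T / Suc n"
  have h: "0 < h" "real (Suc n) * h = T" using assms(1) by (auto simp: h_def)
  have tle: "0 \<le> real i * h" "real i * h \<le> T" if "i \<le> Suc n" for i
    using mult_right_mono[of "real i" "real (Suc n)" h] that h by auto
  define C where "C k = map_weight (clip (\<sigma> * N)) (S k)" for k
  have cN: "0 < \<sigma> * N" using assms \<sigma>_pos by simp
  have C: "simple_adapted F (C k)" for k
    unfolding C_def using S cN by (intro simple_adapted_map_weight) (auto simp: abs_clip_le)
  let ?G = "good N T"
  have G [measurable]: "?G \<in> events" using good_events assms by simp
  let ?u = "\<lambda>k i \<omega>. indicator ?G \<omega> * min 1 \<bar>simple_integral (C k) B (real i * h) \<omega> - I (real i * h) \<omega>\<bar> :: real"
  have um: "?u k i \<in> borel_measurable M" if "i \<le> Suc n" for k i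
  proof -
    have [measurable]: "I (real i * h) \<in> borel_measurable M" "simple_integral (C k) B (real i * h) \<in> borel_measurable M"
      using SI[OF tle(1)[OF that]] simple_integral_measurable[OF C tle(1)[OF that]]
      by (auto simp: converges_in_prob_def)
    show ?thesis by measurable
  qed
  have u_int: "integrable M (?u k i)" if "i \<le> Suc n" for k i
    using um[OF that] by (intro integrable_const_bound[where B=1]) (auto simp: indicator_def)
  have u_lim: "(\<lambda>k. expectation (?u k i)) \<longlonglongrightarrow> 0" if "i \<le> Suc n" for i
    unfolding C_def
  proof (rule clipped_integral_limit[where I=I and S=S, OF progressive sq S U SI[OF tle(1)[OF that]] tle[OF that] cN G])
    fix \<omega> r assume "\<omega> \<in> ?G" "0 \<le> r" "r \<le> T"
    then show "\<bar>\<sigma> * Q r \<omega>\<bar> \<le> \<sigma> * N" using \<sigma>_pos by (auto simp: good_def abs_mult)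
  qed
  \<comment> \<open>Summing over all grid points yields one subsequence along which the clipped
    integrals converge almost surely on the good event at every grid point simultaneously.\<close>
  have "\<exists>r::nat\<Rightarrow>nat. strict_mono r \<and> (AE \<omega> in M. (\<lambda>k. \<Sum>i\<le>Suc n. ?u (r k) i \<omega>) \<longlonglongrightarrow> 0)"
  proof (rule tendsto_L1_AE_subseq)
    show "integrable M (\<lambda>\<omega>. \<Sum>i\<le>Suc n. ?u k i \<omega>)" for k
      by (intro Bochner_Integration.integrable_sum u_int) auto
    have "(\<lambda>k. \<Sum>i\<le>Suc n. expectation (?u k i)) \<longlonglongrightarrow> (\<Sum>i\<le>Suc n. 0)"
      by (intro tendsto_sum u_lim) auto
    moreover have "expectation (\<lambda>\<omega>. norm (\<Sum>i\<le>Suc n. ?u k i \<omega>)) = (\<Sum>i\<le>Suc n. expectation (?u k i))" for k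
    proof -
      have "norm (\<Sum>i\<le>Suc n. ?u k i \<omega>) = (\<Sum>i\<le>Suc n. ?u k i \<omega>)" for \<omega>
        unfolding real_norm_def by (intro abs_of_nonneg sum_nonneg) (auto simp: indicator_def)
      then have "expectation (\<lambda>\<omega>. norm (\<Sum>i\<le>Suc n. ?u k i \<omega>)) = expectation (\<lambda>\<omega>. \<Sum>i\<le>Suc n. ?u k i \<omega>)"
        by (simp only:)
      also have "\<dots> = (\<Sum>i\<le>Suc n. expectation (?u k i))"
        by (intro Bochner_Integration.integral_sum u_int) auto
      finally show ?thesis .
    qed
    ultimately show "(\<lambda>k. expectation (\<lambda>\<omega>. norm (\<Sum>i\<le>Suc n. ?u k i \<omega>))) \<longlonglongrightarrow> 0" by simp
  qed
  then obtain r :: "nat \<Rightarrow> nat" where r: "strict_mono r"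
    "AE \<omega> in M. (\<lambda>k. \<Sum>i\<le>Suc n. ?u (r k) i \<omega>) \<longlonglongrightarrow> 0" by blast
  let ?D = "\<lambda>i \<omega>. B (real (Suc i) * h) \<omega> - B (real i * h) \<omega>"
  \<comment> \<open>On the good event the Euler error satisfies the same recursion with \<open>I\<close> in place of the
    elementary integrals of \<open>C k\<close>, so it is the limit of \<open>e k\<close> along a subsequence; Fatou's lemma then
    transfers the bound on \<open>e k\<close>.\<close>
  define e where "e k = rec_nat (\<lambda>\<omega>. 0) (\<lambda>i f \<omega>. f \<omega> + indicator (good N (real i * h)) \<omega> *
      (- (\<gamma> (real i * h) * h) * f \<omega> - \<alpha> N (real i * h) (real (Suc i) * h) \<omega>
      + \<sigma> * f \<omega> * ?D i \<omega>
      + (simple_integral (C k) B (real (Suc i) * h) \<omega> - simple_integral (C k) B (real i * h) \<omega>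
        - \<sigma> * K N (real i * h) \<omega> * ?D i \<omega>)))" for k
  have e0: "e k 0 \<omega> = 0" for k \<omega> by (simp add: e_def)
  have eS: "e k (Suc i) \<omega> = e k i \<omega> + indicator (good N (real i * h)) \<omega> *
      (- (\<gamma> (real i * h) * h) * e k i \<omega> - \<alpha> N (real i * h) (real (Suc i) * h) \<omega>
      + \<sigma> * e k i \<omega> * ?D i \<omega>
      + (simple_integral (C k) B (real (Suc i) * h) \<omega> - simple_integral (C k) B (real i * h) \<omega>
        - \<sigma> * K N (real i * h) \<omega> * ?D i \<omega>))" for k i \<omega>
    by (simp add: e_def)
  let ?\<rho> = "\<lambda>k. expectation (\<lambda>\<omega>. min (4 * (\<sigma> * N)\<^sup>2 * (T + 1))
      \<bar>LINT t:{0..T}|lborel. (simple_value (S k) t \<omega> - \<sigma> * Q t \<omega>)\<^sup>2\<bar>)"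
  have Um: "(\<lambda>\<omega>. LINT t:{0..T}|lborel. (simple_value (S k) t \<omega> - \<sigma> * Q t \<omega>)\<^sup>2) \<in> borel_measurable M" for k
    using U by (auto simp: converges_in_prob_def)
  note bound = clipped_error_bound[where S="S k" and e="e k" and n=n for k,
      OF assms S sq Um e0, folded h_def C_def, OF eS]
  have "?\<rho> \<longlonglongrightarrow> 0"
  proof -
    have "(\<lambda>k. expectation (\<lambda>\<omega>. indicator (space M) \<omega> * min (4 * (\<sigma> * N)\<^sup>2 * (T + 1))
      \<bar>LINT t:{0..T}|lborel. (simple_value (S k) t \<omega> - \<sigma> * Q t \<omega>)\<^sup>2\<bar>)) \<longlonglongrightarrow> 0"
    proof (rule tendsto_expectation_truncated[OF Um])
      fix \<epsilon> :: real assume "0 < \<epsilon>"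
      then show "(\<lambda>k. prob (space M \<inter> {\<omega> \<in> space M. \<epsilon> < \<bar>LINT t:{0..T}|lborel. (simple_value (S k) t \<omega> - \<sigma> * Q t \<omega>)\<^sup>2\<bar>})) \<longlonglongrightarrow> 0"
        using U by (auto simp: converges_in_prob_def Int_def conj_assoc[symmetric])
    qed (use assms cN in \<open>auto intro!: mult_pos_pos\<close>)
    moreover have "expectation (\<lambda>\<omega>. indicator (space M) \<omega> * f \<omega>) = expectation f" for f :: "'a \<Rightarrow> real"
      by (intro Bochner_Integration.integral_cong) auto
    ultimately show ?thesis by simp
  qed
  \<comment> \<open>The mesh is fixed here, so the factor \<open>real (Suc n)\<close> in front of
    \<open>\<rho>\<close> is a constant.\<close>
  then have \<rho>: "(\<lambda>k. error_bound N T n (?\<rho> (r k))) \<longlonglongrightarrow> error_bound N T n 0"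
    unfolding error_bound_def
    by (intro tendsto_intros LIMSEQ_subseq_LIMSEQ[OF _ r(1), unfolded comp_def])
  have lim: "AE \<omega> in M. \<omega> \<in> ?G \<longrightarrow> (\<lambda>k. e (r k) (Suc n) \<omega>) \<longlonglongrightarrow> Q T \<omega> - euler T n (Suc n) \<omega>"
    using r(2) sde AE_space
  proof eventually_elim
    case (elim \<omega>)
    show ?case
    proof
      assume \<omega>: "\<omega> \<in> ?G"
      have w: "(\<lambda>k. simple_integral (C (r k)) B (real i * h) \<omega>) \<longlonglongrightarrow> I (real i * h) \<omega>" if i: "i \<le> Suc n" for i
      proof -
        have "(\<lambda>k. min 1 \<bar>simple_integral (C (r k)) B (real i * h) \<omega> - I (real i * h) \<omega>\<bar>) \<longlonglongrightarrow> 0"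
        proof (rule tendsto_sandwich[OF _ _ tendsto_const elim(1)])
          show "\<forall>\<^sub>F k in sequentially. min 1 \<bar>simple_integral (C (r k)) B (real i * h) \<omega> - I (real i * h) \<omega>\<bar>
              \<le> (\<Sum>i\<le>Suc n. ?u (r k) i \<omega>)"
          proof (intro always_eventually allI)
            fix k
            have "?u (r k) i \<omega> \<le> (\<Sum>i\<le>Suc n. ?u (r k) i \<omega>)"
              using i by (intro member_le_sum) (auto simp: indicator_def)
            then show "min 1 \<bar>simple_integral (C (r k)) B (real i * h) \<omega> - I (real i * h) \<omega>\<bar>
              \<le> (\<Sum>i\<le>Suc n. ?u (r k) i \<omega>)" using \<omega> by simp
          qed
        qed auto
        \<comment> \<open>Below the level 1 the truncation has no effect, so the threshold
          \<open>min 1 \<epsilon>\<close> recovers convergence of the untruncated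
          difference.\<close>
        then have "\<forall>\<^sub>F k in sequentially. dist (simple_integral (C (r k)) B (real i * h) \<omega>) (I (real i * h) \<omega>) < \<epsilon>"
          if "0 < \<epsilon>" for \<epsilon>
          using order_tendstoD(2)[of _ 0 sequentially "min 1 \<epsilon>"] that
          by (fastforce simp: dist_real_def elim: eventually_mono)
        then show ?thesis by (simp add: tendsto_iff)
      qed
      have Qeq: "Q t \<omega> = q0 + (LINT s:{0..t}|lborel. - (\<gamma> s * Q s \<omega>)) + I t \<omega>" if "0 \<le> t" for t
        using elim(2) that by blast
      let ?X = "\<lambda>i. euler T n i \<omega>"
      have step: "Q (real (Suc i) * h) \<omega> - ?X (Suc i) = (Q (real i * h) \<omega> - ?X i)
        + (- (\<gamma> (real i * h) * h) * (Q (real i * h) \<omega> - ?X i) - \<alpha> N (real i * h) (real (Suc i) * h) \<omega>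
          + \<sigma> * (Q (real i * h) \<omega> - ?X i) * ?D i \<omega>
          + (I (real (Suc i) * h) \<omega> - I (real i * h) \<omega> - \<sigma> * K N (real i * h) \<omega> * ?D i \<omega>))"
        if i: "i < Suc n" for i
      proof -
        let ?s = "real i * h" and ?t = "real (Suc i) * h"
        have st: "0 \<le> ?s" "?s \<le> ?t" "?t \<le> T" "?t - ?s = h"
          using tle[of i] tle[of "Suc i"] i h by (auto simp: algebra_simps)
        have c: "continuous_on {0..} (\<lambda>s. - (\<gamma> s * Q s \<omega>))"
          by (intro continuous_intros \<gamma>_cont Q_continuous elim)
        have QK: "Q x \<omega> = K N x \<omega>" if "?s \<le> x" "x \<le> ?t" for x
          using K_good[OF \<omega> order_trans[OF st(1) that(1)] order_trans[OF that(2) st(3)]] by simp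
        have "(LINT s:{?s..?t}|lborel. - (\<gamma> s * Q s \<omega>)) = (LINT s:{?s..?t}|lborel. - \<gamma>K N s \<omega>)"
          unfolding set_lebesgue_integral_def
          by (intro Bochner_Integration.integral_cong refl) (simp add: QK indicator_def)
        also have "\<dots> = - (\<alpha> N ?s ?t \<omega> + h * (\<gamma> ?s * K N ?s \<omega>))"
          using st(4) by (simp add: \<alpha>_def set_lebesgue_integral_def)
        finally have "Q ?t \<omega> = Q ?s \<omega> - (\<alpha> N ?s ?t \<omega> + h * (\<gamma> ?s * K N ?s \<omega>)) + (I ?t \<omega> - I ?s \<omega>)"
          using Qeq[of ?s] Qeq[of ?t] set_integral_split_continuous[OF c st(1,2)] st by linarith
        moreover have "?X (Suc i) = ?X i * (1 - \<gamma> ?s * h + \<sigma> * ?D i \<omega>)"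
          by (simp add: euler_def h_def)
        moreover have "K N ?s \<omega> = Q ?s \<omega>" using K_good[OF \<omega>] st by simp
        ultimately show ?thesis by (simp only:) (simp add: algebra_simps)
      qed
      \<comment> \<open>The good event up to \<open>T\<close> lies in the good events up to all
        earlier grid points: on it the recursion is never frozen.\<close>
      have good_i: "indicator (good N (real i * h)) \<omega> = (1::real)" if "i < Suc n" for i
        using \<omega> tle[of i] that by (auto simp: good_def)
      \<comment> \<open>Elementary integrals vanish at time 0, hence so does their limit, and
        \<open>Q\<close> and the scheme both start at \<open>q0\<close>.\<close>
      have x0: "Q (real 0 * h) \<omega> - ?X 0 = 0"
      proof -
        have "(\<lambda>k. 0) \<longlonglongrightarrow> I 0 \<omega>"
          using w[of 0] simple_integral_0[OF C] by simp
        then have "I 0 \<omega> = 0" by (rule LIMSEQ_unique[OF _ tendsto_const])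
        moreover have "(LINT s:{0..0}|lborel. - (\<gamma> s * Q s \<omega>)) = 0"
        proof -
          have "continuous_on {0..} (\<lambda>s. - (\<gamma> s * Q s \<omega>))"
            by (intro continuous_intros \<gamma>_cont Q_continuous elim)
          from set_integral_split_continuous[OF this, of 0 0] show ?thesis by simp
        qed
        ultimately show ?thesis using Qeq[of 0] by (simp add: euler_def)
      qed
      have "(\<lambda>k. e (r k) (Suc n) \<omega>) \<longlonglongrightarrow> Q (real (Suc n) * h) \<omega> - ?X (Suc n)"
        by (rule error_recursion_limit[where m="Suc n" and e="\<lambda>k i. e (r k) i \<omega>"
            and x="\<lambda>i. Q (real i * h) \<omega> - ?X i" and g="\<lambda>i. \<gamma> (real i * h) * h"
            and p="\<lambda>i. \<alpha> N (real i * h) (real (Suc i) * h) \<omega>" and D="\<lambda>i. ?D i \<omega>" and \<sigma>=\<sigma>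
            and y="\<lambda>i. \<sigma> * K N (real i * h) \<omega> * ?D i \<omega>"
            and w="\<lambda>k i. simple_integral (C (r k)) B (real i * h) \<omega>" and z="\<lambda>i. I (real i * h) \<omega>"])
          (use e0 x0 step w in \<open>simp_all add: eS good_i\<close>)
      then show "(\<lambda>k. e (r k) (Suc n) \<omega>) \<longlonglongrightarrow> Q T \<omega> - ?X (Suc n)" unfolding h(2) .
    qed
  qed
  have em [measurable]: "e k (Suc n) \<in> borel_measurable M" for k using L2_atD(3)[OF bound(1)] .
  have "(\<integral>\<^sup>+\<omega>. indicator ?G \<omega> * ennreal ((Q T \<omega> - euler T n (Suc n) \<omega>)\<^sup>2) \<partial>M)
    \<le> (\<integral>\<^sup>+\<omega>. liminf (\<lambda>k. ennreal ((e (r k) (Suc n) \<omega>)\<^sup>2)) \<partial>M)"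
  proof (rule nn_integral_mono_AE)
    show "AE \<omega> in M. indicator ?G \<omega> * ennreal ((Q T \<omega> - euler T n (Suc n) \<omega>)\<^sup>2)
      \<le> liminf (\<lambda>k. ennreal ((e (r k) (Suc n) \<omega>)\<^sup>2))"
      using lim
    proof eventually_elim
      case (elim \<omega>)
      show ?case
      proof (cases "\<omega> \<in> ?G")
        case True
        then have "(\<lambda>k. ennreal ((e (r k) (Suc n) \<omega>)\<^sup>2)) \<longlonglongrightarrow> ennreal ((Q T \<omega> - euler T n (Suc n) \<omega>)\<^sup>2)"
          using elim by (intro tendsto_ennrealI tendsto_power) auto
        from lim_imp_Liminf[OF sequentially_bot this] show ?thesis using True by simp
      qed simp
    qed
  qed
  also have "\<dots> \<le> liminf (\<lambda>k. \<integral>\<^sup>+\<omega>. ennreal ((e (r k) (Suc n) \<omega>)\<^sup>2) \<partial>M)"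
    by (rule nn_integral_liminf) measurable
  also have "\<dots> \<le> liminf (\<lambda>k. ennreal (error_bound N T n (?\<rho> (r k))))"
  proof (intro Liminf_mono always_eventually allI)
    fix k
    show "(\<integral>\<^sup>+\<omega>. ennreal ((e (r k) (Suc n) \<omega>)\<^sup>2) \<partial>M) \<le> ennreal (error_bound N T n (?\<rho> (r k)))"
      using bound(2)[of "r k"] L2_atD(4)[OF bound(1)]
      by (subst nn_integral_eq_integral) (auto intro!: ennreal_leI)
  qed
  also have "\<dots> = ennreal (error_bound N T n 0)"
    using \<rho> by (intro lim_imp_Liminf tendsto_ennrealI) auto
  finally show ?thesis .
qed

lemma error_bound_tendsto_0:
  assumes "0 < T" "0 < N"
  shows "(\<lambda>n. error_bound N T n 0) \<longlonglongrightarrow> 0"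
proof -
  have N: "0 \<le> N" using assms by simp
  have 1: "(\<lambda>n. expectation (\<lambda>\<omega>. (grid_modulus (\<gamma>K N) T n \<omega>)\<^sup>2)) \<longlonglongrightarrow> 0"
    by (intro grid_modulus_second_moment(2)[where C="d * N"] \<gamma>K_measurable \<gamma>K_bound \<gamma>K_continuous assms N; assumption)
  have 2: "(\<lambda>n. expectation (\<lambda>\<omega>. (grid_modulus (K N) T n \<omega>)\<^sup>2)) \<longlonglongrightarrow> 0"
    by (intro grid_modulus_second_moment(2)[where C=N] K_measurable K_bound K_continuous assms N; assumption)
  show ?thesis
    unfolding error_bound_def mult_zero_right
    by (intro tendsto_mult_right_zero tendsto_add_zero tendsto_const 1 2)
qed

text \<open>Continuous paths are bounded on compact intervals, so the localization exhausts the
  probability space as \<open>N\<close> grows. Natural \<open>N\<close> keeps the number of null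
  sets countable.\<close>

lemma good_Union:
  assumes "\<omega> \<in> space M" "0 \<le> T"
  shows "\<exists>N::nat. 0 < N \<and> \<omega> \<in> good (real N) T"
proof -
  have "compact ((\<lambda>t. Q t \<omega>) ` {0..T})"
    by (intro compact_continuous_image continuous_on_subset[OF Q_continuous[OF assms(1)]]) auto
  then obtain a where a: "\<forall>t\<in>{0..T}. \<bar>Q t \<omega>\<bar> \<le> a"
    by (auto dest!: compact_imp_bounded simp: bounded_iff)
  obtain N :: nat where "max a 1 < real N" using reals_Archimedean2 by blast
  then show ?thesis using a assms(1) by (intro exI[of _ N]) (force simp: good_def)
qed

end

context linear_sde
begin

lemma error_bound_nonneg: "0 < T \<Longrightarrow> 0 \<le> error_bound N T n 0"
  by (simp add: error_bound_def)

text \<open>The initial value is encoded only through the integral equation at time 0. There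
  \<open>I 0\<close> is a limit in probability of zeros, hence almost surely below every
  \<open>1 / (k + 1)\<close> in absolute value.\<close>

lemma Q_initial: "AE \<omega> in M. Q 0 \<omega> = q0"
proof -
  obtain I where ito: "ito_integral M F B (\<lambda>t \<omega>. \<sigma> * Q t \<omega>) I"
    and sde: "AE \<omega> in M. \<forall>t\<ge>0. Q t \<omega> = q0 + (LINT s:{0..t}|lborel. - (\<gamma> s * Q s \<omega>)) + I t \<omega>"
    using sol by (auto simp: sde_solution_def)
  obtain S where S: "\<forall>k. simple_adapted F (S k)"
      "\<forall>t\<ge>0. converges_in_prob M (\<lambda>k. simple_integral (S k) B t) (I t)"
    using ito unfolding ito_integral_def by blast
  have "(\<lambda>k. simple_integral (S k) B 0) = (\<lambda>k \<omega>. 0)"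
    by (intro ext, rule simple_integral_0) (rule S(1)[rule_format])
  then have c: "converges_in_prob M (\<lambda>k \<omega>. 0) (I 0)"
    using S(2) by (metis order_refl)
  have [measurable]: "I 0 \<in> borel_measurable M" using c by (auto simp: converges_in_prob_def)
  have "AE \<omega> in M. \<bar>I 0 \<omega>\<bar> \<le> 1 / real (Suc k)" for k
  proof -
    have "0 < 1 / real (Suc k)" by simp
    with c have "(\<lambda>n::nat. prob {\<omega> \<in> space M. 1 / real (Suc k) < \<bar>0 - I 0 \<omega>\<bar>}) \<longlonglongrightarrow> 0"
      unfolding converges_in_prob_def by blast
    then have "prob {\<omega> \<in> space M. 1 / real (Suc k) < \<bar>I 0 \<omega>\<bar>} = 0"
      by (simp add: LIMSEQ_const_iff)
    then have "AE \<omega> in M. \<omega> \<notin> {\<omega> \<in> space M. 1 / real (Suc k) < \<bar>I 0 \<omega>\<bar>}"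
      by (subst (asm) prob_eq_0) auto
    then show ?thesis using AE_space by eventually_elim auto
  qed
  then have "AE \<omega> in M. \<forall>k. \<bar>I 0 \<omega>\<bar> \<le> 1 / real (Suc k)" by (simp add: AE_all_countable)
  then show ?thesis
    using sde AE_space
  proof eventually_elim
    case (elim \<omega>)
    have "I 0 \<omega> = 0"
    proof (rule ccontr)
      assume "I 0 \<omega> \<noteq> 0"
      then obtain k where "1 / real (Suc k) < \<bar>I 0 \<omega>\<bar>"
        using nat_approx_posE[of "\<bar>I 0 \<omega>\<bar>"] by auto
      then show False using elim(1) by (meson not_le)
    qed
    moreover have "(LINT s:{0..0}|lborel. - (\<gamma> s * Q s \<omega>)) = 0"
    proof -
      have "continuous_on {0..} (\<lambda>s. - (\<gamma> s * Q s \<omega>))"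
        by (intro continuous_intros \<gamma>_cont Q_continuous elim)
      from set_integral_split_continuous[OF this, of 0 0] show ?thesis by simp
    qed
    ultimately show ?case using elim(2) by (metis add.right_neutral order_refl)
  qed
qed

lemma euler_factors_nonneg:
  assumes "0 < T" "continuous_on {0..} (\<lambda>t. B t \<omega>)"
  shows "\<forall>\<^sub>F n in sequentially. \<forall>i<Suc n. 0 \<le> 1 - \<gamma> (real i * (T / Suc n)) * (T / Suc n)
     + \<sigma> * (B (real (Suc i) * (T / Suc n)) \<omega> - B (real i * (T / Suc n)) \<omega>)"
proof -
  have "uniformly_continuous_on {0..T} (\<lambda>t. B t \<omega>)"
    by (intro compact_uniformly_continuous continuous_on_subset[OF assms(2)]) auto
  \<comment> \<open>The leading 1 of each factor is shared out: an oscillation of \<open>B\<close>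
    below \<open>1 / (2 * \<sigma>)\<close> costs less than one half, and the drift, for a fine
    mesh, less than the other half.\<close>
  then obtain \<delta> where \<delta>: "0 < \<delta>"
    "\<And>s t. s \<in> {0..T} \<Longrightarrow> t \<in> {0..T} \<Longrightarrow> dist t s < \<delta> \<Longrightarrow> dist (B t \<omega>) (B s \<omega>) < 1 / (2 * \<sigma>)"
    unfolding uniformly_continuous_on_def using \<sigma>_pos by (metis mult_pos_pos zero_less_divide_1_iff zero_less_numeral)
  have T0: "(\<lambda>n. T / real (Suc n)) \<longlonglongrightarrow> 0"
    by (rule LIMSEQ_Suc[OF lim_const_over_n])
  have "\<forall>\<^sub>F n in sequentially. T / real (Suc n) < \<delta>"
    by (rule order_tendstoD(2)[OF T0 \<delta>(1)])
  moreover have "\<forall>\<^sub>F n in sequentially. d * (T / real (Suc n)) < 1 / 2"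
    by (rule order_tendstoD(2)[OF tendsto_mult_right_zero[OF T0]]) simp
  ultimately show ?thesis
  proof eventually_elim
    case (elim n)
    show ?case
    proof (intro allI impI)
      fix i assume i: "i < Suc n"
      let ?h = "T / real (Suc n)"
      have h: "0 < ?h" "real (Suc n) * ?h = T" using assms(1) by auto
      have le: "0 \<le> real i * ?h" "real i * ?h \<le> real (Suc i) * ?h" "real (Suc i) * ?h \<le> real (Suc n) * ?h"
        using i h(1) by (intro mult_right_mono mult_nonneg_nonneg; simp)+
      have "real (Suc i) * ?h - real i * ?h = ?h" by (simp add: left_diff_distrib[symmetric] del: times_divide_eq_right)
      then have "dist (real (Suc i) * ?h) (real i * ?h) < \<delta>"
        using elim(1) h(1) unfolding dist_real_def by linarith
      then have "\<bar>B (real (Suc i) * ?h) \<omega> - B (real i * ?h) \<omega>\<bar> < 1 / (2 * \<sigma>)"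
        using \<delta>(2)[of "real i * ?h" "real (Suc i) * ?h"] le h(2) unfolding dist_real_def by auto
      then have "\<sigma> * \<bar>B (real (Suc i) * ?h) \<omega> - B (real i * ?h) \<omega>\<bar> < \<sigma> * (1 / (2 * \<sigma>))"
        using \<sigma>_pos by (intro mult_strict_left_mono)
      then have "\<bar>\<sigma> * (B (real (Suc i) * ?h) \<omega> - B (real i * ?h) \<omega>)\<bar> < 1 / 2"
        using \<sigma>_pos by (simp add: abs_mult)
      moreover have "\<gamma> (real i * ?h) * ?h \<le> d * ?h"
        using \<gamma>_bounds(2)[OF le(1)] h(1) by (intro mult_right_mono) auto
      ultimately show "0 \<le> 1 - \<gamma> (real i * ?h) * ?h + \<sigma> * (B (real (Suc i) * ?h) \<omega> - B (real i * ?h) \<omega>)"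
        using elim(2) by linarith
    qed
  qed
qed

definition squared_error :: "nat \<Rightarrow> real \<Rightarrow> nat \<Rightarrow> 'a \<Rightarrow> real" where
  "squared_error N T n \<omega> = indicator (good (real N) T) \<omega> * (Q T \<omega> - euler T n (Suc n) \<omega>)\<^sup>2"

lemma squared_error_L1:
  assumes "0 < T" "0 < N"
  shows "integrable M (squared_error N T n)"
    and "(\<lambda>n. expectation (squared_error N T n)) \<longlonglongrightarrow> 0"
proof -
  have [measurable]: "good (real N) T \<in> events" "Q T \<in> borel_measurable M" "euler T n (Suc n) \<in> borel_measurable M" for n
    using assms good_events Q_measurable euler_measurable by auto
  have m: "squared_error N T n \<in> borel_measurable M" for n
    unfolding squared_error_def[abs_def] by measurable
  have nn: "0 \<le> squared_error N T n \<omega>" for n \<omega> by (simp add: squared_error_def)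
  have le: "(\<integral>\<^sup>+\<omega>. ennreal (squared_error N T n \<omega>) \<partial>M) \<le> ennreal (error_bound (real N) T n 0)" for n
  proof -
    have "(\<integral>\<^sup>+\<omega>. ennreal (squared_error N T n \<omega>) \<partial>M)
      = (\<integral>\<^sup>+\<omega>. indicator (good (real N) T) \<omega> * ennreal ((Q T \<omega> - euler T n (Suc n) \<omega>)\<^sup>2) \<partial>M)"
      by (intro nn_integral_cong) (auto simp: squared_error_def indicator_def)
    then show ?thesis using euler_error[of T "real N" n] assms by simp
  qed
  show int: "integrable M (squared_error N T n)" for n
    using le[of n] nn m by (intro integrableI_nonneg) (auto intro: le_less_trans)
  have up: "expectation (squared_error N T n) \<le> error_bound (real N) T n 0" for n
    using le[of n] nn error_bound_nonneg[OF assms(1)]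
    by (subst (asm) nn_integral_eq_integral[OF int]) auto
  have lo: "0 \<le> expectation (squared_error N T n)" for n
    using nn by (intro integral_nonneg_AE AE_I2)
  have "(\<lambda>n. error_bound (real N) T n 0) \<longlonglongrightarrow> 0"
    using error_bound_tendsto_0[of T "real N"] assms by simp
  from tendsto_sandwich[OF always_eventually always_eventually tendsto_const this, OF allI[OF lo] allI[OF up]]
  show "(\<lambda>n. expectation (squared_error N T n)) \<longlonglongrightarrow> 0" .
qed

end

subsection \<open>Comparison and hitting times\<close>

text \<open>Both schemes are driven by the same increments, and for almost every path they are
  ordered from some \<open>n\<close> on, which may depend on the path. The order passes to the limit
  along a subsequence on which both schemes converge almost surely on the good events.\<close>

lemma linear_sde_comparison_at:
  assumes "linear_sde M F B \<gamma>1 d1 \<sigma> q0 Q1" "linear_sde M F B \<gamma>2 d2 \<sigma> q0 Q2"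
    and "0 \<le> q0" "\<And>t. 0 \<le> t \<Longrightarrow> \<gamma>2 t \<le> \<gamma>1 t" "0 < T"
  shows "AE \<omega> in M. Q1 T \<omega> \<le> Q2 T \<omega>"
proof -
  interpret X: linear_sde M F B \<gamma>1 d1 \<sigma> q0 Q1 by fact
  interpret Y: linear_sde M F B \<gamma>2 d2 \<sigma> q0 Q2 by fact
  have "AE \<omega> in M. \<omega> \<in> X.good (real N) T \<longrightarrow> \<omega> \<in> Y.good (real N) T \<longrightarrow> Q1 T \<omega> \<le> Q2 T \<omega>"
    if N: "0 < N" for N :: nat
  proof -
    \<comment> \<open>Adding the two errors provides a common subsequence for both schemes.\<close>
    let ?v = "\<lambda>n \<omega>. X.squared_error N T n \<omega> + Y.squared_error N T n \<omega>"
    note XL = X.squared_error_L1[OF assms(5) N] and YL = Y.squared_error_L1[OF assms(5) N]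
    have nn: "0 \<le> X.squared_error N T n \<omega>" "0 \<le> Y.squared_error N T n \<omega>" for n \<omega>
      by (simp_all add: X.squared_error_def Y.squared_error_def)
    have "\<exists>r::nat\<Rightarrow>nat. strict_mono r \<and> (AE \<omega> in M. (\<lambda>n. ?v (r n) \<omega>) \<longlonglongrightarrow> 0)"
    proof (rule tendsto_L1_AE_subseq)
      show "integrable M (?v n)" for n using XL(1) YL(1) by simp
      have "X.expectation (\<lambda>\<omega>. norm (?v n \<omega>))
        = X.expectation (X.squared_error N T n) + X.expectation (Y.squared_error N T n)" for n
        using nn XL(1) YL(1) by simp
      then show "(\<lambda>n. X.expectation (\<lambda>\<omega>. norm (?v n \<omega>))) \<longlonglongrightarrow> 0"
        using tendsto_add[OF XL(2) YL(2)] by simp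
    qed
    then obtain r :: "nat \<Rightarrow> nat" where r: "strict_mono r" "AE \<omega> in M. (\<lambda>n. ?v (r n) \<omega>) \<longlonglongrightarrow> 0"
      by blast
    show ?thesis
      using r(2) X.continuous_paths
    proof eventually_elim
      case (elim \<omega>)
      show ?case
      proof (intro impI)
        assume G: "\<omega> \<in> X.good (real N) T" "\<omega> \<in> Y.good (real N) T"
        have "(\<lambda>n. X.squared_error N T (r n) \<omega>) \<longlonglongrightarrow> 0"
          by (rule tendsto_sandwich[OF _ _ tendsto_const elim(1)]) (use nn in \<open>auto intro!: always_eventually\<close>)
        then have "(\<lambda>n. Q1 T \<omega> - X.euler T (r n) (Suc (r n)) \<omega>) \<longlonglongrightarrow> 0"
          using G by (simp add: X.squared_error_def)
        from tendsto_diff[OF tendsto_const[of "Q1 T \<omega>"] this]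
        have X: "(\<lambda>n. X.euler T (r n) (Suc (r n)) \<omega>) \<longlonglongrightarrow> Q1 T \<omega>" by simp
        have "(\<lambda>n. Y.squared_error N T (r n) \<omega>) \<longlonglongrightarrow> 0"
          by (rule tendsto_sandwich[OF _ _ tendsto_const elim(1)]) (use nn in \<open>auto intro!: always_eventually\<close>)
        then have "(\<lambda>n. Q2 T \<omega> - Y.euler T (r n) (Suc (r n)) \<omega>) \<longlonglongrightarrow> 0"
          using G by (simp add: Y.squared_error_def)
        from tendsto_diff[OF tendsto_const[of "Q2 T \<omega>"] this]
        have Y: "(\<lambda>n. Y.euler T (r n) (Suc (r n)) \<omega>) \<longlonglongrightarrow> Q2 T \<omega>" by simp
        have "\<forall>\<^sub>F n in sequentially. X.euler T n (Suc n) \<omega> \<le> Y.euler T n (Suc n) \<omega>"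
          using X.euler_factors_nonneg[OF assms(5) elim(2)]
        proof eventually_elim
          case (elim n)
          \<comment> \<open>Monotonicity of products asks for nonnegativity of the smaller factors
            only; that of the larger ones follows.\<close>
          show ?case unfolding X.euler_def Y.euler_def
          proof (intro mult_left_mono prod_mono conjI assms(3))
            fix i assume i: "i \<in> {..<Suc n}"
            then show "0 \<le> 1 - \<gamma>1 (real i * (T / real (Suc n))) * (T / real (Suc n))
              + \<sigma> * (B (real (Suc i) * (T / real (Suc n))) \<omega> - B (real i * (T / real (Suc n))) \<omega>)"
              using elim by auto
            have "\<gamma>2 (real i * (T / real (Suc n))) * (T / real (Suc n)) \<le> \<gamma>1 (real i * (T / real (Suc n))) * (T / real (Suc n))"
              using assms(4,5) by (intro mult_right_mono) auto
            then show "1 - \<gamma>1 (real i * (T / real (Suc n))) * (T / real (Suc n))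
              + \<sigma> * (B (real (Suc i) * (T / real (Suc n))) \<omega> - B (real i * (T / real (Suc n))) \<omega>)
              \<le> 1 - \<gamma>2 (real i * (T / real (Suc n))) * (T / real (Suc n))
              + \<sigma> * (B (real (Suc i) * (T / real (Suc n))) \<omega> - B (real i * (T / real (Suc n))) \<omega>)"
              by linarith
          qed
        qed
        from eventually_subseq[OF r(1) this] show "Q1 T \<omega> \<le> Q2 T \<omega>"
          by (intro tendsto_le[OF sequentially_bot Y X])
      qed
    qed
  qed
  then have "AE \<omega> in M. \<forall>N::nat. 0 < N \<longrightarrow> \<omega> \<in> X.good (real N) T \<longrightarrow> \<omega> \<in> Y.good (real N) T \<longrightarrow> Q1 T \<omega> \<le> Q2 T \<omega>"
    by (simp add: AE_all_countable)
  then show ?thesis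
    using AE_space
  proof eventually_elim
    case (elim \<omega>)
    obtain N N' :: nat where N: "0 < N" "\<omega> \<in> X.good (real N) T" "0 < N'" "\<omega> \<in> Y.good (real N') T"
      using X.good_Union[OF elim(2)] Y.good_Union[OF elim(2)] assms(5) by (meson less_imp_le)
    \<comment> \<open>The good events increase with \<open>N\<close>, so the maximum serves both
      solutions.\<close>
    have "\<omega> \<in> X.good (real (max N N')) T" "\<omega> \<in> Y.good (real (max N N')) T"
      using N by (force simp: X.good_def Y.good_def)+
    then show ?case using elim(1) N by (metis max.strict_coboundedI1)
  qed
qed

text \<open>The exceptional null set of the comparison depends on the time. Only the positive
  rational times are collected; time 0 is covered by the common initial value and the remaining
  times by continuity.\<close>

lemma linear_sde_comparison:
  assumes "linear_sde M F B \<gamma>1 d1 \<sigma> q0 Q1" "linear_sde M F B \<gamma>2 d2 \<sigma> q0 Q2"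
    and "0 \<le> q0" "\<And>t. 0 \<le> t \<Longrightarrow> \<gamma>2 t \<le> \<gamma>1 t"
  shows "AE \<omega> in M. \<forall>t\<ge>0. Q1 t \<omega> \<le> Q2 t \<omega>"
proof -
  interpret X: linear_sde M F B \<gamma>1 d1 \<sigma> q0 Q1 by fact
  interpret Y: linear_sde M F B \<gamma>2 d2 \<sigma> q0 Q2 by fact
  have "AE \<omega> in M. \<forall>r\<in>\<rat> \<inter> {0<..}. Q1 r \<omega> \<le> Q2 r \<omega>"
    using linear_sde_comparison_at[OF assms]
    by (subst AE_ball_countable) (auto intro: countable_Int1 countable_rat)
  then show ?thesis
    using X.Q_initial Y.Q_initial AE_space
  proof eventually_elim
    case (elim \<omega>)
    show ?case
    proof (intro allI impI)
      fix t :: real assume t: "0 \<le> t"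
      have "Q1 t \<omega> - Q2 t \<omega> \<le> 0"
      \<comment> \<open>The end point \<open>t + 1\<close> keeps the interval nondegenerate when
        \<open>t = 0\<close>.\<close>
      proof (rule continuous_le_on_rationals[of 0 "t + 1" "\<lambda>t. Q1 t \<omega> - Q2 t \<omega>"])
        show "continuous_on {0..t + 1} (\<lambda>t. Q1 t \<omega> - Q2 t \<omega>)"
          by (intro continuous_intros continuous_on_subset[OF X.Q_continuous[OF elim(4)]]
              continuous_on_subset[OF Y.Q_continuous[OF elim(4)]]) auto
        show "Q1 r \<omega> - Q2 r \<omega> \<le> 0" if "r \<in> \<rat>" "0 \<le> r" for r
          using elim that by (cases "r = 0") auto
      qed (use t in auto)
      then show "Q1 t \<omega> \<le> Q2 t \<omega>" by simp
    qed
  qed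
qed

text \<open>By continuity the set of times at which the path equals \<open>x\<close> is closed, so a
  finite infimum is attained; for the empty set the infimum is infinite and lies above every real
  \<open>t\<close>.\<close>

lemma hitting_time_le_iff:
  assumes "continuous_on {0..} (\<lambda>t. X t \<omega>)"
  shows "hitting_time X x \<omega> \<le> ereal t \<longleftrightarrow> (\<exists>s\<in>{0..t}. X s \<omega> = x)"
proof
  assume le: "hitting_time X x \<omega> \<le> ereal t"
  let ?A = "{t. 0 \<le> t \<and> X t \<omega> = x}"
  have ne: "?A \<noteq> {}"
  proof
    assume "?A = {}"
    then have "hitting_time X x \<omega> = \<infinity>"
      unfolding hitting_time_def by (simp only: image_empty Inf_empty top_ereal_def)
    then show False using le by simp
  qed
  have "?A = {0..} \<inter> (\<lambda>t. X t \<omega>) -` {x}" by auto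
  then have cl: "closed ?A" using continuous_closed_preimage[OF assms] by simp
  have bd: "bdd_below ?A" by (intro bdd_belowI[of _ 0]) auto
  have I: "Inf ?A \<in> ?A" by (rule closed_contains_Inf[OF ne bd cl])
  have "ereal (Inf ?A) \<le> hitting_time X x \<omega>"
    unfolding hitting_time_def using bd by (auto intro!: Inf_greatest cInf_lower)
  then have "Inf ?A \<le> t" using le by (meson ereal_less_eq(3) order_trans)
  then show "\<exists>s\<in>{0..t}. X s \<omega> = x" using I by auto
next
  assume "\<exists>s\<in>{0..t}. X s \<omega> = x"
  then obtain s where "0 \<le> s" "s \<le> t" "X s \<omega> = x" by auto
  then have "hitting_time X x \<omega> \<le> ereal s" unfolding hitting_time_def by (intro Inf_lower) auto
  then show "hitting_time X x \<omega> \<le> ereal t" using \<open>s \<le> t\<close> by (meson ereal_less_eq(3) order_trans)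
qed

text \<open>A hit is rewritten as a countable condition, as needed for measurability. From right to
  left, the distance to \<open>x\<close> attains its minimum on the compact interval, and this
  minimum lies below every \<open>1 / (k + 1)\<close>.\<close>

lemma hits_iff_rationals:
  fixes f :: "real \<Rightarrow> real"
  assumes "continuous_on {0..t} f" "0 < t"
  shows "(\<exists>s\<in>{0..t}. f s = x) \<longleftrightarrow> (\<forall>k::nat. \<exists>r\<in>\<rat> \<inter> {0..t}. \<bar>f r - x\<bar> < 1 / real (Suc k))"
proof
  assume "\<exists>s\<in>{0..t}. f s = x"
  then obtain s where s: "s \<in> {0..t}" "f s = x" by blast
  show "\<forall>k::nat. \<exists>r\<in>\<rat> \<inter> {0..t}. \<bar>f r - x\<bar> < 1 / real (Suc k)"
  proof (rule ccontr)
    assume "\<not> ?thesis"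
    then obtain k where k: "\<forall>r\<in>\<rat> \<inter> {0..t}. 1 / real (Suc k) \<le> \<bar>f r - x\<bar>"
      by (auto simp: not_less)
    have "- \<bar>f s - x\<bar> \<le> - (1 / real (Suc k))"
    proof (rule continuous_le_on_rationals[OF _ assms(2) _ s(1)])
      show "continuous_on {0..t} (\<lambda>r. - \<bar>f r - x\<bar>)" by (intro continuous_intros assms)
      show "- \<bar>f r - x\<bar> \<le> - (1 / real (Suc k))" if "r \<in> \<rat>" "0 \<le> r" "r \<le> t" for r
        using k that by auto
    qed
    then show False using s(2) by simp
  qed
next
  assume *: "\<forall>k::nat. \<exists>r\<in>\<rat> \<inter> {0..t}. \<bar>f r - x\<bar> < 1 / real (Suc k)"
  have "\<exists>s\<in>{0..t}. \<forall>r\<in>{0..t}. \<bar>f s - x\<bar> \<le> \<bar>f r - x\<bar>"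
    using assms by (intro continuous_attains_inf continuous_intros) auto
  then obtain s where s: "s \<in> {0..t}" "\<And>r. r \<in> {0..t} \<Longrightarrow> \<bar>f s - x\<bar> \<le> \<bar>f r - x\<bar>" by blast
  have "f s = x"
  proof (rule ccontr)
    assume "f s \<noteq> x"
    then obtain k where k: "1 / real (Suc k) < \<bar>f s - x\<bar>"
      using nat_approx_posE[of "\<bar>f s - x\<bar>"] by auto
    obtain r where "r \<in> {0..t}" "\<bar>f r - x\<bar> < 1 / real (Suc k)" using * by blast
    with s(2) k show False by force
  qed
  then show "\<exists>s\<in>{0..t}. f s = x" using s(1) by blast
qed

lemma hitting_time_nonneg: "0 \<le> hitting_time X x \<omega>"
  unfolding hitting_time_def by (intro Inf_greatest) auto

lemma hitting_time_measurable:
  assumes X: "\<And>t. 0 \<le> t \<Longrightarrow> X t \<in> borel_measurable M"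
    and c: "\<And>\<omega>. \<omega> \<in> space M \<Longrightarrow> continuous_on {0..} (\<lambda>t. X t \<omega>)"
  shows "hitting_time X x \<in> borel_measurable M"
proof (rule borel_measurableI_le)
  fix y :: ereal
  show "{\<omega> \<in> space M. hitting_time X x \<omega> \<le> y} \<in> sets M"
  proof (cases y)
    case (real t)
    consider "t < 0" | "t = 0" | "0 < t" by linarith
    then show ?thesis
    proof cases
      case 1
      then have "ereal t < hitting_time X x \<omega>" for \<omega>
        using less_le_trans[OF _ hitting_time_nonneg, of "ereal t"] by simp
      then have "{\<omega> \<in> space M. hitting_time X x \<omega> \<le> y} = {}" using real by (auto simp: not_le)
      then show ?thesis by (simp only: sets.empty_sets)
    next
      case 2
      then have "{\<omega> \<in> space M. hitting_time X x \<omega> \<le> y} = {\<omega> \<in> space M. X 0 \<omega> = x}"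
        using hitting_time_le_iff[where X=X, OF c] real by auto
      then show ?thesis using X[of 0] by simp
    next
      case 3
      have "{\<omega> \<in> space M. hitting_time X x \<omega> \<le> y}
        = {\<omega> \<in> space M. \<forall>k::nat. \<exists>r\<in>\<rat> \<inter> {0..t}. \<bar>X r \<omega> - x\<bar> < 1 / real (Suc k)}"
      proof -
        have "hitting_time X x \<omega> \<le> y \<longleftrightarrow> (\<forall>k::nat. \<exists>r\<in>\<rat> \<inter> {0..t}. \<bar>X r \<omega> - x\<bar> < 1 / real (Suc k))"
          if "\<omega> \<in> space M" for \<omega>
          unfolding real hitting_time_le_iff[where X=X and \<omega>=\<omega>, OF c[OF that]]
          by (intro hits_iff_rationals continuous_on_subset[OF c[OF that]] 3) auto
        then show ?thesis by auto
      qed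
      moreover have "{\<omega> \<in> space M. \<bar>X r \<omega> - x\<bar> < 1 / real (Suc k)} \<in> sets M" if "r \<in> \<rat> \<inter> {0..t}" for r k
      proof -
        have [measurable]: "X r \<in> borel_measurable M" using X that by auto
        show ?thesis by measurable
      qed
      ultimately show ?thesis
        by (auto intro!: sets.sets_Collect_countable_All sets.sets_Collect_countable_Ex' countable_Int1 countable_rat)
    qed
  next
    case MInf
    have "\<not> hitting_time X x \<omega> \<le> - \<infinity>" for \<omega>
      using hitting_time_nonneg[of X x \<omega>] by auto
    then show ?thesis using MInf by simp
  qed simp
qed

lemma hitting_time_mono:
  assumes "\<And>t. 0 \<le> t \<Longrightarrow> X t \<omega> \<le> Y t \<omega>" "x \<le> X 0 \<omega>" "continuous_on {0..} (\<lambda>t. X t \<omega>)"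
  shows "hitting_time X x \<omega> \<le> hitting_time Y x \<omega>"
  unfolding hitting_time_def[of Y]
proof (rule Inf_greatest)
  fix z assume "z \<in> ereal ` {t. 0 \<le> t \<and> Y t \<omega> = x}"
  then obtain t where t: "z = ereal t" "0 \<le> t" "Y t \<omega> = x" by auto
  then have "X t \<omega> \<le> x" using assms(1) by auto
  then obtain s where "0 \<le> s" "s \<le> t" "X s \<omega> = x"
    using IVT2'[of "\<lambda>t. X t \<omega>" t x 0] assms(2) t(2) continuous_on_subset[OF assms(3), of "{0..t}"] by auto
  then show "hitting_time X x \<omega> \<le> z"
    using hitting_time_le_iff[where X=X and \<omega>=\<omega>, OF assms(3)] t(1) by auto
qed

theorem proposition5:
  fixes M :: "'a measure" and F :: "real \<Rightarrow> 'a measure" and B :: "real \<Rightarrow> 'a \<Rightarrow> real"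
    and Q :: "real \<Rightarrow> real \<Rightarrow> 'a \<Rightarrow> real"
    and q0 d0 \<sigma> x b1 b2 :: real
  assumes "q0 > 0" and "d0 > 0" and "\<sigma> > 0" and "x < q0"
    and "brownian_motion M F B"
    and "\<And>b. 0 \<le> b \<Longrightarrow> b \<le> 1 \<Longrightarrow>
      sde_solution M F B (\<lambda>t q. - (d0 * q / (1 + b * d0 * t))) (\<lambda>t q. \<sigma> * q) q0 (Q b)"
    and "0 \<le> b1" and "b1 \<le> b2" and "b2 \<le> 1"
  shows "stochastic_le M (hitting_time (Q b1) x) (hitting_time (Q b2) x)"
proof -
  \<comment> \<open>For nonnegative \<open>b\<close> and \<open>t\<close> the denominator is at
    least 1, so \<open>d0\<close> bounds the rate; the denominator grows with \<open>b\<close>, so a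
    larger \<open>b\<close> means weaker damping and a larger solution.\<close>
  let ?\<gamma> = "\<lambda>b t. d0 / (1 + b * d0 * t)"
  interpret brownian_motion M F B by fact
  have pos: "1 \<le> 1 + b * d0 * t" if "0 \<le> b" "0 \<le> t" for b t
    using that assms(2) by simp
  have lin: "linear_sde M F B (?\<gamma> b) d0 \<sigma> q0 (Q b)" if b: "0 \<le> b" "b \<le> 1" for b
  proof unfold_locales
    show "continuous_on {0..} (?\<gamma> b)"
      using pos[OF b(1)] by (intro continuous_intros) force
    show "0 \<le> ?\<gamma> b t" "?\<gamma> b t \<le> d0" if "0 \<le> t" for t
      using pos[OF b(1) that] assms(2) by (auto simp: divide_le_eq)
    show "sde_solution M F B (\<lambda>t q. - (?\<gamma> b t * q)) (\<lambda>t q. \<sigma> * q) q0 (Q b)"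
      using assms(6)[OF b] by simp
  qed (use assms in auto)
  have b: "0 \<le> b1" "b1 \<le> 1" "0 \<le> b2" "b2 \<le> 1" using assms by auto
  interpret X: linear_sde M F B "?\<gamma> b1" d0 \<sigma> q0 "Q b1" by (rule lin[OF b(1,2)])
  interpret Y: linear_sde M F B "?\<gamma> b2" d0 \<sigma> q0 "Q b2" by (rule lin[OF b(3,4)])
  have "?\<gamma> b2 t \<le> ?\<gamma> b1 t" if "0 \<le> t" for t
    using pos[OF b(1) that] pos[OF b(3) that] assms(2,8) that
    by (intro divide_left_mono add_left_mono mult_right_mono mult_pos_pos) auto
  from linear_sde_comparison[OF lin[OF b(1,2)] lin[OF b(3,4)] _ this] assms(1)
  have cmp: "AE \<omega> in M. \<forall>t\<ge>0. Q b1 t \<omega> \<le> Q b2 t \<omega>" by simp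
  have m [measurable]: "hitting_time (Q b1) x \<in> borel_measurable M" "hitting_time (Q b2) x \<in> borel_measurable M"
    by (intro hitting_time_measurable X.Q_measurable X.Q_continuous Y.Q_measurable Y.Q_continuous; assumption)+
  have "AE \<omega> in M. hitting_time (Q b1) x \<omega> \<le> hitting_time (Q b2) x \<omega>"
    using cmp X.Q_initial AE_space
    by eventually_elim (use assms(4) X.Q_continuous in \<open>auto intro!: hitting_time_mono\<close>)
  then have "prob {\<omega> \<in> space M. ereal t < hitting_time (Q b1) x \<omega>}
      \<le> prob {\<omega> \<in> space M. ereal t < hitting_time (Q b2) x \<omega>}" for t
    by (intro finite_measure_mono_AE) (auto elim!: eventually_mono intro: less_le_trans)
  then show ?thesis using m by (simp add: stochastic_le_def)
qed

end
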